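(* Let $K$ be a field of characteristic zero, $n\ge1$ and $r\ge 0$. The (images of the) $(n+1)$-noncrossing diagrams in $D(0,r)$ form a basis of the $K$-vector space $\mathrm{Hom}_{\mathsf{D}_{\mathrm{Sp}(2n)}/\mathrm{Pf}^{(n)}}(0,r)$.
   Context: $D(r,s)$ denotes the set of perfect matchings of $[r]\amalg[s]$; so $D(0,r)$ is the set of perfect matchings of $\{1,\dots,r\}$. $\mathsf{D}_{\mathrm{Sp}(2n)}$ is the Brauer category with parameter $\delta=-2n$: objects $\mathbb N$, $\mathrm{Hom}(r,s)$ the $K$-vector space with basis $D(r,s)$, composition of diagrams by stacking, each closed loop being removed and replaced by a factor $\delta$. For a $2(n+1)$-element subset $S\subseteq[r]\amalg[s]$ and a perfect matching $f$ of $([r]\amalg[s])\setminus S$, put $\mathrm{Pf}(f)=\sum_m (m\cup f)$, the sum over all perfect matchings $m$ of $S$. The ideal $\mathrm{Pf}^{(n)}$ has $\mathrm{Pf}^{(n)}(r,s)$ equal to the span of all such $\mathrm{Pf}(f)$, and $\mathrm{Hom}_{\mathsf{D}_{\mathrm{Sp}(2n)}/\mathrm{Pf}^{(n)}}(r,s)=\mathrm{Hom}_{\mathsf{D}_{\mathrm{Sp}(2n)}}(r,s)/\mathrm{Pf}^{(n)}(r,s)$. An $m$-crossing in $d\in D(0,r)$ is a set of $m$ strands $(a_1,b_1),\dots,(a_m,b_m)$ of $d$ with $a_1<a_2<\dots<a_m<b_1<b_2<\dots<b_m$. The diagram $d$ is $(n+1)$-noncrossing if it contains no $(n+1)$-crossing.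 *)

theory Defs
  imports
    "Jordan_Normal_Form.VS_Connect"
    "HOL-Algebra.AbelCoset"
    "HOL-Library.Poly_Mapping"
    "HOL-Library.Disjoint_Sets"
begin

text \<open>The additive cosets of a submodule \<open>N\<close>, with operations induced from \<open>M\<close>. The record
  fields \<open>mult\<close> and \<open>one\<close> have no meaning for a module, here and below.\<close>

definition quot_module :: "('a, 'b, 'm) module_scheme \<Rightarrow> 'b set \<Rightarrow> ('a, 'b set) module" where
  "quot_module M N =
    \<lparr>carrier = a_rcosets\<^bsub>M\<^esub> N, mult = undefined, one = undefined, zero = N, add = set_add M,
     smult = (\<lambda>a X. \<Union>x\<in>X. N +>\<^bsub>M\<^esub> (a \<odot>\<^bsub>M\<^esub> x))\<rparr>"

context Module.module
begin

context
  fixes N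
  assumes sub: "LinearCombinations.submodule R N M"
begin

interpretation N: LinearCombinations.submodule R N M
  by (rule sub)

lemma submodule_HOL_Algebra: "Module.submodule N R M"
  by (rule submoduleI) (use N.subset in \<open>auto simp flip: smult_minus_1\<close>)

interpretation N: abelian_subgroup N M
proof (rule abelian_subgroupI3)
  show "additive_subgroup N M"
    using submodule_HOL_Algebra by (simp add: additive_subgroup.intro Module.submodule_def)
  show "abelian_group M" ..
qed

lemma smult_quot_module:
  assumes "a \<in> carrier R" "x \<in> carrier M"
  shows "a \<odot>\<^bsub>quot_module M N\<^esub> (N +>\<^bsub>M\<^esub> x) = N +>\<^bsub>M\<^esub> (a \<odot>\<^bsub>M\<^esub> x)"
proof -
  have coset: "N +>\<^bsub>M\<^esub> (a \<odot>\<^bsub>M\<^esub> y) = N +>\<^bsub>M\<^esub> (a \<odot>\<^bsub>M\<^esub> x)" if "y \<in> N +>\<^bsub>M\<^esub> x" for y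
  proof -
    obtain h where h: "h \<in> N" "y = h \<oplus>\<^bsub>M\<^esub> x"
      using \<open>y \<in> N +>\<^bsub>M\<^esub> x\<close> by (auto simp: a_r_coset_def')
    have "a \<odot>\<^bsub>M\<^esub> y = a \<odot>\<^bsub>M\<^esub> h \<oplus>\<^bsub>M\<^esub> a \<odot>\<^bsub>M\<^esub> x"
      using h assms N.a_Hcarr by (simp add: smult_r_distr)
    moreover have "a \<odot>\<^bsub>M\<^esub> h \<in> N"
      using h assms by blast
    ultimately have "a \<odot>\<^bsub>M\<^esub> y \<in> N +>\<^bsub>M\<^esub> (a \<odot>\<^bsub>M\<^esub> x)"
      by (auto simp: a_r_coset_def')
    then show ?thesis
      by (rule M.a_repr_independence[symmetric]) (use assms N.a_subgroup in auto)
  qed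
  have "a \<odot>\<^bsub>quot_module M N\<^esub> (N +>\<^bsub>M\<^esub> x) = (\<Union>y\<in>N +>\<^bsub>M\<^esub> x. N +>\<^bsub>M\<^esub> (a \<odot>\<^bsub>M\<^esub> y))"
    by (simp add: quot_module_def)
  also have "\<dots> = (\<Union>y\<in>N +>\<^bsub>M\<^esub> x. N +>\<^bsub>M\<^esub> (a \<odot>\<^bsub>M\<^esub> x))"
    by (rule SUP_cong[OF refl coset])
  also have "\<dots> = N +>\<^bsub>M\<^esub> (a \<odot>\<^bsub>M\<^esub> x)"
    using N.a_rcos_self[OF assms(2)] by blast
  finally show ?thesis .
qed

lemma add_quot_module:
  assumes "x \<in> carrier M" "y \<in> carrier M"
  shows "(N +>\<^bsub>M\<^esub> x) \<oplus>\<^bsub>quot_module M N\<^esub> (N +>\<^bsub>M\<^esub> y) = N +>\<^bsub>M\<^esub> (x \<oplus>\<^bsub>M\<^esub> y)"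
  using N.a_rcos_sum assms by (simp add: quot_module_def)

lemma carrier_quot_module: "carrier (quot_module M N) = (\<lambda>x. N +>\<^bsub>M\<^esub> x) ` carrier M"
  by (auto simp: quot_module_def A_RCOSETS_def')

lemma module_quot_module: "Module.module R (quot_module M N)"
proof (rule moduleI)
  show "cring R" ..
  show "abelian_group (quot_module M N)"
  proof (rule abelian_groupI)
    have zero: "\<zero>\<^bsub>quot_module M N\<^esub> = N +>\<^bsub>M\<^esub> \<zero>\<^bsub>M\<^esub>"
      using N.subset by (simp add: quot_module_def)
    show "\<zero>\<^bsub>quot_module M N\<^esub> \<in> carrier (quot_module M N)"
      unfolding zero carrier_quot_module by blast
    fix X assume "X \<in> carrier (quot_module M N)"
    then obtain x where x: "x \<in> carrier M" "X = N +>\<^bsub>M\<^esub> x"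
      by (auto simp: carrier_quot_module)
    then show "\<zero>\<^bsub>quot_module M N\<^esub> \<oplus>\<^bsub>quot_module M N\<^esub> X = X"
      unfolding zero by (simp add: add_quot_module)
    show "\<exists>Y\<in>carrier (quot_module M N). Y \<oplus>\<^bsub>quot_module M N\<^esub> X = \<zero>\<^bsub>quot_module M N\<^esub>"
      unfolding zero using x
      by (intro bexI[of _ "N +>\<^bsub>M\<^esub> (\<ominus>\<^bsub>M\<^esub> x)"])
        (auto simp: add_quot_module carrier_quot_module M.l_neg)
    fix Y assume "Y \<in> carrier (quot_module M N)"
    then obtain y where y: "y \<in> carrier M" "Y = N +>\<^bsub>M\<^esub> y"
      by (auto simp: carrier_quot_module)
    show "X \<oplus>\<^bsub>quot_module M N\<^esub> Y \<in> carrier (quot_module M N)"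
      using x y by (simp add: add_quot_module carrier_quot_module)
    show "X \<oplus>\<^bsub>quot_module M N\<^esub> Y = Y \<oplus>\<^bsub>quot_module M N\<^esub> X"
      using x y by (simp add: add_quot_module M.a_comm)
    fix Z assume "Z \<in> carrier (quot_module M N)"
    then obtain z where z: "z \<in> carrier M" "Z = N +>\<^bsub>M\<^esub> z"
      by (auto simp: carrier_quot_module)
    show "X \<oplus>\<^bsub>quot_module M N\<^esub> Y \<oplus>\<^bsub>quot_module M N\<^esub> Z = X \<oplus>\<^bsub>quot_module M N\<^esub> (Y \<oplus>\<^bsub>quot_module M N\<^esub> Z)"
      using x y z by (simp add: add_quot_module M.a_assoc)
  qed
next
  fix a X assume a: "a \<in> carrier R" and "X \<in> carrier (quot_module M N)"
  then obtain x where x: "x \<in> carrier M" "X = N +>\<^bsub>M\<^esub> x"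
    by (auto simp: carrier_quot_module)
  show "a \<odot>\<^bsub>quot_module M N\<^esub> X \<in> carrier (quot_module M N)"
    using a x by (simp add: smult_quot_module carrier_quot_module)
  fix b assume b: "b \<in> carrier R"
  show "(a \<oplus> b) \<odot>\<^bsub>quot_module M N\<^esub> X =
      a \<odot>\<^bsub>quot_module M N\<^esub> X \<oplus>\<^bsub>quot_module M N\<^esub> b \<odot>\<^bsub>quot_module M N\<^esub> X"
    using a b x by (simp add: smult_quot_module add_quot_module smult_l_distr)
  show "(a \<otimes> b) \<odot>\<^bsub>quot_module M N\<^esub> X =
      a \<odot>\<^bsub>quot_module M N\<^esub> (b \<odot>\<^bsub>quot_module M N\<^esub> X)"
    using a b x by (simp add: smult_quot_module smult_assoc1)
next
  fix X assume "X \<in> carrier (quot_module M N)"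
  then show "\<one> \<odot>\<^bsub>quot_module M N\<^esub> X = X"
    by (auto simp: carrier_quot_module smult_quot_module)
next
  fix a X Y
  assume a: "a \<in> carrier R" and "X \<in> carrier (quot_module M N)" "Y \<in> carrier (quot_module M N)"
  then obtain x y where xy: "x \<in> carrier M" "X = N +>\<^bsub>M\<^esub> x" "y \<in> carrier M" "Y = N +>\<^bsub>M\<^esub> y"
    by (auto simp: carrier_quot_module)
  show "a \<odot>\<^bsub>quot_module M N\<^esub> (X \<oplus>\<^bsub>quot_module M N\<^esub> Y) =
      a \<odot>\<^bsub>quot_module M N\<^esub> X \<oplus>\<^bsub>quot_module M N\<^esub> a \<odot>\<^bsub>quot_module M N\<^esub> Y"
    using a xy by (simp add: smult_quot_module add_quot_module smult_r_distr)
qed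

end

end

definition perfect_matchings :: "'a set \<Rightarrow> 'a set set set" where
  "perfect_matchings V = {m. partition_on V m \<and> (\<forall>e\<in>m. card e = 2)}"

text \<open>The disjoint union of \<open>{1..r}\<close> and \<open>{1..s}\<close>, tagged by \<open>Inl\<close> and \<open>Inr\<close>. In particular
  every strand of a diagram in \<open>diagrams 0 r\<close> has the form \<open>{Inr a, Inr b}\<close>.\<close>

definition nodes :: "nat \<Rightarrow> nat \<Rightarrow> (nat + nat) set" where
  "nodes r s = Inl ` {1..r} \<union> Inr ` {1..s}"

definition diagrams :: "nat \<Rightarrow> nat \<Rightarrow> (nat + nat) set set set" where
  "diagrams r s = perfect_matchings (nodes r s)"

text \<open>The \<open>m\<close> strands of a crossing are \<open>(as ! i, bs ! i)\<close>, and \<open>as @ bs\<close> being strictly increasing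
  says \<open>a\<^sub>1 < \<dots> < a\<^sub>m < b\<^sub>1 < \<dots> < b\<^sub>m\<close>. The notion concerns diagrams in \<open>diagrams 0 r\<close>.\<close>

definition has_crossing :: "nat \<Rightarrow> (nat + nat) set set \<Rightarrow> bool" where
  "has_crossing m d \<longleftrightarrow>
    (\<exists>as bs. length as = m \<and> length bs = m \<and> sorted_wrt (<) (as @ bs) \<and>
      (\<forall>i<m. {Inr (as ! i), Inr (bs ! i)} \<in> d))"

definition noncrossing_diagrams :: "nat \<Rightarrow> nat \<Rightarrow> (nat + nat) set set set" where
  "noncrossing_diagrams m r = {d \<in> diagrams 0 r. \<not> has_crossing m d}"

text \<open>The space of morphisms from \<open>r\<close> to \<open>s\<close> in the Brauer category: the free vector space on
  \<open>diagrams r s\<close>. The loop parameter, \<open>-2n\<close> for the symplectic group \<open>Sp(2n)\<close>, enters only the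
  composition of morphisms, so it does not occur here.\<close>

definition brauer_hom :: "nat \<Rightarrow> nat \<Rightarrow> ('k::field, (nat + nat) set set \<Rightarrow>\<^sub>0 'k) module" where
  "brauer_hom r s =
    \<lparr>carrier = {v. Poly_Mapping.keys v \<subseteq> diagrams r s}, mult = undefined, one = undefined,
     zero = 0, add = (+), smult = (\<lambda>c. Poly_Mapping.map ((*) c))\<rparr>"

definition diagram_vec :: "(nat + nat) set set \<Rightarrow> (nat + nat) set set \<Rightarrow>\<^sub>0 'k::field" where
  "diagram_vec d = Poly_Mapping.single d 1"

definition pfaffian ::
    "(nat + nat) set \<Rightarrow> (nat + nat) set set \<Rightarrow> (nat + nat) set set \<Rightarrow>\<^sub>0 'k::field" where
  "pfaffian S f = (\<Sum>m\<in>perfect_matchings S. diagram_vec (m \<union> f))"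

definition pfaffian_ideal :: "nat \<Rightarrow> nat \<Rightarrow> nat \<Rightarrow> ((nat + nat) set set \<Rightarrow>\<^sub>0 'k::field) set" where
  "pfaffian_ideal n r s =
    LinearCombinations.module.span class_ring (brauer_hom r s)
      {pfaffian S f | S f. S \<subseteq> nodes r s \<and> card S = 2 * (n + 1) \<and>
        f \<in> perfect_matchings (nodes r s - S)}"

definition pf_quotient_hom ::
    "nat \<Rightarrow> nat \<Rightarrow> nat \<Rightarrow> ('k::field, ((nat + nat) set set \<Rightarrow>\<^sub>0 'k) set) module" where
  "pf_quotient_hom n r s = quot_module (brauer_hom r s) (pfaffian_ideal n r s)"

definition diagram_class ::
    "nat \<Rightarrow> nat \<Rightarrow> nat \<Rightarrow> (nat + nat) set set \<Rightarrow> ((nat + nat) set set \<Rightarrow>\<^sub>0 'k::field) set" where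
  "diagram_class n r s d = pfaffian_ideal n r s +>\<^bsub>brauer_hom r s\<^esub> diagram_vec d"

lemma lookup_smult:
  "Poly_Mapping.lookup (Poly_Mapping.map ((*) c) v) d = (c :: 'k::field) * Poly_Mapping.lookup v d"
  by transfer (auto simp: when_def)

lemma vectorspace_brauer_hom: "vectorspace class_ring (brauer_hom r s :: ('k::field, _) module)"
proof -
  have "abelian_group (brauer_hom r s :: ('k, _) module)"
  proof (rule abelian_groupI)
    fix x assume "x \<in> carrier (brauer_hom r s :: ('k, _) module)"
    then show "\<exists>y\<in>carrier (brauer_hom r s). y \<oplus>\<^bsub>brauer_hom r s\<^esub> x = \<zero>\<^bsub>brauer_hom r s :: ('k, _) module\<^esub>"
      by (intro bexI[of _ "- x"]) (auto simp: brauer_hom_def)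
  qed (auto simp: brauer_hom_def add.assoc add.commute dest!: set_mp[OF Poly_Mapping.keys_add])
  then have "Module.module class_ring (brauer_hom r s :: ('k, _) module)"
  proof (intro moduleI)
    show "cring (class_ring :: 'k ring)" ..
  qed (auto simp: brauer_hom_def lookup_smult in_keys_iff lookup_add algebra_simps intro!: poly_mapping_eqI)
  then show ?thesis
    by (intro vectorspace.intro class_field)
qed

lemma pfaffian_in_carrier:
  assumes "S \<subseteq> nodes r s" "f \<in> perfect_matchings (nodes r s - S)"
  shows "(pfaffian S f :: _ \<Rightarrow>\<^sub>0 'k::field) \<in> carrier (brauer_hom r s)"
proof -
  have "m \<union> f \<in> diagrams r s" if m: "m \<in> perfect_matchings S" for m
  proof -
    have "\<Union>m = S" "\<Union>f = nodes r s - S"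
      using m assms(2) by (simp_all add: perfect_matchings_def partition_on_def)
    then have "\<Union>(m \<union> f) = nodes r s" "\<Union>m \<inter> \<Union>f = {}"
      using assms(1) by blast+
    moreover from this(2) have "disjoint (m \<union> f)"
      using m assms(2) by (intro disjoint_union) (simp_all add: perfect_matchings_def partition_on_def)
    moreover have "{} \<notin> m \<union> f" "\<forall>e\<in>m \<union> f. card e = 2"
      using m assms(2) by (auto simp only: perfect_matchings_def partition_on_def)
    ultimately show ?thesis
      unfolding diagrams_def perfect_matchings_def partition_on_def by blast
  qed
  then have "Poly_Mapping.keys (pfaffian S f :: _ \<Rightarrow>\<^sub>0 'k) \<subseteq> diagrams r s"
    unfolding pfaffian_def diagram_vec_def
    by (intro order.trans[OF Poly_Mapping.keys_sum]) (auto split: if_splits)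
  then show ?thesis
    by (simp add: brauer_hom_def)
qed

lemma vectorspace_pf_quotient_hom:
  "vectorspace class_ring (pf_quotient_hom n r s :: ('k::field, _) module)"
proof -
  interpret V: vectorspace class_ring "brauer_hom r s :: ('k, _) module"
    by (rule vectorspace_brauer_hom)
  have "LinearCombinations.submodule class_ring (pfaffian_ideal n r s) (brauer_hom r s :: ('k, _) module)"
    unfolding pfaffian_ideal_def
    by (rule V.span_is_submodule) (use pfaffian_in_carrier in blast)
  then show ?thesis
    unfolding pf_quotient_hom_def
    by (intro vectorspace.intro V.module_quot_module class_field)
qed

end

theory Submission
  imports Defs "HOL-Combinatorics.Permutations" "HOL-Library.Sublist"
begin

text \<open>The noncrossing diagrams span: in the Pfaffian on the ends of an \<open>(n + 1)\<close>-crossing of a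
  diagram \<open>d\<close>, the term \<open>d\<close> has strictly larger weight than all others, where a strand
  \<open>a < b\<close> weighs \<open>a b + r (b - a)\<close>.

  For independence call a diagram colourable if its strands can be coloured with \<open>n\<close> colours so that
  strands of equal colour are never nested. Colouring the points and declaring the left ends positive
  amounts to choosing a basis tensor of the \<open>r\<close>-th power of the natural representation of
  \<open>Sp(2n)\<close>. The corresponding coefficient of a diagram is a sign or zero, it vanishes on the Pfaffian
  ideal, and on colourable diagrams these coefficients form a triangular matrix, because matching first
  in, first out within each colour maximises the sum of the products \<open>a b\<close>. Hence the colourable
  diagrams are independent in the quotient.

  It remains to see that there are at most as many noncrossing diagrams as colourable ones. Row insertion
  turns a diagram into a closed walk in Young's lattice. A diagram without \<open>(n + 1)\<close>-crossing gives
  a walk through shapes with at most \<open>n\<close> rows. The transposed walk comes from another diagram, whose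
  shapes have at most \<open>n\<close> columns, and the column in which a left end enters the first row is a
  colouring of that diagram.\<close>

section \<open>Row insertion\<close>

text \<open>The noncrossing diagrams are never tested against the functionals: triangularity rests
  on first in, first out matching within a colour, a condition on nestings, whereas straightening
  yields a condition on crossings. Nesting is a partial order on strands, so by Mirsky's theorem
  \<open>n\<close> colours suffice exactly when no \<open>n + 1\<close> strands are pairwise nested.
  The count is thus the known symmetry between crossings and nestings, by transposing oscillating
  tableaux. An inequality is enough, since the noncrossing diagrams bound the dimension of the
  quotient from above and the colourable ones from below; the insertion columns give a colouring
  directly.

  The functionals kill a Pfaffian for a reason of rank: unless all terms vanish, half of the
  \<open>2 * (n + 1)\<close> points are positive, and up to sign the sum is the determinant of the
  0-1 matrix of size \<open>n + 1\<close> recording which positive and negative points share a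
  colour. With \<open>n\<close> colours two of its rows agree.\<close>

fun row_insert :: "nat \<Rightarrow> nat list list \<Rightarrow> nat list list" where
  "row_insert x [] = [[x]]"
| "row_insert x (R # T) =
    (case dropWhile (\<lambda>z. z < x) R of
      [] \<Rightarrow> (R @ [x]) # T
    | y # ys \<Rightarrow> (takeWhile (\<lambda>z. z < x) R @ x # ys) # row_insert y T)"

definition dominates :: "nat list \<Rightarrow> nat list \<Rightarrow> bool" where
  "dominates R R' \<longleftrightarrow> length R' \<le> length R \<and> (\<forall>j<length R'. R ! j < R' ! j)"

abbreviation entries :: "nat list list \<Rightarrow> nat set" where
  "entries T \<equiv> \<Union>(set ` set T)"

text \<open>Entries are distinct but need not form an initial segment, since they are labels of
  points. Empty rows are excluded so that \<open>cells\<close> determines the list of row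
  lengths.\<close>

fun tableau :: "nat list list \<Rightarrow> bool" where
  "tableau [] \<longleftrightarrow> True"
| "tableau (R # T) \<longleftrightarrow>
    R \<noteq> [] \<and> sorted_wrt (<) R \<and> set R \<inter> entries T = {} \<and> (case T of [] \<Rightarrow> True | R' # _ \<Rightarrow> dominates R R') \<and> tableau T"

text \<open>Any index past the last row opens one new row, so statements about \<open>cells\<close>
  assume \<open>i \<le> length T\<close>.\<close>

fun add_cell :: "'a list list \<Rightarrow> nat \<Rightarrow> 'a \<Rightarrow> 'a list list" where
  "add_cell [] i x = [[x]]"
| "add_cell (R # T) 0 x = (R @ [x]) # T"
| "add_cell (R # T) (Suc i) x = R # add_cell T i x"

fun cells :: "nat list list \<Rightarrow> (nat \<times> nat) set" where
  "cells [] = {}"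
| "cells (R # T) = {0} \<times> {..<length R} \<union> map_prod Suc id ` cells T"

lemma row_cases:
  assumes "sorted_wrt (<) R"
  obtains "\<forall>z\<in>set R. z < x" "\<And>T. row_insert x (R # T) = (R @ [x]) # T"
  | R1 y R2 where "R = R1 @ y # R2" "\<forall>z\<in>set R1. z < x" "x \<le> y" "\<forall>z\<in>set R2. y < z"
      "\<And>T. row_insert x (R # T) = (R1 @ x # R2) # row_insert y T"
proof (cases "dropWhile (\<lambda>z. z < x) R")
  case Nil
  then have "\<forall>z\<in>set R. z < x" by (simp add: dropWhile_eq_Nil_conv)
  then show thesis using Nil by (intro that(1)) (simp_all only: row_insert.simps list.case)
next
  case (Cons y ys)
  define R1 where "R1 = takeWhile (\<lambda>z. z < x) R"
  have R: "R = R1 @ y # ys" using Cons unfolding R1_def by (metis takeWhile_dropWhile_id)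
  have "\<forall>z\<in>set R1. z < x" unfolding R1_def using set_takeWhileD by fastforce
  moreover have "x \<le> y" using Cons by (metis dropWhile_eq_Cons_conv linorder_not_less)
  moreover have "\<forall>z\<in>set ys. y < z" using assms R by (simp add: sorted_wrt_append)
  moreover have "row_insert x (R # T) = (R1 @ x # ys) # row_insert y T" for T
    using Cons by (simp add: R1_def)
  ultimately show thesis using that(2) R by blast
qed

lemma row_insert_bump:
  assumes "\<forall>z\<in>set R1. z < x" "x \<le> y"
  shows "row_insert x ((R1 @ y # R2) # T) = (R1 @ x # R2) # row_insert y T"
proof -
  have "dropWhile (\<lambda>z. z < x) (R1 @ y # R2) = y # R2" "takeWhile (\<lambda>z. z < x) (R1 @ y # R2) = R1"
    using assms by (simp_all add: dropWhile_append takeWhile_append)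
  then show ?thesis by simp
qed

lemma row_insert_append:
  assumes "\<forall>z\<in>set R. z < x"
  shows "row_insert x (R # T) = (R @ [x]) # T"
proof -
  have "dropWhile (\<lambda>z. z < x) R = []" using assms by (simp only: dropWhile_eq_Nil_conv)
  then show ?thesis by (simp only: row_insert.simps list.case)
qed

lemma entries_row_insert:
  assumes "tableau T"
  shows "entries (row_insert x T) = insert x (entries T)"
  using assms
proof (induction T arbitrary: x)
  case (Cons R T)
  from Cons.prems have s: "sorted_wrt (<) R" and t: "tableau T" by auto
  from s show ?case
    by (cases rule: row_cases[of R x]) (auto simp: Cons.IH[OF t] simp del: row_insert.simps)
qed simp

text \<open>The bumping path moves weakly left. The letter \<open>y\<close> stood in column
  \<open>length R1\<close>, where the entry below exceeds it, if there is one; so \<open>y\<close>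
  enters \<open>R'\<close> in that column or further left, under an entry of the new row that is
  smaller than \<open>y\<close>.\<close>

lemma dominates_bump:
  assumes d: "dominates (R1 @ y # R2) R'" and x: "x \<le> y" and s: "sorted_wrt (<) R'" 
    and R1: "\<forall>z\<in>set R1. z < y"  and R2: "\<forall>z\<in>set R2. y < z"  "x < y"
  shows "dominates (R1 @ x # R2) (hd (row_insert y (R' # T)))"
  using s
proof (cases rule: row_cases[of R' y])
  case 1
  have len: "length R' \<le> length R1"
  proof (rule ccontr)
    assume "\<not> ?thesis"
    then have l: "length R1 < length R'" by simp
    then have "y < R' ! length R1" using d unfolding dominates_def by (metis nth_append_length)
    then show False using 1(1) l by (meson nth_mem not_less_iff_gr_or_eq)
  qed
  show ?thesis unfolding 1(2) using len d R1 R2 unfolding dominates_def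
    by (auto simp: nth_append less_Suc_eq nth_Cons split: nat.splits if_splits)
next
  case (2 S1 z S2)
  have len: "length S1 \<le> length R1"
  proof (rule ccontr)
    assume "\<not> ?thesis"
    then have l: "length R1 < length S1" by simp
    then have "y < R' ! length R1" using d 2(1) unfolding dominates_def by (metis nth_append_length length_append trans_less_add1)
    moreover have "R' ! length R1 = S1 ! length R1" using l 2 by (simp add: nth_append)
    ultimately show False using 2(2) l by (metis nth_mem not_less_iff_gr_or_eq)
  qed
  have R1': "R1 ! j < y" if "j < length R1" for j using that R1 by auto
  have le: "length R' \<le> length R1 + 1 + length R2" using d unfolding dominates_def by simp
  show ?thesis unfolding 2(5) dominates_def list.sel
  proof (intro conjI allI impI)
    show "length (S1 @ y # S2) \<le> length (R1 @ x # R2)" using le 2(1) by simp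
    fix j assume j: "j < length (S1 @ y # S2)"
    then have j': "(R1 @ y # R2) ! j < R' ! j" using d 2(1) unfolding dominates_def by simp
    consider "j = length S1" | "j \<noteq> length S1" by blast
    then show "(R1 @ x # R2) ! j < (S1 @ y # S2) ! j"
    proof cases
      case 1
      then show ?thesis using len R1' \<open>x < y\<close> by (cases "j < length R1") (auto simp: nth_append)
    next
      case ne: 2
      have "(S1 @ y # S2) ! j = R' ! j" using ne 2(1) by (auto simp: nth_append nth_Cons split: nat.splits)
      moreover have "(R1 @ x # R2) ! j \<le> (R1 @ y # R2) ! j" using x
        by (auto simp: nth_append nth_Cons split: nat.splits)
      ultimately show ?thesis using j' by simp
    qed
  qed
qed

lemma row_insert_ne: "row_insert x T \<noteq> []"
  by (cases T) (auto split: list.splits)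

lemma dominates_bump_head:
  assumes "tableau (R # T)" "R = R1 @ y # R2" "x < y"
  shows "case row_insert y T of [] \<Rightarrow> True | R' # _ \<Rightarrow> dominates (R1 @ x # R2) R'"
proof (cases T)
  case Nil
  have "\<forall>z\<in>set R1. z < y" using assms by (auto simp: sorted_wrt_append)
  then show ?thesis using assms Nil by (cases R1) (auto simp: dominates_def)
next
  case (Cons R' T')
  have "dominates (R1 @ x # R2) (hd (row_insert y (R' # T')))"
    by (rule dominates_bump) (use assms Cons in \<open>auto simp: sorted_wrt_append\<close>)
  then show ?thesis using Cons row_insert_ne[of y T] by (cases "row_insert y T") auto
qed

lemma tableau_row_insert:
  assumes "tableau T" "x \<notin> entries T"
  shows "tableau (row_insert x T)"
  using assms
proof (induction T arbitrary: x)
  case (Cons R T)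
  from Cons.prems have s: "sorted_wrt (<) R" and t: "tableau T" by auto
  from s show ?case
  proof (cases rule: row_cases[of R x])
    case 1
    then show ?thesis using Cons.prems
      by (auto simp: sorted_wrt_append dominates_def nth_append simp del: row_insert.simps split: list.splits)
  next
    case (2 R1 y R2)
    then have "x \<noteq> y" using Cons.prems by auto
    then have xy: "x < y" using 2 by simp
    have y: "y \<notin> entries T" using Cons.prems 2(1) by auto
    have "case row_insert y T of [] \<Rightarrow> True | R' # _ \<Rightarrow> dominates (R1 @ x # R2) R'"
      by (rule dominates_bump_head[OF Cons.prems(1) 2(1) xy])
    moreover have "sorted_wrt (<) (R1 @ x # R2)" using s 2(1,2,4) xy by (fastforce simp: sorted_wrt_append)
    moreover have "set (R1 @ x # R2) \<inter> entries (row_insert y T) = {}"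
      using Cons.prems 2(1) xy s unfolding entries_row_insert[OF t] by (auto simp: sorted_wrt_append)
    ultimately show ?thesis using Cons.IH[OF t y] 2(5) by (simp del: row_insert.simps)
  qed
qed simp

text \<open>Knowing the shape before insertion means knowing where the new cell appeared, so both
  insertions stop in the same row. Above it the bumped letter \<open>y\<close> is known by
  induction, and \<open>x\<close> is the last entry of the new row that does not exceed
  \<open>y\<close>.\<close>

lemma row_insert_inj:
  assumes "row_insert x T = row_insert x' T'" "map length T = map length T'" "tableau T" "tableau T'"
  shows "x = x' \<and> T = T'"
  using assms
proof (induction T arbitrary: x x' T')
  case (Cons R T)
  then obtain S U where T': "T' = S # U" by (cases T') auto
  have s: "sorted_wrt (<) R" "sorted_wrt (<) S" using Cons.prems T' by auto
  have len: "length R = length S" using Cons.prems T' by simp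
  show ?case
  proof (cases rule: row_cases[OF s(1), of x])
    case 1
    note R = 1
    show ?thesis
    proof (cases rule: row_cases[OF s(2), of x'])
      case 1
      then show ?thesis using Cons.prems R T' by (simp del: row_insert.simps)
    next
      case (2 R1 y R2)
      then have "length (R @ [x]) = length S" using Cons.prems R T' by (simp del: row_insert.simps)
      then show ?thesis using len by simp
    qed
  next
    case (2 R1 y R2)
    note R = 2
    show ?thesis
    proof (cases rule: row_cases[OF s(2), of x'])
      case 1
      then have "R1 @ x # R2 = S @ [x']" using Cons.prems(1) R(5) T' by (simp del: row_insert.simps)
      then have "length R = length (S @ [x'])" using R(1) by (metis length_append length_Cons)
      then show ?thesis using len by simp
    next
      case (2 S1 y' S2)
      have eq: "R1 @ x # R2 = S1 @ x' # S2" "row_insert y T = row_insert y' U"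
        using Cons.prems(1) R(5) 2(5) T' by (simp_all del: row_insert.simps)
      have "y = y' \<and> T = U" by (rule Cons.IH[OF eq(2)]) (use Cons.prems T' in auto)
      moreover have "length R1 = length S1"
      proof (rule linorder_cases[of "length R1" "length S1"])
        assume l: "length R1 < length S1"
        have "(R1 @ x # R2) ! length S1 = x'" using eq(1) by simp
        then have "R2 ! (length S1 - length R1 - 1) = x'" using l by (simp add: nth_append nth_Cons')
        moreover have "length S1 - length R1 - 1 < length R2"
          using l arg_cong[OF eq(1), of length] by simp
        ultimately have "x' \<in> set R2" by (metis nth_mem)
        then show ?thesis using \<open>y = y' \<and> T = U\<close> R(4) 2(3) by fastforce
      next
        assume l: "length S1 < length R1"
        have "(S1 @ x' # S2) ! length R1 = x" using eq(1)[symmetric] by simp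
        then have "S2 ! (length R1 - length S1 - 1) = x" using l by (simp add: nth_append nth_Cons')
        moreover have "length R1 - length S1 - 1 < length S2"
          using l arg_cong[OF eq(1), of length] by simp
        ultimately have "x \<in> set S2" by (metis nth_mem)
        then show ?thesis using \<open>y = y' \<and> T = U\<close> R(3) 2(4) by fastforce
      qed
      ultimately show ?thesis using eq R(1) 2(1) T' by simp
    qed
  qed
qed (auto simp: Cons_eq_map_conv)

section \<open>Shapes as sets of cells\<close>

lemma length_row_insert: "\<exists>i \<le> length T. map length (row_insert x T) = map length (add_cell T i x)"
proof (induction T arbitrary: x)
  case (Cons R T)
  show ?case
  proof (cases "dropWhile (\<lambda>z. z < x) R")
    case Nil
    then have "row_insert x (R # T) = (R @ [x]) # T" by (simp only: row_insert.simps list.case)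
    then show ?thesis by (intro exI[of _ 0]) (simp del: row_insert.simps)
  next
    case (Cons y ys)
    obtain i where "i \<le> length T" "map length (row_insert y T) = map length (add_cell T i y)"
      using Cons.IH by blast
    moreover have "map length (add_cell T i y) = map length (add_cell T i x)" for T :: "nat list list" and i
      by (induction T i y rule: add_cell.induct) auto
    moreover have "length (takeWhile (\<lambda>z. z < x) R @ x # ys) = length R"
      using Cons by (metis length_Cons length_append takeWhile_dropWhile_id)
    ultimately show ?thesis using Cons by (intro exI[of _ "Suc i"]) (simp del: length_append)
  qed
qed simp

lemma in_cells: "(i, j) \<in> cells T \<longleftrightarrow> i < length T \<and> j < length (T ! i)"
proof (induction T arbitrary: i)
  case (Cons R T)
  have "(i, j) \<in> map_prod Suc id ` cells T \<longleftrightarrow> (\<exists>k. i = Suc k \<and> (k, j) \<in> cells T)"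
    by (auto simp: map_prod_def image_iff split: prod.splits)
  then show ?case using Cons.IH by (cases i) auto
qed simp

lemma cells_cong:
  assumes "map length T = map length T'"
  shows "cells T = cells T'"
proof -
  have "length T = length T'" using assms by (metis length_map)
  moreover have "length (T ! i) = length (T' ! i)" if "i < length T" for i
    using assms that calculation by (metis nth_map)
  ultimately show ?thesis by (auto simp: in_cells)
qed

definition row_length :: "nat list list \<Rightarrow> nat \<Rightarrow> nat" where
  "row_length T i = (if i < length T then length (T ! i) else 0)"

lemma row_length_simps [simp]:
  "row_length [] i = 0" "row_length (R # T) 0 = length R" "row_length (R # T) (Suc i) = row_length T i"
  by (simp_all add: row_length_def)

lemma cells_add_cell:
  "i \<le> length T \<Longrightarrow> cells (add_cell T i x) = insert (i, row_length T i) (cells T)"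
proof (induction T i x rule: add_cell.induct)
  case (3 R T i x)
  then show ?case by simp
qed (simp_all add: lessThan_Suc)

lemma new_cell: "(i, row_length T i) \<notin> cells T"
  by (auto simp: row_length_def in_cells)

lemma length_eq_if_cells_eq:
  assumes "cells T = cells T'" "[] \<notin> set T" "[] \<notin> set T'"
  shows "map length T = map length T'"
proof -
  have rl: "i < length T \<longleftrightarrow> (i, 0) \<in> cells T" if "[] \<notin> set T" for i T
    using that by (metis in_cells nth_mem length_greater_0_conv)
  have len: "length T = length T'"
    using rl[OF assms(2)] rl[OF assms(3)] assms(1) by (metis linorder_neqE_nat less_irrefl)
  have "length (T ! i) = length (T' ! i)" if "i < length T" for i
    using in_cells[of i _ T] in_cells[of i _ T'] assms(1) that len by (metis linorder_neqE_nat less_irrefl)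
  then show ?thesis using len by (simp add: list_eq_iff_nth_eq)
qed

lemma tableau_nonempty_rows: "tableau T \<Longrightarrow> [] \<notin> set T"
  by (induction T) auto

section \<open>Deleting the largest entry\<close>

definition restrict_tableau :: "nat \<Rightarrow> nat list list \<Rightarrow> nat list list" where
  "restrict_tableau M T = filter (\<lambda>R. R \<noteq> []) (map (filter (\<lambda>z. z < M)) T)"

lemma restrict_tableau_simps [simp]:
  "restrict_tableau M [] = []"
  "restrict_tableau M (R # T) =
    (if filter (\<lambda>z. z < M) R = [] then restrict_tableau M T
     else filter (\<lambda>z. z < M) R # restrict_tableau M T)"
  by (simp_all add: restrict_tableau_def)

lemma restrict_tableau_triv:
  assumes "\<forall>z\<in>entries T. z < M" "[] \<notin> set T"
  shows "restrict_tableau M T = T"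
  using assms
proof (induction T)
  case (Cons R T)
  then have "filter (\<lambda>z. z < M) R = R" by (auto simp: filter_id_conv)
  with Cons show ?case by auto
qed simp

lemma restrict_tableau_id:
  "tableau T \<Longrightarrow> \<forall>z\<in>entries T. z < M \<Longrightarrow> restrict_tableau M T = T"
  by (intro restrict_tableau_triv tableau_nonempty_rows)

lemma tableau_tail_gt:
  assumes "tableau (R # T)" "\<forall>z\<in>set R. M \<le> z"
  shows "\<forall>z\<in>entries T. M < z"
  using assms
proof (induction T arbitrary: R)
  case (Cons S T)
  have d: "dominates R S" and t: "tableau (S # T)" using Cons.prems(1) by simp_all
  have S: "\<forall>z\<in>set S. M < z"
  proof
    fix z assume "z \<in> set S"
    then obtain j where j: "j < length S" "z = S ! j" by (metis in_set_conv_nth)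
    then have "R ! j < z" "j < length R" using d by (simp_all add: dominates_def)
    then show "M < z" using Cons.prems(2) nth_mem le_less_trans by blast
  qed
  have "\<forall>z\<in>entries T. M < z"
    by (rule Cons.IH[OF t]) (use S less_imp_le in blast)
  with S show ?case by auto
qed simp

text \<open>A largest entry alone in its row sits in the last row, so dropping the emptied row does
  not shift any row below it.\<close>

lemma tableau_tail_eq_Nil:
  assumes "tableau (R # T)" "\<forall>z\<in>set R. M \<le> z" "\<forall>z\<in>entries T. z < M"
  shows "T = []"
proof (cases T)
  case (Cons S U)
  then have "S \<noteq> []" using assms(1) by simp
  then have "hd S \<in> entries T" using Cons by simp
  then have "M < hd S" "hd S < M" using tableau_tail_gt[OF assms(1,2)] assms(3) by blast+
  then show ?thesis by simp
qed

lemma last_of_max: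
  assumes "sorted_wrt (<) R" "M \<in> set R" "\<forall>z\<in>set R. z \<le> (M::nat)"
  obtains R0 where "R = R0 @ [M]" "\<forall>z\<in>set R0. z < M"
proof -
  obtain R0 R1 where R: "R = R0 @ M # R1" using assms(2) by (metis split_list)
  have "R1 = []"
  proof (cases R1)
    case (Cons z zs)
    then have "M < z" "z \<le> M" using assms(1,3) R by (simp_all add: sorted_wrt_append)
    then show ?thesis by simp
  qed
  then show thesis using that[of R0] R assms(1) by (simp add: sorted_wrt_append)
qed

text \<open>The largest letter never displaces another one: a smaller letter leaves it at the end of
  its row or bumps it, and then it is appended to the next row. So it may be deleted before or after
  the insertion.\<close>

lemma restrict_row_insert:
  assumes "tableau T" "\<forall>z\<in>entries T. z \<le> M" "x < M" "x \<notin> entries T"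
  shows "restrict_tableau M (row_insert x T) = row_insert x (restrict_tableau M T)"
  using assms
proof (induction T arbitrary: x)
  case (Cons R T)
  have s: "sorted_wrt (<) R" and t: "tableau T" using Cons.prems by auto
  show ?case
  proof (cases "M \<in> set R")
    case True
    then obtain R0 where R: "R = R0 @ [M]" "\<forall>z\<in>set R0. z < M"
      using last_of_max[OF s] Cons.prems by auto
    have fR: "filter (\<lambda>z. z < M) R0 = R0" using R(2) by (simp add: filter_id_conv)
    have MT: "\<forall>z\<in>entries T. z < M"
    proof
      fix z assume z: "z \<in> entries T"
      then have "z \<noteq> M" using Cons.prems(1) R by auto
      then show "z < M" using z Cons.prems(2) by (simp add: order_less_le)
    qed
    have rT: "restrict_tableau M T = T" by (rule restrict_tableau_id[OF t MT])
    show ?thesis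
    \<comment> \<open>\<open>M\<close> ends its row and is bumped exactly when \<open>x\<close>
      exceeds everything before it.\<close>
    proof (cases "\<forall>z\<in>set R0. z < x")
      case True
      have ins: "row_insert x (R # T) = (R0 @ [x]) # row_insert M T"
        using row_insert_bump[OF True, of M "[]" T] R Cons.prems by simp
      have "restrict_tableau M (row_insert M T) = T"
      proof (cases T)
          case (Cons S U)
          then have "row_insert M T = (S @ [M]) # U" using MT by (simp add: row_insert_append del: row_insert.simps)
          moreover have "filter (\<lambda>z. z < M) S = S" "S \<noteq> []" using MT t Cons by (auto simp: filter_id_conv)
          ultimately show ?thesis using rT Cons by simp
      qed simp
      moreover have "R0 = [] \<Longrightarrow> T = []" by (rule tableau_tail_eq_Nil[OF Cons.prems(1) _ MT]) (simp add: R(1))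
      moreover have "filter (\<lambda>z. z < M) (R0 @ [x]) = R0 @ [x]" using fR Cons.prems(3) by simp
      moreover have "restrict_tableau M (R # T) = (if R0 = [] then T else R0 # T)"
        using R(1) fR rT by simp
      ultimately show ?thesis unfolding ins
        by (simp add: row_insert_append[OF True] del: row_insert.simps(2) filter_append)
    next
      case False
      have "sorted_wrt (<) R0" using s R(1) by (simp add: sorted_wrt_append)
      then obtain R1 y R2 where 2: "R0 = R1 @ y # R2" "\<forall>z\<in>set R1. z < x" "x \<le> y"
        by (cases rule: row_cases[of R0 x]) (use False in blast)+
      have i1: "row_insert x (R # T) = (R1 @ x # R2 @ [M]) # row_insert y T"
        using row_insert_bump[OF 2(2,3), of "R2 @ [M]" T] R 2(1) by simp
      have i2: "row_insert x (R0 # T) = (R1 @ x # R2) # row_insert y T"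
        using row_insert_bump[OF 2(2,3), of "R2" T] 2(1) by simp
      have y: "y < M" "y \<notin> entries T" using R 2 Cons.prems by auto
      have "restrict_tableau M (row_insert y T) = row_insert y T"
        using Cons.IH[OF t _ y] MT rT by (simp add: less_imp_le)
      moreover have "filter (\<lambda>z. z < M) (R1 @ x # R2 @ [M]) = R1 @ x # R2"
        using R(2) 2(1) Cons.prems(3) by (simp add: filter_id_conv)
      moreover have "restrict_tableau M (R # T) = R0 # T" using R fR 2(1) rT by simp
      ultimately show ?thesis unfolding i1 by (simp add: i2 del: row_insert.simps filter_append)
    qed
  next
    case False
    then have R: "\<forall>z\<in>set R. z < M" using Cons.prems(2) by (auto simp: order_less_le)
    then have fR: "filter (\<lambda>z. z < M) R = R" by (simp add: filter_id_conv)
    have Rne: "R \<noteq> []" using Cons.prems by simp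
    from s show ?thesis
    proof (cases rule: row_cases[of R x])
      case 1
      then show ?thesis using fR Rne Cons.prems(3) by (simp del: row_insert.simps)
    next
      case (2 R1 y R2)
      have y: "y < M" "y \<notin> entries T" using R 2 Cons.prems by auto
      have "filter (\<lambda>z. z < M) (R1 @ x # R2) = R1 @ x # R2"
        using R 2(1) Cons.prems(3) by (auto simp: filter_id_conv)
      then show ?thesis using Cons.IH[OF t _ y] Cons.prems fR Rne 2(5) by (simp del: row_insert.simps)
    qed
  qed
qed simp

lemma restrict_row_insert_max:
  assumes "tableau T" "\<forall>z\<in>entries T. z < M"
  shows "restrict_tableau M (row_insert M T) = T"
proof (cases T)
  case (Cons S U)
  then have "row_insert M T = (S @ [M]) # U" using assms by (simp add: row_insert_append del: row_insert.simps)
  moreover have "filter (\<lambda>z. z < M) S = S" "S \<noteq> []" using assms Cons by (auto simp: filter_id_conv)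
  ultimately show ?thesis using restrict_tableau_id[OF assms] Cons by simp
qed simp

lemma add_cell_max:
  assumes "tableau T" "\<forall>z\<in>entries T. z \<le> M" "M \<in> entries T"
  shows "\<exists>i\<le>length (restrict_tableau M T). T = add_cell (restrict_tableau M T) i M"
  using assms
proof (induction T)
  case (Cons R T)
  have s: "sorted_wrt (<) R" and t: "tableau T" using Cons.prems by auto
  show ?case
  proof (cases "M \<in> set R")
    case True
    then obtain R0 where R: "R = R0 @ [M]" "\<forall>z\<in>set R0. z < M"
      using last_of_max[OF s] Cons.prems by auto
    have fR: "filter (\<lambda>z. z < M) R0 = R0" using R(2) by (simp add: filter_id_conv)
    have MT: "\<forall>z\<in>entries T. z < M"
    proof
      fix z assume z: "z \<in> entries T"
      then have "z \<noteq> M" using Cons.prems(1) R by auto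
      then show "z < M" using z Cons.prems(2) by (simp add: order_less_le)
    qed
    have rT: "restrict_tableau M T = T" by (rule restrict_tableau_id[OF t MT])
    have "R0 = [] \<Longrightarrow> T = []" by (rule tableau_tail_eq_Nil[OF Cons.prems(1) _ MT]) (simp add: R(1))
    then show ?thesis using R fR rT by (intro exI[of _ 0]) auto
  next
    case False
    then have R: "\<forall>z\<in>set R. z < M" using Cons.prems(2) by (auto simp: order_less_le)
    then have fR: "filter (\<lambda>z. z < M) R = R" by (simp add: filter_id_conv)
    obtain i where "i \<le> length (restrict_tableau M T)" "T = add_cell (restrict_tableau M T) i M"
      using Cons.IH[OF t] Cons.prems False by auto
    then show ?thesis using fR Cons.prems(1) by (intro exI[of _ "Suc i"]) simp
  qed
qed simp

section \<open>Adding and removing corner cells\<close>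

lemma entries_add_cell: "entries (add_cell T i x) = insert x (entries T)"
  by (induction T i x rule: add_cell.induct) auto

lemma restrict_add_cell:
  assumes "\<forall>z\<in>entries T. z < M" "[] \<notin> set T"
  shows "restrict_tableau M (add_cell T i M) = T"
  using assms
proof (induction T i M rule: add_cell.induct)
  case (2 R T M)
  then have "filter (\<lambda>z. z < M) R = R" "restrict_tableau M T = T"
    by (auto simp: filter_id_conv intro: restrict_tableau_triv)
  moreover have "R \<noteq> []" using 2 by auto
  ultimately show ?case by simp
next
  case (3 R T i M)
  then have "filter (\<lambda>z. z < M) R = R" by (auto simp: filter_id_conv)
  then show ?case using 3 by auto
qed simp

lemma add_cell_Cons_head: "add_cell (R # T) i x = (if i = 0 then R @ [x] else R) # (if i = 0 then T else add_cell T (i - 1) x)"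
  by (cases i) simp_all

lemma tableau_add_cell:
  assumes "tableau T" "\<forall>z\<in>entries T. z < M" "i \<le> length T"
    "i > 0 \<longrightarrow> row_length T i < row_length T (i - 1)"
  shows "tableau (add_cell T i M)"
  using assms
proof (induction T i M rule: add_cell.induct)
  case (2 R T M)
  have "M \<notin> entries T" using 2 by auto
  then show ?case using 2 by (auto simp: sorted_wrt_append dominates_def nth_append split: list.splits)
next
  case (3 R T i M)
  have t: "tableau T" using 3 by simp
  have "i > 0 \<longrightarrow> row_length T i < row_length T (i - 1)" using 3(5) by (cases i) auto
  then have IH: "tableau (add_cell T i M)" using 3 by simp
  have "\<forall>z\<in>set R. z < M" "set R \<inter> entries T = {}" using 3 by auto
  then have dis: "set R \<inter> entries (add_cell T i M) = {}" by (auto simp: entries_add_cell)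
  have "case add_cell T i M of [] \<Rightarrow> True | R' # _ \<Rightarrow> dominates R R'"
  proof (cases T)
    case Nil
    have "R \<noteq> []" "i = 0" using 3 Nil by simp_all
    then show ?thesis using Nil 3(3) by (simp add: dominates_def Suc_le_eq)
  next
    case (Cons S U)
    then have d: "dominates R S" using 3 by simp
    have "dominates R (S @ [M])" if "i = 0"
    proof -
      have "length S < length R" using 3(5) that Cons by simp
      then show ?thesis using d \<open>\<forall>z\<in>set R. z < M\<close> by (auto simp: dominates_def nth_append less_Suc_eq)
    qed
    then show ?thesis using d Cons by (simp add: add_cell_Cons_head)
  qed
  then show ?case using IH 3(2) dis by simp
qed simp

text \<open>Reverse insertion from the corner in row \<open>i\<close>: this row gives up its last
  entry, and in each row above the incoming letter \<open>y\<close> replaces the last entry smaller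
  than \<open>y\<close>, which moves on upwards. Such an entry exists because the one directly above
  \<open>y\<close> is smaller.\<close>

lemma row_insert_surj:
  assumes "tableau X" "i < length X" "row_length X (Suc i) < row_length X i"
  shows "\<exists>x T. tableau T \<and> x \<notin> entries T \<and> row_insert x T = X \<and> cells X = insert (i, row_length T i) (cells T) \<and> i \<le> length T"
  using assms
proof (induction X arbitrary: i)
  case (Cons R X)
  have s: "sorted_wrt (<) R" and t: "tableau X" and ne: "R \<noteq> []" and dis: "set R \<inter> entries X = {}" using Cons.prems(1) by auto
  show ?case
  proof (cases i)
    case 0
    obtain R0 x where R: "R = R0 @ [x]" using ne by (metis rev_exhaust)
    have lt: "\<forall>z\<in>set R0. z < x" using s R by (simp add: sorted_wrt_append)
    show ?thesis
    proof (cases "R0 = []")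
      case True
      then have "X = []" using Cons.prems 0 R by (cases X) (auto simp: row_length_def split: if_splits)
      then show ?thesis using True R 0 by (intro exI[of _ x] exI[of _ "[]"]) (simp add: lessThan_Suc)
    next
      case False
      have "case X of [] \<Rightarrow> True | R' # _ \<Rightarrow> dominates R0 R'"
        using Cons.prems 0 R by (cases X) (auto simp: dominates_def row_length_def nth_append split: if_splits)
      then have "tableau (R0 # X)" using t s R dis False by (auto simp: sorted_wrt_append)
      moreover have "row_insert x (R0 # X) = R # X" using row_insert_append[OF lt] R by simp
      moreover have "x \<notin> entries (R0 # X)" using dis R lt by auto
      moreover have "cells (R # X) = insert (0, length R0) (cells (R0 # X))" using R by (auto simp: lessThan_Suc)
      ultimately show ?thesis using 0 by (intro exI[of _ x] exI[of _ "R0 # X"]) simp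
    qed
  next
    case (Suc k)
    have "k < length X" "row_length X (Suc k) < row_length X k" using Cons.prems Suc by simp_all
    then obtain y T where IH: "tableau T" "y \<notin> entries T" "row_insert y T = X" 
        "cells X = insert (k, row_length T k) (cells T)" "k \<le> length T"
      using Cons.IH[OF t] by blast
    obtain S U where X: "X = S # U" using \<open>k < length X\<close> by (cases X) auto
    have d: "dominates R S" using Cons.prems(1) X by simp
    have yX: "entries X = insert y (entries T)" using entries_row_insert[OF IH(1)] IH(3) by blast
    \<comment> \<open>\<open>y\<close> was inserted into \<open>T\<close>, so it stands in the top
      row \<open>S\<close> of \<open>X\<close>. Before the insertion its place was free, at the end
      of the row, or held a larger \<open>z\<close>.\<close>
    have S_split: "\<exists>S1 S2. S = S1 @ y # S2 \<and> (case T of [] \<Rightarrow> S1 = [] \<and> S2 = [] | S' # T' \<Rightarrow> 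
        (S2 = [] \<and> S' = S1) \<or> (\<exists>z. S' = S1 @ z # S2 \<and> y < z))"
    proof (cases T)
      case Nil
      then show ?thesis using IH(3) X by auto
    next
      case T: (Cons S' T')
      have "sorted_wrt (<) S'" using IH(1) T by simp
      then show ?thesis
      proof (cases rule: row_cases[of S' y])
        case 1
        then show ?thesis using IH(3) X T by (auto simp del: row_insert.simps)
      next
        case (2 S1 z S2)
        then have "y < z" using IH(2) T by (auto simp: order_less_le)
        moreover have "S = S1 @ y # S2" using IH(3) X T 2(5) by (simp del: row_insert.simps)
        ultimately show ?thesis using T 2(1) by auto
      qed
    qed
    then obtain S1 S2 where S: "S = S1 @ y # S2" and 
      T_cases: "case T of [] \<Rightarrow> S1 = [] \<and> S2 = [] | S' # T' \<Rightarrow> 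
        (S2 = [] \<and> S' = S1) \<or> (\<exists>z. S' = S1 @ z # S2 \<and> y < z)" by blast
    have l1: "length S1 < length R" using d S by (simp add: dominates_def)
    have "R ! length S1 < y" using d S unfolding dominates_def by (metis nth_append_length length_append length_Cons less_add_Suc1 add_Suc_right)
    define R1 where "R1 = takeWhile (\<lambda>z. z < y) R"
    have y: "y \<notin> set R" using dis yX by blast
    \<comment> \<open>The entries of \<open>R\<close> up to and including the column of
      \<open>y\<close> are smaller than \<open>y\<close>. Hence the last smaller entry, which
      becomes \<open>x\<close>, sits in that column or further right; this is what keeps the columns
      increasing after the replacement.\<close>
    have sub: "length S1 < length R1"
    proof -
      have "R ! i < y" if "i \<le> length S1" for i
      proof (cases "i = length S1")
        case False
        then have "R ! i < R ! length S1" using that s l1 by (simp add: sorted_wrt_iff_nth_less)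
        then show ?thesis using \<open>R ! length S1 < y\<close> by simp
      qed (use \<open>R ! length S1 < y\<close> in simp)
      then have "Suc (length S1) \<le> length R1"
        unfolding R1_def using l1 by (intro length_takeWhile_less_P_nth) auto
      then show ?thesis by simp
    qed
    then obtain R0 x where R1: "R1 = R0 @ [x]" by (cases R1 rule: rev_cases) auto
    define R2 where "R2 = dropWhile (\<lambda>z. z < y) R"
    have R: "R = R0 @ x # R2" using R1 R1_def R2_def by (metis append_Cons append_Nil append_assoc takeWhile_dropWhile_id)
    have xy: "x < y" using R1 R1_def by (metis in_set_conv_decomp set_takeWhileD)
    have R2: "\<forall>z\<in>set R2. y < z"
    proof (cases R2)
      case (Cons w ws)
      then have "\<not> w < y" using R2_def by (metis dropWhile_eq_Cons_conv)
      moreover have "w \<noteq> y" using y R Cons by auto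
      ultimately have "y < w" by simp
      then show ?thesis using s R Cons by (auto simp: sorted_wrt_append)
    qed simp
    have R0: "\<forall>z\<in>set R0. z < x" using s R by (simp add: sorted_wrt_append)
    have T_eq: "row_insert x ((R0 @ y # R2) # T) = R # X"
      using row_insert_bump[OF R0, of y R2 T] xy IH(3) R by simp
    have "sorted_wrt (<) (R0 @ y # R2)" using s R R2 R0 xy by (fastforce simp: sorted_wrt_append)
    moreover have "set (R0 @ y # R2) \<inter> entries T = {}" using dis R yX IH(2) by auto
    moreover have "case T of [] \<Rightarrow> True | R' # _ \<Rightarrow> dominates (R0 @ y # R2) R'"
    proof (cases T)
      case T: (Cons S' T')
      have len: "length S1 \<le> length R0" using sub R1 by simp
      have R': "length (R0 @ y # R2) = length R" using R by simp
      from T_cases T consider "S2 = []" "S' = S1" | z where "S' = S1 @ z # S2" "y < z" by auto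
      then have "dominates (R0 @ y # R2) S'"
      proof cases
        case 1
        have "(R0 @ y # R2) ! j < S' ! j" if "j < length S'" for j
        proof -
          have "R ! j < S ! j" using d S 1 that by (simp add: dominates_def)
          then show ?thesis using S 1 that len R by (simp add: nth_append)
        qed
        then show ?thesis unfolding dominates_def using R' 1 l1 by simp
      next
        case 2
        have "(R0 @ y # R2) ! j < S' ! j" if j: "j < length S'" for j
        proof -
          have j': "R ! j < S ! j" using d S 2 j by (auto simp: dominates_def)
          consider "j < length R0" | "j = length R0" | "j > length R0" by linarith
          then show ?thesis
          proof cases
            case 1
            then have "R ! j < y" using R R0 xy by (metis nth_append nth_mem order.strict_trans)
            then show ?thesis using 1 2 S j' R by (auto simp: nth_append nth_Cons split: nat.splits if_splits)
          next
            case eq: 2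
            have "S' ! j > y"
            proof (cases "j = length S1")
              case True
              then show ?thesis using 2 by simp
            next
              case False
              have "sorted_wrt (<) S'" using IH(1) T by simp
              then have "S' ! length S1 < S' ! j" using False eq len j by (simp add: sorted_wrt_iff_nth_less)
              then show ?thesis using 2 by simp
            qed
            then show ?thesis using eq by simp
          next
            case 3
            then have "S' ! j = S ! j" using S 2 len by (auto simp: nth_append nth_Cons split: nat.splits)
            then show ?thesis using 3 R j' by (auto simp: nth_append nth_Cons split: nat.splits)
          qed
        qed
        then show ?thesis unfolding dominates_def using R' d S 2 by (simp add: dominates_def)
      qed
      then show ?thesis using T by simp
    qed simp
    ultimately have tab: "tableau ((R0 @ y # R2) # T)" using IH(1) by simp
    have "x \<notin> entries X" using dis R by auto
    then have "x \<notin> entries T" using yX by simp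
    then have x: "x \<notin> entries ((R0 @ y # R2) # T)" using s R xy by (auto simp: sorted_wrt_append)
    have "cells (R # X) = insert (Suc k, row_length T k) (cells ((R0 @ y # R2) # T))"
      using IH(4) R by auto
    then show ?thesis using tab T_eq x Suc IH(5) by (intro exI[of _ x] exI[of _ "(R0 @ y # R2) # T"]) simp
  qed
qed simp

section \<open>Decreasing subsequences and the number of rows\<close>

lemma subseq_sorted_wrt:
  "subseq xs ys \<Longrightarrow> sorted_wrt P ys \<Longrightarrow> sorted_wrt P xs \<and> set xs \<subseteq> set ys"
  by (induction rule: list_emb.induct) auto

definition reading_word :: "nat list list \<Rightarrow> nat list" where
  "reading_word T = concat (rev T)"

definition has_decreasing :: "nat \<Rightarrow> nat list \<Rightarrow> bool" where
  "has_decreasing l w \<longleftrightarrow> (\<exists>ys. subseq ys w \<and> sorted_wrt (>) ys \<and> length ys = l)"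

text \<open>The Knuth relations behind one bump, for a bumped letter \<open>y\<close> and a row \<open>R1 @ y # R2\<close>.\<close>

lemma has_decreasing_bump:
  assumes dec: "has_decreasing l (u @ y # (R1 @ x # R2) @ v)"
    and R: "sorted_wrt (<) (R1 @ y # R2)" "\<forall>z\<in>set R1. z < x" "x < y"
  shows "has_decreasing l (u @ (R1 @ y # R2) @ x # v)"
proof -
  obtain ys where ys: "subseq ys (u @ y # (R1 @ x # R2) @ v)" "sorted_wrt (>) ys" "length ys = l"
    using dec unfolding has_decreasing_def by blast
  obtain yu ym yv where split: "ys = yu @ ym @ yv" "subseq yu u" "subseq ym (y # R1 @ x # R2)" "subseq yv v"
  proof -
    have "subseq ys (u @ (y # R1 @ x # R2) @ v)" using ys(1) by simp
    then show thesis using that unfolding subseq_append_iff by blast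
  qed
  have sR: "sorted_wrt (<) (R1 @ x # R2)"
    using R by (fastforce simp: sorted_wrt_append)
  \<comment> \<open>A decreasing sequence meets an increasing row at most once.\<close>
  have one: "length zs \<le> 1" if "subseq zs (R1 @ x # R2)" "sorted_wrt (>) zs" for zs
  proof (cases zs rule: remdups_adj.cases)
    case (3 a b cs)
    then have "b < a" using that(2) by simp
    moreover have "sorted_wrt (<) zs" using that(1) sR by (metis subseq_sorted_wrt)
    ultimately show ?thesis using 3 by simp
  qed auto
  have sm: "sorted_wrt (>) ym" using ys(2) split(1) by (simp add: sorted_wrt_append)
  have mem: "subseq [a] w" if "a \<in> set w" for a :: nat and w using that by (simp add: subseq_singleton_left)
  have "\<exists>ym'. subseq ym' ((R1 @ y # R2) @ [x]) \<and> sorted_wrt (>) (yu @ ym' @ yv) \<and> length ym' = length ym"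
  proof (cases ym)
    case Nil
    then show ?thesis using ys(2) split(1) by auto
  next
    case (Cons a as)
    show ?thesis
    proof (cases as)
      case Nil
      have "a \<in> set (y # R1 @ x # R2)" using split(3) Cons Nil by (simp only: subseq_singleton_left)
      then have "a \<in> set ((R1 @ y # R2) @ [x])" by auto
      then show ?thesis using Cons Nil ys(2) split(1) mem by (intro exI[of _ "[a]"]) auto
    next
      case as: (Cons b bs)
      have "\<not> subseq ym (R1 @ x # R2)" using one[OF _ sm] Cons as by auto
      then have a: "a = y" and sub: "subseq as (R1 @ x # R2)"
        using split(3) Cons by (auto split: if_splits)
      have bs: "bs = []" "b \<in> set (R1 @ x # R2)"
        using one[OF sub] sm Cons as sub subseq_sorted_wrt[OF sub sR] by auto
      have "b < y" using sm Cons as a by simp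
      then have "b \<le> x" using bs(2) R by (auto simp: sorted_wrt_append)
      \<comment> \<open>Two letters of the sequence fit here only as \<open>y\<close> followed by
        some \<open>b \<le> x\<close>. Replacing \<open>b\<close> by \<open>x\<close> keeps the
        sequence decreasing, since everything after \<open>b\<close> is smaller still, and
        \<open>y\<close> precedes the final \<open>x\<close> in the new order.\<close>
      have "subseq [y, x] ((R1 @ y # R2) @ [x])"
        by (simp add: subseq_drop_many subseq_singleton_left)
      moreover have "sorted_wrt (>) (yu @ [y, x] @ yv)"
        using ys(2) split(1) Cons as a bs(1) \<open>b \<le> x\<close> R(3) by (auto simp: sorted_wrt_append)
      ultimately show ?thesis using Cons as bs(1) by (intro exI[of _ "[y, x]"]) simp
    qed
  qed
  then obtain ym' where ym': "subseq ym' ((R1 @ y # R2) @ [x])" "sorted_wrt (>) (yu @ ym' @ yv)" "length ym' = length ym"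
    by blast
  have "subseq (yu @ ym' @ yv) (u @ ((R1 @ y # R2) @ [x]) @ v)"
    using ym'(1) split by (intro list_emb_append_mono) 
  then show ?thesis unfolding has_decreasing_def
    using ym' ys(3) split(1) by (intro exI[of _ "yu @ ym' @ yv"]) simp
qed

text \<open>The two words are Knuth equivalent; this is the direction from the tableau back to the
  word. The suffix \<open>v\<close> collects the rows above in the recursion here, and the letters
  inserted later in \<open>has_decreasing_rsk\<close>.\<close>

lemma has_decreasing_row_insert:
  assumes "tableau T" "x \<notin> entries T" "has_decreasing l (reading_word (row_insert x T) @ v)"
  shows "has_decreasing l (reading_word T @ x # v)"
  using assms
proof (induction T arbitrary: x v)
  case (Cons R T)
  have s: "sorted_wrt (<) R" using Cons.prems(1) by simp
  from s show ?case
  proof (cases rule: row_cases[of R x])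
    case 1
    then show ?thesis using Cons.prems(3) by (simp add: reading_word_def del: row_insert.simps)
  next
    case (2 R1 y R2)
    have y: "y \<notin> entries T" "y \<noteq> x" using Cons.prems 2(1) by auto
    have "has_decreasing l (reading_word (row_insert y T) @ (R1 @ x # R2) @ v)"
      using Cons.prems(3) 2(5) by (simp add: reading_word_def del: row_insert.simps)
    then have "has_decreasing l (reading_word T @ y # (R1 @ x # R2) @ v)"
      using Cons.IH[OF _ y(1)] Cons.prems(1) by simp
    then have "has_decreasing l (reading_word T @ (R1 @ y # R2) @ x # v)"
      by (rule has_decreasing_bump) (use s 2 y(2) in auto)
    then show ?thesis using 2(1) by (simp add: reading_word_def)
  qed
qed (simp add: reading_word_def)

definition rsk :: "nat list \<Rightarrow> nat list list" where
  "rsk w = fold row_insert w []"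

lemma rsk_simps [simp]: "rsk [] = []" "rsk (w @ [x]) = row_insert x (rsk w)"
  by (simp_all add: rsk_def)

lemma tableau_rsk: "distinct w \<Longrightarrow> tableau (rsk w) \<and> entries (rsk w) = set w"
  by (induction w rule: rev_induct) (auto simp: tableau_row_insert entries_row_insert)

lemma restrict_rsk:
  assumes "distinct w" "\<forall>z\<in>set w. z \<le> M"
  shows "restrict_tableau M (rsk w) = rsk (filter (\<lambda>z. z < M) w)"
  using assms
proof (induction w rule: rev_induct)
  case (snoc x w)
  have w: "tableau (rsk w)" "entries (rsk w) = set w" using tableau_rsk[of w] snoc.prems by auto
  show ?case
  proof (cases "x = M")
    case True
    then have "\<forall>z\<in>entries (rsk w). z < M" using snoc.prems w by (fastforce simp: order_less_le)
    then have "restrict_tableau M (row_insert x (rsk w)) = rsk w" using True w restrict_row_insert_max by blast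
    moreover have "filter (\<lambda>z. z < M) w = w" using \<open>\<forall>z\<in>entries (rsk w). z < M\<close> w by (simp add: filter_id_conv)
    ultimately show ?thesis using True by simp
  next
    case False
    then have "x < M" using snoc.prems by (simp add: order_less_le)
    then show ?thesis using restrict_row_insert[OF w(1), of M x] w snoc by simp
  qed
qed simp

lemma has_decreasing_rsk:
  "distinct w \<Longrightarrow> has_decreasing l (reading_word (rsk w) @ v) \<Longrightarrow> has_decreasing l (w @ v)"
proof (induction w arbitrary: v rule: rev_induct)
  case (snoc x w)
  have "has_decreasing l (reading_word (rsk w) @ x # v)"
    by (rule has_decreasing_row_insert) (use tableau_rsk[of w] snoc.prems in auto)
  then show ?case using snoc.IH[of "x # v"] snoc.prems by simp
qed (simp add: reading_word_def)

text \<open>Witnessed by the first column, which the reading word meets from bottom to top.\<close>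

lemma has_decreasing_column:
  "tableau T \<Longrightarrow> has_decreasing (length T) (reading_word T)"
proof -
  have "subseq (rev (map hd T)) (reading_word T) \<and> sorted_wrt (>) (rev (map hd T))"
    if "tableau T" for T using that
  proof (induction T)
    case (Cons R T)
    have "subseq (rev (map hd T) @ [hd R]) (reading_word T @ R)"
      by (rule list_emb_append_mono) (use Cons in \<open>auto simp: subseq_singleton_left\<close>)
    moreover have "hd R < z" if "z \<in> entries T" for z
      using tableau_tail_gt[OF Cons.prems, of "hd R"] that Cons.prems
      by (cases R) (auto intro: less_imp_le)
    moreover have "hd S \<in> entries T" if "S \<in> set T" for S 
      using that tableau_nonempty_rows[of T] Cons.prems by (metis UN_I hd_in_set tableau.simps(2))
    ultimately show ?case using Cons by (auto simp: reading_word_def sorted_wrt_append)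
  qed (simp add: reading_word_def)
  then show "tableau T \<Longrightarrow> ?thesis" unfolding has_decreasing_def by (metis length_map length_rev)
qed

text \<open>One half of Schensted's theorem on decreasing subsequences. It turns the absence of
  large crossings into a bound on the number of rows.\<close>

lemma has_decreasing_if_rows:
  assumes "distinct w"
  shows "has_decreasing (length (rsk w)) w"
proof -
  have "has_decreasing (length (rsk w)) (reading_word (rsk w) @ [])"
    using has_decreasing_column tableau_rsk[OF assms] by simp
  then show ?thesis using has_decreasing_rsk[OF assms] by fastforce
qed

lemma has_decreasing_mono:
  assumes "has_decreasing l w" "k \<le> l"
  shows "has_decreasing k w"
proof -
  obtain ys where ys: "subseq ys w" "sorted_wrt (>) ys" "length ys = l" using assms(1) unfolding has_decreasing_def by blast
  have "subseq (take k ys) ys" by (rule prefix_imp_subseq[OF take_is_prefix])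
  then show ?thesis using ys assms(2) unfolding has_decreasing_def
    by (intro exI[of _ "take k ys"]) (auto simp: sorted_wrt_take intro: subseq_order.trans)
qed

section \<open>The walk of tableaux of a pairing\<close>

text \<open>A perfect matching as a fixed-point-free involution of \<open>V\<close>. Values outside
  \<open>V\<close> are free, so pairings with the same strands need agree only on
  \<open>V\<close>.\<close>

definition pairing :: "'a set \<Rightarrow> ('a \<Rightarrow> 'a) \<Rightarrow> bool" where
  "pairing V f \<longleftrightarrow> (\<forall>x\<in>V. f x \<in> V \<and> f x \<noteq> x \<and> f (f x) = x)"

text \<open>The left ends of the strands passing over the gap between \<open>j\<close> and \<open>j + 1\<close>, sorted by
  decreasing right end. A decreasing subsequence is therefore a crossing. When \<open>j\<close> decreases by one,
  the word either gets a new last letter or loses its largest letter.\<close>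

definition open_word :: "(nat \<Rightarrow> nat) \<Rightarrow> nat \<Rightarrow> nat \<Rightarrow> nat list" where
  "open_word f r j = map f (filter (\<lambda>b. f b \<le> j) (rev [Suc j..<Suc r]))"

definition open_tableau :: "(nat \<Rightarrow> nat) \<Rightarrow> nat \<Rightarrow> nat \<Rightarrow> nat list list" where
  "open_tableau f r j = rsk (open_word f r j)"

lemma pairing_inj: "pairing V f \<Longrightarrow> inj_on f V"
  by (rule inj_on_inverseI[of _ f]) (simp add: pairing_def)

lemma distinct_open_word:
  assumes "pairing {1..r} f"
  shows "distinct (open_word f r j)"
proof -
  have "inj_on f (set (filter (\<lambda>b. f b \<le> j) (rev [Suc j..<Suc r])))"
    by (rule inj_on_subset[OF pairing_inj[OF assms]]) auto
  then show ?thesis unfolding open_word_def distinct_map by simp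
qed

lemma set_open_word: 
  assumes "pairing {1..r} f"
  shows "set (open_word f r j) = {a \<in> {1..r}. a \<le> j \<and> j < f a}"
proof -
  have "set (filter (\<lambda>b. f b \<le> j) (rev [Suc j..<Suc r])) = {b \<in> {1..r}. f b \<le> j \<and> j < b}"
    by auto
  then have "set (open_word f r j) = f ` {b \<in> {1..r}. f b \<le> j \<and> j < b}"
    by (simp only: open_word_def set_map)
  also have "\<dots> = {a \<in> {1..r}. a \<le> j \<and> j < f a}"
  proof (intro equalityI subsetI)
    fix a assume "a \<in> {a \<in> {1..r}. a \<le> j \<and> j < f a}"
    then show "a \<in> f ` {b \<in> {1..r}. f b \<le> j \<and> j < b}"
      using assms by (intro image_eqI[of _ _ "f a"]) (auto simp: pairing_def)
  qed (use assms in \<open>auto simp: pairing_def\<close>)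
  finally show ?thesis .
qed

lemma tableau_open_tableau:
  assumes "pairing {1..r} f"
  shows "tableau (open_tableau f r j)"
    "entries (open_tableau f r j) = {a \<in> {1..r}. a \<le> j \<and> j < f a}"
  using tableau_rsk[OF distinct_open_word[OF assms]] set_open_word[OF assms]
  unfolding open_tableau_def by simp_all

lemma open_tableau_ends: 
  assumes "pairing {1..r} f"
  shows "open_tableau f r 0 = []" "open_tableau f r r = []"
proof -
  have w: "open_word f r j = []" if "j = 0 \<or> j = r" for j
  proof -
    have "\<not> (a \<le> j \<and> j < f a)" if a: "a \<in> {1..r}" for a
    proof -
      have "f a \<le> r" using assms a by (simp add: pairing_def)
      then show ?thesis using \<open>j = 0 \<or> j = r\<close> a by auto
    qed
    then have "set (open_word f r j) = {}" unfolding set_open_word[OF assms]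
      by blast
    then show ?thesis by simp
  qed
  show "open_tableau f r 0 = []" "open_tableau f r r = []"
    unfolding open_tableau_def by (simp_all only: w rsk_simps simp_thms)
qed

lemma open_tableau_step:
  assumes f: "pairing {1..r} f" and j: "j < r"
  shows "f (Suc j) \<le> j \<Longrightarrow> open_tableau f r j = row_insert (f (Suc j)) (open_tableau f r (Suc j))"
    "\<not> f (Suc j) \<le> j \<Longrightarrow> open_tableau f r j = restrict_tableau (Suc j) (open_tableau f r (Suc j))"
proof -
  have upt: "rev [Suc j..<Suc r] = rev [Suc (Suc j)..<Suc r] @ [Suc j]"
    using j by (metis Suc_less_eq rev.simps(2) upt_conv_Cons)
  have filt: "filter (\<lambda>z. z < Suc j) (map f (filter (\<lambda>b. f b \<le> Suc j) bs)) = map f (filter (\<lambda>b. f b \<le> j) bs)" for bs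
    by (induction bs) auto
  have *: "open_word f r j = filter (\<lambda>z. z < Suc j) (open_word f r (Suc j)) @ (if f (Suc j) \<le> j then [f (Suc j)] else [])"
    unfolding open_word_def upt filt by simp
  have le: "\<forall>z\<in>set (open_word f r (Suc j)). z \<le> Suc j"
    unfolding set_open_word[OF f] by simp
  have r: "restrict_tableau (Suc j) (open_tableau f r (Suc j)) = rsk (filter (\<lambda>z. z < Suc j) (open_word f r (Suc j)))"
    unfolding open_tableau_def by (rule restrict_rsk[OF distinct_open_word[OF f] le])
  show "open_tableau f r j = row_insert (f (Suc j)) (open_tableau f r (Suc j))" if "f (Suc j) \<le> j"
  proof -
    have "\<forall>z\<in>set (open_word f r (Suc j)). z < Suc j"
    proof
      fix z assume z: "z \<in> set (open_word f r (Suc j))"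
      have "f (Suc j) \<noteq> Suc j" "f (f (Suc j)) = Suc j" using f j by (auto simp: pairing_def)
      then have "z \<noteq> Suc j" using z that unfolding set_open_word[OF f] by auto
      then show "z < Suc j" using z le by (simp add: order_less_le)
    qed
    then have "filter (\<lambda>z. z < Suc j) (open_word f r (Suc j)) = open_word f r (Suc j)" by (simp add: filter_id_conv)
    then show ?thesis using * that by (simp add: open_tableau_def)
  qed
  show "open_tableau f r j = restrict_tableau (Suc j) (open_tableau f r (Suc j))" if "\<not> f (Suc j) \<le> j"
    using r * that by (simp add: open_tableau_def)
qed

lemma finite_cells: "finite (cells T)"
  by (induction T) auto

lemma cells_row_insert: "\<exists>c. c \<notin> cells T \<and> cells (row_insert x T) = insert c (cells T)"
  using length_row_insert[of T x] cells_cong cells_add_cell new_cell by metis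

lemma open_tableau_opener:
  assumes f: "pairing {1..r} f" and j: "j < r" and "\<not> f (Suc j) \<le> j"
  shows "\<exists>i\<le>length (open_tableau f r j). open_tableau f r (Suc j) = add_cell (open_tableau f r j) i (Suc j)"
proof -
  have "f (Suc j) \<noteq> Suc j" using f j by (simp add: pairing_def)
  then have "Suc j < f (Suc j)" using assms(3) by simp
  then have "Suc j \<in> entries (open_tableau f r (Suc j))" 
    unfolding tableau_open_tableau(2)[OF f] using j by simp
  moreover have "\<forall>z\<in>entries (open_tableau f r (Suc j)). z \<le> Suc j"
    unfolding tableau_open_tableau(2)[OF f] by simp
  ultimately show ?thesis using add_cell_max[OF tableau_open_tableau(1)[OF f]] open_tableau_step(2)[OF assms] by simp
qed

text \<open>Going down, passing a right end adds a cell and passing a left end removes one. Hence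
  the shapes alone reveal which points are right ends.\<close>

lemma open_tableau_card:
  assumes f: "pairing {1..r} f" and j: "j < r"
  shows "f (Suc j) \<le> j \<longleftrightarrow> card (cells (open_tableau f r (Suc j))) < card (cells (open_tableau f r j))"
proof (cases "f (Suc j) \<le> j")
  case True
  then show ?thesis using cells_row_insert open_tableau_step(1)[OF assms]
    by (metis card_insert_disjoint finite_cells lessI)
next
  case False
  then show ?thesis using open_tableau_opener[OF assms] cells_add_cell new_cell
    by (metis card_insert_disjoint finite_cells lessI less_asym)
qed

lemma tableau_length_eq:
  "tableau T \<Longrightarrow> tableau T' \<Longrightarrow> cells T = cells T' \<Longrightarrow> map length T = map length T'"
  by (intro length_eq_if_cells_eq tableau_nonempty_rows)

text \<open>Going up from \<open>j = 0\<close>, an added cell receives the entry \<open>j\<close>, and a removed cell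
  determines by reverse insertion the entry that leaves, which is the partner of \<open>j\<close>.\<close>

lemma open_tableau_inj:
  assumes f: "pairing {1..r} f" and g: "pairing {1..r} g"
    and eq: "\<And>j. j \<le> r \<Longrightarrow> cells (open_tableau f r j) = cells (open_tableau g r j)"
  shows "\<forall>x\<in>{1..r}. f x = g x"
proof -
  have step: "open_tableau f r (Suc j) = open_tableau g r (Suc j) \<and> (f (Suc j) \<le> j \<longrightarrow> f (Suc j) = g (Suc j))"
    if T: "open_tableau f r j = open_tableau g r j" and j: "j < r" for j
  proof (cases "f (Suc j) \<le> j")
    case True
    then have "g (Suc j) \<le> j" using open_tableau_card[OF f j] open_tableau_card[OF g j] eq j by simp
    then have "row_insert (f (Suc j)) (open_tableau f r (Suc j)) = row_insert (g (Suc j)) (open_tableau g r (Suc j))"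
      using open_tableau_step(1)[OF f j True] open_tableau_step(1)[OF g j] T by simp
    moreover have "map length (open_tableau f r (Suc j)) = map length (open_tableau g r (Suc j))"
      using eq[of "Suc j"] j by (intro tableau_length_eq tableau_open_tableau f g) simp
    ultimately show ?thesis using row_insert_inj tableau_open_tableau f g by blast
  next
    case False
    then have F': "\<not> g (Suc j) \<le> j" using open_tableau_card[OF f j] open_tableau_card[OF g j] eq j by simp
    obtain i where i: "i\<le>length (open_tableau f r j)" "open_tableau f r (Suc j) = add_cell (open_tableau f r j) i (Suc j)"
      using open_tableau_opener[OF f j False] by blast
    obtain k where k: "k\<le>length (open_tableau f r j)" "open_tableau g r (Suc j) = add_cell (open_tableau f r j) k (Suc j)"
      using open_tableau_opener[OF g j F'] T by auto
    have "insert (i, row_length (open_tableau f r j) i) (cells (open_tableau f r j)) =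
      insert (k, row_length (open_tableau f r j) k) (cells (open_tableau f r j))"
      using i k eq[of "Suc j"] j by (simp add: cells_add_cell)
    then have "i = k" using new_cell by (metis insertE insertI1 prod.inject)
    then show ?thesis using i k False by simp
  qed
  have T: "open_tableau f r j = open_tableau g r j" if "j \<le> r" for j
    using that by (induction j) (use step open_tableau_ends[OF f] open_tableau_ends[OF g] in auto)
  have closer: "f x = g x" if "x \<in> {1..r}" "f x < x" for x
    using step[OF T[of "x - 1"]] that by (cases x) auto
  show ?thesis
  proof
    fix x assume x: "x \<in> {1..r}"
    show "f x = g x"
    proof (cases "f x < x")
      case False
      then have "f x \<in> {1..r}" "f (f x) < f x" "f (f x) = x" using f x by (auto simp: pairing_def order_less_le)
      then have "g (f x) = x" using closer[of "f x"] by simp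
      then show ?thesis using g \<open>f x \<in> {1..r}\<close> by (metis pairing_def)
    qed (use closer x in blast)
  qed
qed

lemma has_decreasing_crossing:
  assumes f: "pairing {1..r} f" and "has_decreasing m (open_word f r j)"
  shows "\<exists>as bs. length as = m \<and> length bs = m \<and> sorted_wrt (<) (as @ bs) \<and> set bs \<subseteq> {1..r} \<and>
    (\<forall>i<m. as ! i = f (bs ! i))"
proof -
  obtain ys where ys: "subseq ys (open_word f r j)" "sorted_wrt (>) ys" "length ys = m"
    using assms(2) unfolding has_decreasing_def by blast
  obtain N where N: "ys = nths (open_word f r j) N" using ys(1) subseq_conv_nths by blast
  define bs where "bs = nths (filter (\<lambda>b. f b \<le> j) (rev [Suc j..<Suc r])) N"
  have ysb: "ys = map f bs" unfolding N bs_def open_word_def by (simp add: nths_map)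
  have sub: "subseq bs (filter (\<lambda>b. f b \<le> j) (rev [Suc j..<Suc r]))" unfolding bs_def subseq_conv_nths by blast
  have sorted: "sorted_wrt (>) (filter (\<lambda>b. f b \<le> j) (rev [Suc j..<Suc r]))"
    by (intro sorted_wrt_filter) (simp add: sorted_wrt_rev del: upt_Suc)
  then have bs: "sorted_wrt (>) bs" "set bs \<subseteq> {b. f b \<le> j \<and> j < b \<and> b \<le> r}"
    using subseq_sorted_wrt[OF sub sorted] by (auto simp del: upt_Suc)
  have "sorted_wrt (<) (rev ys @ rev bs)"
  proof -
    have "\<forall>x\<in>set ys. x \<le> j" "\<forall>x\<in>set bs. j < x" using ysb bs(2) by auto
    then show ?thesis using ys(2) bs(1) by (auto simp: sorted_wrt_append sorted_wrt_rev intro: le_less_trans)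
  qed
  then show ?thesis
    using ys(3) ysb bs(2) by (intro exI[of _ "rev ys"] exI[of _ "rev bs"]) (auto simp: rev_nth)
qed

section \<open>Every closed walk of shapes comes from a pairing\<close>

definition young :: "(nat \<times> nat) set \<Rightarrow> bool" where
  "young Y \<longleftrightarrow> (\<forall>i j i' j'. (i, j) \<in> Y \<longrightarrow> i' \<le> i \<longrightarrow> j' \<le> j \<longrightarrow> (i', j') \<in> Y)"

lemma row_length_Suc_le: "tableau T \<Longrightarrow> row_length T (Suc i) \<le> row_length T i"
proof (induction T arbitrary: i)
  case (Cons R T)
  show ?case
  proof (cases i)
    case 0
    then show ?thesis using Cons.prems by (cases T) (simp_all add: dominates_def)
  next
    case (Suc k)
    then show ?thesis using Cons by simp
  qed
qed simp

lemma in_cells_row_length: "(i, j) \<in> cells T \<longleftrightarrow> j < row_length T i"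
  by (auto simp: in_cells row_length_def)

lemma young_cells:
  assumes "tableau T"
  shows "young (cells T)"
proof -
  have "row_length T i \<le> row_length T i'" if "i' \<le> i" for i i'
    using that by (induction i rule: dec_induct) (use row_length_Suc_le[OF assms] le_trans in blast)+
  then show ?thesis unfolding young_def in_cells_row_length by (meson le_less_trans less_le_trans)
qed

lemma young_transpose: "young (prod.swap ` Y) \<longleftrightarrow> young Y"
proof -
  have "(i, j) \<in> prod.swap ` Y \<longleftrightarrow> (j, i) \<in> Y" for i j by (simp add: image_iff Bex_def prod.swap_def split_beta) 
  then show ?thesis unfolding young_def by blast
qed

lemma add_cell_young:
  assumes T: "tableau T" "\<forall>z\<in>entries T. z < M" and Y: "young (insert c (cells T))" "c \<notin> cells T"
  shows "\<exists>i\<le>length T. tableau (add_cell T i M) \<and> cells (add_cell T i M) = insert c (cells T)"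
proof -
  obtain i j where c: "c = (i, j)" by (cases c)
  have j: "j = row_length T i"
  proof (rule ccontr)
    assume "j \<noteq> row_length T i"
    moreover have "\<not> j < row_length T i" using Y(2) c by (simp add: in_cells_row_length)
    ultimately have "row_length T i < j" by simp
    then have "(i, row_length T i) \<in> insert c (cells T)" using Y(1) c unfolding young_def by (meson insertI1 less_imp_le order_refl)
    then show False using \<open>row_length T i < j\<close> c by (simp add: in_cells_row_length)
  qed
  have up: "j < row_length T i'" if "i' < i" for i'
  proof -
    have "(i', j) \<in> insert c (cells T)" using Y(1) c that unfolding young_def by (meson insertI1 less_imp_le order_refl)
    then show ?thesis using that c by (simp add: in_cells_row_length)
  qed
  have i: "i \<le> length T"
  proof (rule ccontr)
    assume "\<not> i \<le> length T"
    then have "j < row_length T (length T)" by (intro up) simp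
    then show False by (simp add: row_length_def)
  qed
  moreover have "i > 0 \<longrightarrow> row_length T i < row_length T (i - 1)" using up[of "i - 1"] j by simp
  ultimately show ?thesis using tableau_add_cell[OF T] cells_add_cell c j by blast
qed

lemma row_insert_young:
  assumes T: "tableau X" and Y: "young Y" "cells X = insert c Y" "c \<notin> Y"
  shows "\<exists>x T. tableau T \<and> x \<notin> entries T \<and> row_insert x T = X \<and> cells T = Y"
proof -
  obtain i j where c: "c = (i, j)" by (cases c)
  have ij: "j < row_length X i" using Y(2) c in_cells_row_length[of i j X] by simp
  have j: "row_length X i = Suc j"
  proof (rule ccontr)
    assume "row_length X i \<noteq> Suc j"
    then have "(i, Suc j) \<in> cells X" using ij by (simp add: in_cells_row_length)
    then have "(i, Suc j) \<in> Y" using Y(2) c by simp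
    then have "(i, j) \<in> Y" using Y(1) unfolding young_def by (meson le_SucI order_refl)
    then show False using c Y(3) by simp
  qed
  have "row_length X (Suc i) < row_length X i"
  proof (rule ccontr)
    assume "\<not> ?thesis"
    then have "(Suc i, j) \<in> cells X" using ij by (simp add: in_cells_row_length)
    then have "(Suc i, j) \<in> Y" using Y(2) c by simp
    then have "(i, j) \<in> Y" using Y(1) unfolding young_def by (meson le_SucI order_refl)
    then show False using c Y(3) by simp
  qed
  moreover have "i < length X" using ij by (auto simp: row_length_def split: if_splits)
  ultimately obtain x T where xT: "tableau T" "x \<notin> entries T" "row_insert x T = X" "cells X = insert (i, row_length T i) (cells T)"
    using row_insert_surj[OF T] by blast
  have "cells T = Y"
  proof -
    have "(i, row_length T i) \<in> cells X" using xT(4) by simp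
    moreover have "(i, j) \<in> cells X" using ij by (simp add: in_cells_row_length)
    ultimately have "row_length T i \<le> j" "j < row_length T i \<or> j = row_length T i"
      using xT(4) j in_cells_row_length[of i "row_length T i" X] in_cells_row_length[of i j T] by auto
    then have "(i, row_length T i) = c" using c by simp
    then show ?thesis using xT(4) Y(2,3) new_cell by (metis insert_ident)
  qed
  then show ?thesis using xT by blast
qed

definition walk_step :: "(nat \<times> nat) set \<Rightarrow> (nat \<times> nat) set \<Rightarrow> bool" where
  "walk_step X Y \<longleftrightarrow> (\<exists>c. (c \<notin> X \<and> Y = insert c X) \<or> (c \<notin> Y \<and> X = insert c Y))"

lemma open_tableau_walk:
  assumes "pairing {1..r} f" "j < r"
  shows "walk_step (cells (open_tableau f r j)) (cells (open_tableau f r (Suc j)))"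
proof (cases "f (Suc j) \<le> j")
  case True
  obtain c where "c \<notin> cells (open_tableau f r (Suc j))"
    "cells (open_tableau f r j) = insert c (cells (open_tableau f r (Suc j)))"
    unfolding open_tableau_step(1)[OF assms True] using cells_row_insert by blast
  then show ?thesis unfolding walk_step_def by blast
next
  case False
  obtain i where i: "i \<le> length (open_tableau f r j)"
    "open_tableau f r (Suc j) = add_cell (open_tableau f r j) i (Suc j)"
    using open_tableau_opener[OF assms False] by blast
  then show ?thesis using cells_add_cell[OF i(1)] new_cell unfolding walk_step_def i(2) by blast
qed

text \<open>The tableaux are rebuilt upwards from the empty one: an added cell receives the label of
  the current point, and a removed cell ejects a letter by reverse insertion. The point at which
  \<open>a\<close> is ejected becomes the partner of \<open>a\<close>. Every left end gets a partner
  because the walk returns to the empty shape.\<close>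

lemma open_tableau_surj:
  assumes Y0: "Y 0 = {}" and Yr: "Y r = {}" and young: "\<And>j. j \<le> r \<Longrightarrow> young (Y j)"
    and step: "\<And>j. j < r \<Longrightarrow> walk_step (Y j) (Y (Suc j))"
  shows "\<exists>f. pairing {1..r} f \<and> (\<forall>j\<le>r. cells (open_tableau f r j) = Y j)"
proof -
  \<comment> \<open>The guards \<open>j \<le> r\<close> and \<open>j < r\<close> let dependent
    choice produce a sequence indexed by all naturals, with nothing required beyond
    \<open>r\<close>.\<close>
  define P where "P j T \<longleftrightarrow> (j \<le> r \<longrightarrow> tableau T \<and> cells T = Y j \<and> entries T \<subseteq> {1..j})" for j T
  define Q where "Q j T T' \<longleftrightarrow> (j < r \<longrightarrow>
      (T = restrict_tableau (Suc j) T' \<and> entries T' = insert (Suc j) (entries T) \<and> Suc j \<notin> entries T) \<or>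
      (\<exists>a. T = row_insert a T' \<and> a \<notin> entries T' \<and> entries T = insert a (entries T')))" for j T T'
  have "\<exists>T. \<forall>j. P j (T j) \<and> Q j (T j) (T (Suc j))"
  proof (rule dependent_nat_choice)
    show "\<exists>T. P 0 T" unfolding P_def using Y0 by (intro exI[of _ "[]"]) simp
    fix T j assume P: "P j T"
    show "\<exists>T'. P (Suc j) T' \<and> Q j T T'"
    proof (cases "j < r")
      case True
      have T: "tableau T" "cells T = Y j" "entries T \<subseteq> {1..j}" using P True unfolding P_def by simp_all
      obtain c where "(c \<notin> Y j \<and> Y (Suc j) = insert c (Y j)) \<or> (c \<notin> Y (Suc j) \<and> Y j = insert c (Y (Suc j)))"
        using step[OF True] unfolding walk_step_def by blast
      then show ?thesis
      proof
        assume c: "c \<notin> Y j \<and> Y (Suc j) = insert c (Y j)"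
        have lt: "\<forall>z\<in>entries T. z < Suc j" using T(3) by (auto simp: less_Suc_eq_le)
        obtain i where i: "i \<le> length T" "tableau (add_cell T i (Suc j))" "cells (add_cell T i (Suc j)) = insert c (cells T)"
        proof -
          have "young (insert c (cells T))" "c \<notin> cells T" using young[of "Suc j"] True c T(2) by simp_all
          then show thesis using that add_cell_young[OF T(1) lt] by blast
        qed
        have "restrict_tableau (Suc j) (add_cell T i (Suc j)) = T"
          by (rule restrict_add_cell[OF lt tableau_nonempty_rows[OF T(1)]])
        moreover have "entries T \<subseteq> {1..Suc j}" using T(3) by (rule order_trans) simp
        moreover have "Suc j \<notin> entries T" using lt by blast
        ultimately show ?thesis unfolding P_def Q_def using i c T(2)
          by (intro exI[of _ "add_cell T i (Suc j)"] conjI impI disjI1) (simp_all add: entries_add_cell)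
      next
        assume c: "c \<notin> Y (Suc j) \<and> Y j = insert c (Y (Suc j))"
        obtain x T' where x: "tableau T'" "x \<notin> entries T'" "row_insert x T' = T" "cells T' = Y (Suc j)"
        proof -
          have "young (Y (Suc j))" using young[of "Suc j"] True by simp
          moreover have "cells T = insert c (Y (Suc j))" "c \<notin> Y (Suc j)" using c T(2) by simp_all
          ultimately show thesis using that row_insert_young[OF T(1)] by blast
        qed
        have "entries T = insert x (entries T')" using entries_row_insert[OF x(1)] x(3) by blast
        then have e: "entries T = insert x (entries T')" "entries T' \<subseteq> {1..Suc j}"
          using T(3) by (auto simp: atLeastAtMostSuc_conv)
        show ?thesis unfolding P_def Q_def using x e
          by (intro exI[of _ T'] conjI impI disjI2 exI[of _ x]) simp_all
      qed
    next
      case False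
      then show ?thesis unfolding P_def Q_def by simp
    qed
  qed
  then obtain T where P: "\<And>j. P j (T j)" and Q: "\<And>j. Q j (T j) (T (Suc j))" by blast
  have T: "tableau (T j)" "cells (T j) = Y j" "entries (T j) \<subseteq> {1..j}" if "j \<le> r" for j
    using P[of j] that unfolding P_def by simp_all
  have T0: "entries (T 0) = {}" using T(3)[of 0] by simp
  have nil: "U = []" if "tableau U" "cells U = {}" for U
  proof (cases U)
    case (Cons R V)
    then have "(0, 0) \<in> cells U" using that by (auto simp: in_cells)
    then show ?thesis using that by simp
  qed
  have Tr: "T r = []" using nil T[of r] Yr by simp
  \<comment> \<open>\<open>I b a\<close> says that \<open>b\<close> is a right end at which
    \<open>a\<close> is ejected. \<open>C\<close> becomes the set of right ends, and
    \<open>\<alpha>\<close> sends each of them to its left end.\<close>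
  define I where "I b a \<longleftrightarrow> T (b - 1) = row_insert a (T b) \<and> a \<notin> entries (T b) \<and>
    entries (T (b - 1)) = insert a (entries (T b))" for b a
  define C where "C = {b \<in> {1..r}. \<exists>a. I b a}"
  define \<alpha> where "\<alpha> b = (SOME a. I b a)" for b
  have I\<alpha>: "I b (\<alpha> b)" if "b \<in> C" for b
  proof -
    have "\<exists>a. I b a" using that by (simp add: C_def)
    then show ?thesis unfolding \<alpha>_def by (rule someI_ex)
  qed
  note \<alpha> = I\<alpha>[unfolded I_def, THEN conjunct1] I\<alpha>[unfolded I_def, THEN conjunct2, THEN conjunct1]
    I\<alpha>[unfolded I_def, THEN conjunct2, THEN conjunct2]
  have op: "T (b - 1) = restrict_tableau b (T b) \<and> entries (T b) = insert b (entries (T (b - 1)))"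
    if b: "b \<in> {1..r} - C" for b
  proof -
    have b': "Suc (b - 1) = b" "b - 1 < r" using b by auto
    have "b - 1 < r \<longrightarrow> (T (b - 1) = restrict_tableau b (T b) \<and> entries (T b) = insert b (entries (T (b - 1))) \<and>
        b \<notin> entries (T (b - 1))) \<or> (\<exists>a. I b a)"
      using Q[of "b - 1"] unfolding Q_def I_def b'(1) .
    moreover have "\<not> (\<exists>a. I b a)" using b unfolding C_def by (simp del: not_ex)
    ultimately show ?thesis using b'(2) by (elim impE disjE conjE) (assumption | intro conjI | elim notE)+
  qed
  have \<alpha>_less: "\<alpha> b < b" if "b \<in> C" for b
    using \<alpha>(3)[OF that] T(3)[of "b - 1"] that unfolding C_def by fastforce
  \<comment> \<open>At level \<open>j\<close> the entries are the left ends that are still open. The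
    range, the injectivity and the surjectivity of \<open>\<alpha>\<close> are all read off from
    this description.\<close>
  have E: "entries (T j) = {a \<in> {1..j} - C. \<forall>b\<in>C. b \<le> j \<longrightarrow> \<alpha> b \<noteq> a}" if "j \<le> r" for j
    using that
  proof (induction j)
    case (Suc j)
    then have IH: "entries (T j) = {a \<in> {1..j} - C. \<forall>b\<in>C. b \<le> j \<longrightarrow> \<alpha> b \<noteq> a}" by simp
    show ?case
    proof (cases "Suc j \<in> C")
      case True
      have "entries (T (Suc j)) = entries (T j) - {\<alpha> (Suc j)}"
        using \<alpha>(2,3)[OF True] by auto
      then show ?thesis unfolding IH using True by (auto simp: le_Suc_eq)
    next
      case False
      have "entries (T (Suc j)) = insert (Suc j) (entries (T j))"
        using op[of "Suc j"] False Suc.prems by simp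
      moreover have "\<alpha> b \<noteq> Suc j" if "b \<in> C" "b \<le> j" for b using \<alpha>_less[OF that(1)] that(2) by simp
      ultimately show ?thesis unfolding IH using False by (auto simp: le_Suc_eq)
    qed
  qed (use T0 in simp)
  have \<alpha>_op: "\<alpha> b \<in> {1..r} - C" if "b \<in> C" for b
  proof -
    have b: "b \<in> {1..r}" using that unfolding C_def by simp
    have "\<alpha> b \<in> entries (T (b - 1))" using \<alpha>(3)[OF that] by simp
    moreover have "b - 1 \<le> r" using b by auto
    ultimately have "\<alpha> b \<in> {a \<in> {1..b - 1} - C. \<forall>b'\<in>C. b' \<le> b - 1 \<longrightarrow> \<alpha> b' \<noteq> a}"
      using E by blast
    then show ?thesis using b by auto
  qed
  have \<alpha>_inj: "inj_on \<alpha> C"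
  proof (rule linorder_inj_onI')
    fix b b' assume b: "b \<in> C" "b' \<in> C" "b < b'"
    have b': "b' \<in> {1..r}" using b unfolding C_def by simp
    have "\<alpha> b' \<in> entries (T (b' - 1))" using \<alpha>(3)[OF b(2)] by simp
    moreover have "b' - 1 \<le> r" using b' by auto
    ultimately have "\<alpha> b' \<in> {a \<in> {1..b' - 1} - C. \<forall>b\<in>C. b \<le> b' - 1 \<longrightarrow> \<alpha> b \<noteq> a}"
      using E by blast
    then show "\<alpha> b \<noteq> \<alpha> b'" using b by auto
  qed
  have \<alpha>_surj: "a \<in> \<alpha> ` C" if "a \<in> {1..r} - C" for a
  proof -
    have "a \<notin> entries (T r)" using Tr by simp
    then show ?thesis using E[of r] that by auto
  qed
  define f where "f x = (if x \<in> C then \<alpha> x else inv_into C \<alpha> x)" for x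
  have CC: "C \<subseteq> {1..r}" unfolding C_def by blast
  have f: "pairing {1..r} f" unfolding pairing_def
  proof
    fix x assume x: "x \<in> {1..r}"
    show "f x \<in> {1..r} \<and> f x \<noteq> x \<and> f (f x) = x"
    proof (cases "x \<in> C")
      case True
      then show ?thesis using \<alpha>_op[OF True] \<alpha>_less[OF True] inv_into_f_f[OF \<alpha>_inj True] by (simp add: f_def)
    next
      case False
      then have "x \<in> \<alpha> ` C" using \<alpha>_surj x by blast
      then have "inv_into C \<alpha> x \<in> C" "\<alpha> (inv_into C \<alpha> x) = x" by (simp_all add: inv_into_into f_inv_into_f)
      then show ?thesis using False CC by (auto simp: f_def)
    qed
  qed
  \<comment> \<open>The induction descends from the empty tableau at \<open>r\<close>, the direction
    in which \<open>open_tableau\<close> inserts and deletes.\<close>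
  have "open_tableau f r j = T j" if "j \<le> r" for j
    using that
  proof (induction rule: inc_induct)
    case base
    then show ?case using open_tableau_ends[OF f] Tr by simp
  next
    case (step j)
    show ?case
    proof (cases "Suc j \<in> C")
      case True
      then have "f (Suc j) = \<alpha> (Suc j)" by (simp add: f_def)
      moreover from this have "f (Suc j) \<le> j" using \<alpha>_less[OF True] by simp
      ultimately show ?thesis using open_tableau_step(1)[OF f step(2)] step(3) \<alpha>(1)[OF True] by simp
    next
      case False
      then have "Suc j \<in> \<alpha> ` C" using \<alpha>_surj step(2) by simp
      then obtain b where b: "b \<in> C" "Suc j = \<alpha> b" by blast
      then have "f (Suc j) = b" using False inv_into_f_f[OF \<alpha>_inj b(1)] by (simp add: f_def)
      then have "\<not> f (Suc j) \<le> j" using \<alpha>_less[OF b(1)] b(2) by simp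
      then show ?thesis using open_tableau_step(2)[OF f step(2)] step(3) op[of "Suc j"] False step(2) by simp
    qed
  qed
  then show ?thesis using f T(2) by auto
qed

section \<open>Columns of the first row as colours\<close>

definition first_row :: "nat list list \<Rightarrow> nat list" where
  "first_row T = (case T of [] \<Rightarrow> [] | R # _ \<Rightarrow> R)"

definition insertion_column :: "nat \<Rightarrow> nat list list \<Rightarrow> nat" where
  "insertion_column x T = length (takeWhile (\<lambda>z. z < x) (first_row T))"

lemma first_row_insert:
  "insertion_column x T < length (first_row (row_insert x T))"
  "first_row (row_insert x T) ! insertion_column x T = x"
  "i < length (first_row T) \<Longrightarrow>
    i < length (first_row (row_insert x T)) \<and> first_row (row_insert x T) ! i \<le> first_row T ! i"
proof -
  define R1 where "R1 = takeWhile (\<lambda>z. z < x) (first_row T)"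
  define R2 where "R2 = dropWhile (\<lambda>z. z < x) (first_row T)"
  have R: "first_row T = R1 @ R2" by (simp add: R1_def R2_def)
  have ins: "first_row (row_insert x T) = R1 @ x # tl R2"
  proof (cases T)
    case Nil
    then show ?thesis by (simp add: first_row_def R1_def R2_def)
  next
    case (Cons R U)
    then have T: "T = R # U" "first_row T = R" by (simp_all add: first_row_def)
    show ?thesis
    proof (cases R2)
      case Nil
      then have "row_insert x T = (R @ [x]) # U" using T R2_def by (simp only: row_insert.simps list.case)
      then show ?thesis using Nil R T by (simp add: first_row_def del: row_insert.simps)
    next
      case (Cons y ys)
      then have "dropWhile (\<lambda>z. z < x) R = y # ys" using T R2_def by simp
      then have "row_insert x T = (R1 @ x # ys) # row_insert y U"
        using T R1_def by (simp only: row_insert.simps list.case)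
      then show ?thesis using Cons by (simp add: first_row_def del: row_insert.simps)
    qed
  qed
  have col: "insertion_column x T = length R1" by (simp add: insertion_column_def R1_def)
  show "insertion_column x T < length (first_row (row_insert x T))"
    "first_row (row_insert x T) ! insertion_column x T = x"
    unfolding ins col by simp_all
  assume i: "i < length (first_row T)"
  have "x \<le> R2 ! 0" if "R2 \<noteq> []" using that hd_dropWhile[of "\<lambda>z. z < x" "first_row T"]
    unfolding R2_def by (simp add: hd_conv_nth)
  then show "i < length (first_row (row_insert x T)) \<and> first_row (row_insert x T) ! i \<le> first_row T ! i"
    using i unfolding ins R by (cases R2) (auto simp: nth_append nth_Cons split: nat.splits)
qed

lemma first_row_restrict:
  assumes "tableau T" "\<forall>z\<in>entries T. z \<le> M" "i < length (first_row T)" "first_row T ! i < M"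
  shows "i < length (first_row (restrict_tableau M T)) \<and>
    first_row (restrict_tableau M T) ! i = first_row T ! i"
proof (cases T)
  case (Cons R U)
  then have R: "sorted_wrt (<) R" "i < length R" "R ! i < M" "\<forall>z\<in>set R. z \<le> M"
    using assms by (simp_all add: first_row_def)
  show ?thesis
  proof (cases "M \<in> set R")
    case True
    then obtain R0 where R0: "R = R0 @ [M]" "\<forall>z\<in>set R0. z < M" using last_of_max[OF R(1)] R(4) by blast
    have fR: "filter (\<lambda>z. z < M) R0 = R0" using R0(2) by (simp add: filter_id_conv)
    have i: "i < length R0" using R R0(1) by (auto simp: nth_append less_Suc_eq)
    then have "R0 \<noteq> []" by auto
    then show ?thesis using Cons R0(1) fR i by (simp add: first_row_def nth_append)
  next
    case False
    then have "filter (\<lambda>z. z < M) R = R" using R(4) by (auto simp: filter_id_conv order_less_le)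
    moreover have "R \<noteq> []" using R(2) by auto
    ultimately show ?thesis using Cons R(2) by (simp add: first_row_def)
  qed
qed (use assms(3) in \<open>simp add: first_row_def\<close>)

definition fifo_colouring :: "nat set \<Rightarrow> (nat \<Rightarrow> nat) \<Rightarrow> nat \<Rightarrow> (nat \<Rightarrow> nat) \<Rightarrow> bool" where
  "fifo_colouring V f n c \<longleftrightarrow> (\<forall>x\<in>V. c x < n \<and> c (f x) = c x) \<and>
    (\<forall>x\<in>V. \<forall>y\<in>V. x < f x \<longrightarrow> y < f y \<longrightarrow> c x = c y \<longrightarrow> x < y \<longrightarrow> f x < f y)"

text \<open>In a fixed column of the first row, insertion only decreases the entry, and deletion removes it only
  once \<open>j\<close> has passed below it. So a strand that ends further left and enters the same column also
  starts further left.\<close>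

lemma fifo_colouring_if_columns:
  assumes f: "pairing {1..r} f" and cols: "\<And>j. j \<le> r \<Longrightarrow> cells (open_tableau f r j) \<subseteq> UNIV \<times> {..<n}"
  shows "\<exists>c. fifo_colouring {1..r} f n c"
proof -
  define k where "k b = insertion_column (f b) (open_tableau f r b)" for b
  have step: "open_tableau f r (b - 1) = row_insert (f b) (open_tableau f r b)" if "b \<in> {1..r}" "f b < b" for b
    using open_tableau_step(1)[OF f, of "b - 1"] that by (cases b) auto
  have inv: "k b < length (first_row (open_tableau f r j)) \<and> first_row (open_tableau f r j) ! k b \<le> f b"
    if b: "b \<in> {1..r}" "f b < b" and j: "j < b" "f b \<le> j" for b j
  proof -
    have "j \<le> b - 1" using j by simp
    then show ?thesis using j(2)
    proof (induction rule: inc_induct)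
      case base
      then show ?case using step[OF b] first_row_insert(1,2) unfolding k_def by simp
    next
      case (step i)
      then have IH: "k b < length (first_row (open_tableau f r (Suc i)))"
        "first_row (open_tableau f r (Suc i)) ! k b \<le> f b" by auto
      have i: "i < r" using step.hyps b(1) by auto
      show ?case
      proof (cases "f (Suc i) \<le> i")
        case True
        show ?thesis unfolding open_tableau_step(1)[OF f i True]
          using first_row_insert(3)[OF IH(1)] IH(2) le_trans by blast
      next
        case False
        have "\<forall>z\<in>entries (open_tableau f r (Suc i)). z \<le> Suc i"
          unfolding tableau_open_tableau(2)[OF f] by simp
        then show ?thesis unfolding open_tableau_step(2)[OF f i False]
          using first_row_restrict[OF tableau_open_tableau(1)[OF f] _ IH(1)] IH(2) step.prems by simp
      qed
    qed
  qed
  have kn: "k b < n" if b: "b \<in> {1..r}" "f b < b" for b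
  proof -
    have "k b < length (first_row (open_tableau f r (b - 1)))" using inv[OF b, of "b - 1"] b by simp
    then have "(0, k b) \<in> cells (open_tableau f r (b - 1))"
      by (auto simp: first_row_def in_cells split: list.splits)
    moreover have "b - 1 \<le> r" using b(1) by auto
    ultimately show ?thesis using cols[of "b - 1"] by (meson SigmaD2 lessThan_iff subsetD)
  qed
  define c where "c x = (if f x < x then k x else k (f x))" for x
  have F: "f x \<in> {1..r}" "f x \<noteq> x" "f (f x) = x" if "x \<in> {1..r}" for x
    using f that by (auto simp: pairing_def)
  have "fifo_colouring {1..r} f n c" unfolding fifo_colouring_def
  proof (intro conjI ballI impI)
    fix x assume x: "x \<in> {1..r}"
    show "c x < n"
    proof (cases "f x < x")
      case False
      then have "f (f x) < f x" using F[OF x] by simp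
      then show ?thesis using False kn[OF F(1)[OF x]] by (simp add: c_def)
    qed (use kn x in \<open>simp add: c_def\<close>)
    show "c (f x) = c x" using F[OF x] by (auto simp: c_def)
  next
    fix x y assume x: "x \<in> {1..r}" and y: "y \<in> {1..r}" and "x < f x" "y < f y" and c: "c x = c y" and "x < y"
    have kk: "k (f x) = k (f y)" using c \<open>x < f x\<close> \<open>y < f y\<close> by (simp add: c_def)
    show "f x < f y"
    proof (rule ccontr)
      assume "\<not> f x < f y"
      moreover have "f x \<noteq> f y" using F(3)[OF x] F(3)[OF y] \<open>x < y\<close> by auto
      ultimately have lt: "f y < f x" by simp
      \<comment> \<open>When \<open>f y\<close> inserts \<open>y\<close>, the column into which
        \<open>f x\<close> inserted \<open>x\<close> still holds an entry at most \<open>x\<close>.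
        Since \<open>x < y\<close>, the letter \<open>y\<close> would have to enter further right,
        so the two columns cannot agree.\<close>
      have "k (f x) < length (first_row (open_tableau f r (f y))) \<and> first_row (open_tableau f r (f y)) ! k (f x) \<le> f (f x)"
        by (rule inv) (use F(1,3)[OF x] lt \<open>x < f x\<close> \<open>y < f y\<close> \<open>x < y\<close> in auto)
      then have "k (f y) < length (first_row (open_tableau f r (f y)))" "first_row (open_tableau f r (f y)) ! k (f y) \<le> x"
        unfolding kk F(3)[OF x] by blast+
      then have "\<not> first_row (open_tableau f r (f y)) ! k (f y) < y"
        unfolding k_def insertion_column_def F(3)[OF y] by (intro nth_length_takeWhile) simp
      then show False using \<open>first_row (open_tableau f r (f y)) ! k (f y) \<le> x\<close> \<open>x < y\<close> by simp
    qed
  qed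
  then show ?thesis by blast
qed

definition noncrossing :: "nat \<Rightarrow> nat set \<Rightarrow> (nat \<Rightarrow> nat) \<Rightarrow> bool" where
  "noncrossing m V f \<longleftrightarrow> \<not> (\<exists>as bs. length as = m \<and> length bs = m \<and> sorted_wrt (<) (as @ bs) \<and>
    set bs \<subseteq> V \<and> (\<forall>i<m. as ! i = f (bs ! i)))"

lemma walk_step_swap:
  assumes "walk_step X Y"
  shows "walk_step (prod.swap ` X) (prod.swap ` Y)"
proof -
  obtain c where "(c \<notin> X \<and> Y = insert c X) \<or> (c \<notin> Y \<and> X = insert c Y)"
    using assms unfolding walk_step_def by blast
  then have "(prod.swap c \<notin> prod.swap ` X \<and> prod.swap ` Y = insert (prod.swap c) (prod.swap ` X)) \<or>
      (prod.swap c \<notin> prod.swap ` Y \<and> prod.swap ` X = insert (prod.swap c) (prod.swap ` Y))"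
    by (elim disj_forward conj_forward) (simp_all only: image_insert inj_image_mem_iff[OF inj_swap] simp_thms)
  then show ?thesis unfolding walk_step_def by blast
qed

lemma transposed_pairing:
  assumes f: "pairing {1..r} f" and nc: "noncrossing (n + 1) {1..r} f"
  shows "\<exists>g c. pairing {1..r} g \<and> fifo_colouring {1..r} g n c \<and>
    (\<forall>j\<le>r. cells (open_tableau g r j) = prod.swap ` cells (open_tableau f r j))"
proof -
  have rows: "length (open_tableau f r j) \<le> n" for j
  proof (rule ccontr)
    assume "\<not> ?thesis"
    then have "n + 1 \<le> length (rsk (open_word f r j))" by (simp add: open_tableau_def)
    then have "has_decreasing (n + 1) (open_word f r j)"
      by (rule has_decreasing_mono[OF has_decreasing_if_rows[OF distinct_open_word[OF f]]])
    then show False using nc has_decreasing_crossing[OF f] unfolding noncrossing_def by blast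
  qed
  have "\<exists>g. pairing {1..r} g \<and> (\<forall>j\<le>r. cells (open_tableau g r j) = prod.swap ` cells (open_tableau f r j))"
  proof (rule open_tableau_surj)
    show "prod.swap ` cells (open_tableau f r 0) = {}" "prod.swap ` cells (open_tableau f r r) = {}"
      by (simp_all add: open_tableau_ends[OF f])
    show "young (prod.swap ` cells (open_tableau f r j))" for j
      unfolding young_transpose by (rule young_cells[OF tableau_open_tableau(1)[OF f]])
    show "walk_step (prod.swap ` cells (open_tableau f r j)) (prod.swap ` cells (open_tableau f r (Suc j)))"
      if "j < r" for j by (rule walk_step_swap[OF open_tableau_walk[OF f that]])
  qed
  then obtain g where g: "pairing {1..r} g" "\<forall>j\<le>r. cells (open_tableau g r j) = prod.swap ` cells (open_tableau f r j)"
    by blast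
  have "\<exists>c. fifo_colouring {1..r} g n c"
  proof (rule fifo_colouring_if_columns[OF g(1)])
    fix j assume "j \<le> r"
    then have "cells (open_tableau g r j) = prod.swap ` cells (open_tableau f r j)" using g(2) by blast
    moreover have "i < n" if "(i, k) \<in> cells (open_tableau f r j)" for i k
      using rows[of j] that unfolding in_cells by linarith
    ultimately show "cells (open_tableau g r j) \<subseteq> UNIV \<times> {..<n}" by auto
  qed
  then show ?thesis using g by blast
qed

section \<open>Perfect matchings\<close>

definition strands :: "'a set \<Rightarrow> ('a \<Rightarrow> 'a) \<Rightarrow> 'a set set" where
  "strands V f = (\<lambda>x. {x, f x}) ` V"

lemma pairing_D:
  assumes "pairing V f" "x \<in> V"
  shows "f x \<in> V" "f x \<noteq> x" "f (f x) = x"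
  using assms by (simp_all add: pairing_def)

lemma strand_iff:
  assumes "pairing V f"
  shows "{x, y} \<in> strands V f \<longleftrightarrow> x \<in> V \<and> y = f x"
proof
  assume "{x, y} \<in> strands V f"
  then obtain z where z: "z \<in> V" "{x, y} = {z, f z}" unfolding strands_def by blast
  then show "x \<in> V \<and> y = f x" using pairing_D[OF assms z(1)] by (auto simp: doubleton_eq_iff)
qed (auto simp: strands_def)

lemma strands_perfect_matching:
  assumes f: "pairing V f"
  shows "strands V f \<in> perfect_matchings V"
proof -
  have "f ` V \<subseteq> V" using pairing_D(1)[OF f] by blast
  then have "\<Union>(strands V f) = V" by (auto simp: strands_def)
  moreover have "disjoint (strands V f)"
  proof (rule disjointI)
    fix e e' assume e: "e \<in> strands V f" "e' \<in> strands V f" "e \<noteq> e'"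
    show "e \<inter> e' = {}"
    proof (rule ccontr)
      assume "e \<inter> e' \<noteq> {}"
      then obtain z where z: "z \<in> e" "z \<in> e'" by blast
      have "u = {z, f z}" if "u \<in> strands V f" "z \<in> u" for u
      proof -
        obtain x where x: "x \<in> V" "u = {x, f x}" using \<open>u \<in> strands V f\<close> unfolding strands_def by blast
        then show ?thesis using \<open>z \<in> u\<close> pairing_D(3)[OF f x(1)] by auto
      qed
      then show False using e z by blast
    qed
  qed
  moreover have "card e = 2" if "e \<in> strands V f" for e
  proof -
    obtain x where "x \<in> V" "e = {x, f x}" using \<open>e \<in> strands V f\<close> unfolding strands_def by blast
    then show ?thesis using pairing_D(2)[OF f, of x] by (simp add: card_2_iff)
  qed
  moreover have "{} \<notin> strands V f" by (auto simp: strands_def)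
  ultimately show ?thesis unfolding perfect_matchings_def partition_on_def by blast
qed

lemma perfect_matching_strands:
  assumes "d \<in> perfect_matchings V"
  obtains f where "pairing V f" "d = strands V f"
proof -
  have U: "\<Union>d = V" and disj: "disjoint d" and c2: "\<And>e. e \<in> d \<Longrightarrow> card e = 2"
    using assms unfolding perfect_matchings_def partition_on_def by auto
  have "\<exists>y. {x, y} \<in> d \<and> x \<noteq> y" if x: "x \<in> V" for x
  proof -
    obtain e where e: "e \<in> d" "x \<in> e" using x U by blast
    then obtain a b where ab: "e = {a, b}" "a \<noteq> b" using c2[OF e(1)] by (auto simp: card_2_iff)
    show ?thesis
    proof (cases "x = a")
      case False
      then have "x = b" using e(2) ab by blast
      then show ?thesis using e(1) ab by (intro exI[of _ a]) (simp add: insert_commute)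
    qed (use e(1) ab in blast)
  qed
  then have "\<exists>f. \<forall>x\<in>V. {x, f x} \<in> d \<and> x \<noteq> f x" by (intro bchoice) blast
  then obtain f where f: "\<And>x. x \<in> V \<Longrightarrow> {x, f x} \<in> d \<and> x \<noteq> f x" by blast
  have uniq: "e = {x, f x}" if "e \<in> d" "x \<in> e" for e x
  proof -
    have "x \<in> V" using that U by blast
    then have "{x, f x} \<in> d" using f by blast
    moreover have "e \<inter> {x, f x} \<noteq> {}" using that by blast
    ultimately show ?thesis using disjointD[OF disj that(1)] by blast
  qed
  have "pairing V f" unfolding pairing_def
  proof
    fix x assume x: "x \<in> V"
    have fx: "f x \<in> V" using f[OF x] U by blast
    have "{x, f x} \<in> d" "f x \<in> {x, f x}" "x \<noteq> f x" using f[OF x] by simp_all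
    then have "{x, f x} = {f x, f (f x)}" by (intro uniq)
    then have "f (f x) = x" using \<open>x \<noteq> f x\<close> by (metis doubleton_eq_iff)
    then show "f x \<in> V \<and> f x \<noteq> x \<and> f (f x) = x" using fx \<open>x \<noteq> f x\<close> by simp
  qed
  moreover have "d = strands V f"
  proof
    show "d \<subseteq> strands V f"
    proof
      fix e assume e: "e \<in> d"
      then obtain x where "x \<in> e" using c2[OF e] by (auto simp: card_2_iff)
      then show "e \<in> strands V f" using uniq[OF e] U e unfolding strands_def by blast
    qed
    show "strands V f \<subseteq> d" using f unfolding strands_def by blast
  qed
  ultimately show thesis using that by blast
qed

text \<open>Serves both the exchange of two points and the passage from numbers to tagged
  nodes.\<close>

lemma perfect_matchings_image:
  assumes h: "inj_on h V"
  shows "perfect_matchings (h ` V) = (`) ((`) h) ` perfect_matchings V"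
proof -
  have sub: "(`) ((`) h) ` perfect_matchings V \<subseteq> perfect_matchings (h ` V)" if h: "inj_on h V" for h :: "'a \<Rightarrow> 'b" and V
  proof
    fix d' assume "d' \<in> (`) ((`) h) ` perfect_matchings V"
    then obtain d where d: "d \<in> perfect_matchings V" "d' = (`) h ` d" by blast
    obtain f where f: "pairing V f" "d = strands V f" using d(1) by (rule perfect_matching_strands)
    define g where "g = h \<circ> f \<circ> the_inv_into V h"
    have g: "g (h x) = h (f x)" if "x \<in> V" for x using that h by (simp add: g_def the_inv_into_f_f)
    have "pairing (h ` V) g" unfolding pairing_def
    proof
      fix y assume "y \<in> h ` V"
      then obtain x where x: "x \<in> V" "y = h x" by blast
      have fx: "f x \<in> V" "f x \<noteq> x" "f (f x) = x" using pairing_D[OF f(1) x(1)] by simp_all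
      have "h (f x) \<noteq> h x" using h fx x by (simp add: inj_on_eq_iff)
      then show "g y \<in> h ` V \<and> g y \<noteq> y \<and> g (g y) = y" using fx x by (simp add: g)
    qed
    moreover have "d' = strands (h ` V) g" using g by (auto simp: d(2) f(2) strands_def image_image)
    ultimately show "d' \<in> perfect_matchings (h ` V)" using strands_perfect_matching by blast
  qed
  show ?thesis
  proof
    show "perfect_matchings (h ` V) \<subseteq> (`) ((`) h) ` perfect_matchings V"
    proof
      fix d assume d: "d \<in> perfect_matchings (h ` V)"
      then obtain g where g: "pairing (h ` V) g" "d = strands (h ` V) g" by (rule perfect_matching_strands)
      define f where "f x = the_inv_into V h (g (h x))" for x
      have hf: "h (f x) = g (h x)" "f x \<in> V" if "x \<in> V" for x
        using that pairing_D(1)[OF g(1), of "h x"] h by (simp_all add: f_def f_the_inv_into_f the_inv_into_into)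
      have "pairing V f" unfolding pairing_def
      proof
        fix x assume x: "x \<in> V"
        have "h (f (f x)) = h x" using hf x pairing_D(3)[OF g(1), of "h x"] by simp
        then have "f (f x) = x" using h hf x by (meson inj_onD)
        moreover have "f x \<noteq> x" using hf(1)[OF x] pairing_D(2)[OF g(1), of "h x"] x by auto
        ultimately show "f x \<in> V \<and> f x \<noteq> x \<and> f (f x) = x" using hf x by blast
      qed
      moreover have "d = (`) h ` strands V f" using hf(1) by (auto simp: g(2) strands_def image_image)
      ultimately show "d \<in> (`) ((`) h) ` perfect_matchings V" using strands_perfect_matching by blast
    qed
  qed (rule sub[OF h])
qed

lemma finite_perfect_matchings: "finite V \<Longrightarrow> finite (perfect_matchings V)"
  by (rule finite_subset[of _ "Pow (Pow V)"]) (auto simp: perfect_matchings_def partition_on_def)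

lemma finite_perfect_matching: "finite V \<Longrightarrow> d \<in> perfect_matchings V \<Longrightarrow> finite d"
  by (rule finite_subset[of _ "Pow V"]) (auto simp: perfect_matchings_def partition_on_def)

lemma perfect_matchings_Un:
  assumes "m \<in> perfect_matchings S" "f \<in> perfect_matchings (V - S)" "S \<subseteq> V"
  shows "m \<union> f \<in> perfect_matchings V" "m \<inter> f = {}"
proof -
  have U: "\<Union>m = S" "\<Union>f = V - S"
    using assms(1,2) by (simp_all add: perfect_matchings_def partition_on_def)
  have ne: "{} \<notin> m" using assms(1) by (simp add: perfect_matchings_def partition_on_def)
  show "m \<inter> f = {}"
  proof (rule ccontr)
    assume "m \<inter> f \<noteq> {}"
    then obtain e where "e \<in> m" "e \<in> f" by blast
    then have "e = {}" using U by blast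
    then show False using ne \<open>e \<in> m\<close> by blast
  qed
  have "\<Union>(m \<union> f) = V" using U assms(3) by blast
  moreover have "disjoint (m \<union> f)"
    using assms U by (intro disjoint_union) (auto simp add: perfect_matchings_def partition_on_def)
  moreover have "{} \<notin> m \<union> f" "\<forall>e\<in>m \<union> f. card e = 2"
    using assms by (auto simp only: perfect_matchings_def partition_on_def)
  ultimately show "m \<union> f \<in> perfect_matchings V"
    unfolding perfect_matchings_def partition_on_def by blast
qed

section \<open>Exchanging two points of a matching\<close>

abbreviation swap_matching :: "'a \<Rightarrow> 'a \<Rightarrow> 'a set set \<Rightarrow> 'a set set" where
  "swap_matching p p' d \<equiv> (`) (Transposition.transpose p p') ` d"

lemma swap_matching_perfect:
  assumes "d \<in> perfect_matchings V" "p \<in> V" "p' \<in> V"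
  shows "swap_matching p p' d \<in> perfect_matchings V"
proof -
  have "Transposition.transpose p p' ` V = V" using assms by (simp add: transpose_image_eq)
  moreover have "inj_on (Transposition.transpose p p') V" by (simp add: inj_on_transpose)
  ultimately show ?thesis using perfect_matchings_image[of "Transposition.transpose p p'" V] assms(1) by auto
qed

lemma swap_matching_swap: "swap_matching p p' (swap_matching p p' d) = d"
  by (simp add: image_image)

lemma swap_strands:
  assumes "pairing V f" "p \<in> V" "p' \<in> V"
  shows "swap_matching p p' (strands V f) =
    strands V (Transposition.transpose p p' \<circ> f \<circ> Transposition.transpose p p')"
    "pairing V (Transposition.transpose p p' \<circ> f \<circ> Transposition.transpose p p')"
proof -
  let ?t = "Transposition.transpose p p'"
  have V: "?t ` V = V" using assms by (simp add: transpose_image_eq)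
  have "strands V (?t \<circ> f \<circ> ?t) = strands (?t ` V) (?t \<circ> f \<circ> ?t)" unfolding V ..
  also have "\<dots> = swap_matching p p' (strands V f)" by (simp add: strands_def image_image)
  finally show "swap_matching p p' (strands V f) = strands V (?t \<circ> f \<circ> ?t)" ..
  have "?t x \<in> V" if "x \<in> V" for x using V that by blast
  moreover have "?t (f (?t x)) \<noteq> x" if "f (?t x) \<noteq> ?t x" for x using that by (metis transpose_involutory)
  ultimately show "pairing V (?t \<circ> f \<circ> ?t)" using pairing_D[OF assms(1)] by (simp add: pairing_def)
qed

text \<open>The exchange only replaces \<open>{p, f p}\<close> and \<open>{p', f p'}\<close> by
  \<open>{p', f p}\<close> and \<open>{p, f p'}\<close>. Lost and gained terms stand on opposite
  sides to avoid subtraction of naturals.\<close>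

lemma sum_swap_matching:
  fixes g :: "'a set \<Rightarrow> nat"
  assumes f: "pairing V f" and V: "finite V" "p \<in> V" "p' \<in> V" "p \<noteq> p'" "f p \<noteq> p'"
  shows "sum g (swap_matching p p' (strands V f)) + g {p, f p} + g {p', f p'} =
    sum g (strands V f) + g {p', f p} + g {p, f p'}"
proof -
  let ?t = "Transposition.transpose p p'"
  let ?E = "{{p, f p}, {p', f p'}}"
  have fin: "finite (strands V f)" using V by (simp add: strands_def)
  have E: "?E \<subseteq> strands V f" using V by (auto simp: strands_def)
  have ne: "{p, f p} \<noteq> {p', f p'}" using V by (auto simp: doubleton_eq_iff)
  have "f p' \<noteq> p" using V pairing_D(3)[OF f] by metis
  then have t: "?t ` {p, f p} = {p', f p}" "?t ` {p', f p'} = {p, f p'}"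
    using V pairing_D(2)[OF f] by auto
  have rest: "?t ` e = e" if "e \<in> strands V f - ?E" for e
  proof -
    obtain x where x: "x \<in> V" "e = {x, f x}" using \<open>e \<in> strands V f - ?E\<close> unfolding strands_def by blast
    have "p \<notin> e" "p' \<notin> e" using that x pairing_D[OF f] by (auto simp: insert_commute)
    then have "?t y = y" if "y \<in> e" for y using that by (intro transpose_apply_other) auto
    then show ?thesis by auto
  qed
  have inj: "inj_on ((`) ?t) (strands V f)" by (rule inj_on_inverseI[of _ "(`) ?t"]) (simp add: image_image)
  have "sum g (swap_matching p p' (strands V f)) = (\<Sum>e\<in>strands V f. g (?t ` e))"
    using sum.reindex[OF inj, of g] by (simp add: comp_def)
  also have "\<dots> = (\<Sum>e\<in>strands V f - ?E. g (?t ` e)) + (\<Sum>e\<in>?E. g (?t ` e))"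
    using sum.subset_diff[OF E fin] .
  also have "(\<Sum>e\<in>strands V f - ?E. g (?t ` e)) = (\<Sum>e\<in>strands V f - ?E. g e)"
    by (intro sum.cong refl) (simp only: rest)
  also have "(\<Sum>e\<in>?E. g (?t ` e)) = g {p', f p} + g {p, f p'}" using ne t by simp
  finally have "sum g (swap_matching p p' (strands V f)) = sum g (strands V f - ?E) + (g {p', f p} + g {p, f p'})" .
  moreover have "sum g (strands V f) = sum g (strands V f - ?E) + (g {p, f p} + g {p', f p'})"
    using sum.subset_diff[OF E fin, of g] ne by simp
  ultimately show ?thesis by simp
qed

text \<open>Within a colour both pairings are increasing bijections from the points in
  \<open>P\<close> to those outside, hence equal: the partner of \<open>x\<close> is preceded by as
  many points outside \<open>P\<close> of its colour as \<open>x\<close> is by points in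
  \<open>P\<close>. The two uses are first in, first out matchings and, with a constant colour, full
  crossings.\<close>

lemma monotone_pairing_unique:
  fixes V :: "nat set"
  assumes V: "finite V" and f: "pairing V f" and g: "pairing V g"
    and P: "\<And>x. x \<in> V \<Longrightarrow> f x \<in> P \<longleftrightarrow> x \<notin> P" "\<And>x. x \<in> V \<Longrightarrow> g x \<in> P \<longleftrightarrow> x \<notin> P"
    and c: "\<And>x. x \<in> V \<Longrightarrow> c (f x) = c x" "\<And>x. x \<in> V \<Longrightarrow> c (g x) = c x"
    and mono_f: "\<And>x y. x \<in> V \<inter> P \<Longrightarrow> y \<in> V \<inter> P \<Longrightarrow> c x = c y \<Longrightarrow> x < y \<Longrightarrow> f x < f y"
    and mono_g: "\<And>x y. x \<in> V \<inter> P \<Longrightarrow> y \<in> V \<inter> P \<Longrightarrow> c x = c y \<Longrightarrow> x < y \<Longrightarrow> g x < g y"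
  shows "strands V f = strands V g"
proof -
  have rank: "card {z \<in> V - P. c z = c x \<and> z < h x} = card {y \<in> V \<inter> P. c y = c x \<and> y < x}"
    if x: "x \<in> V \<inter> P" and h: "pairing V h" and Ph: "\<And>x. x \<in> V \<Longrightarrow> h x \<in> P \<longleftrightarrow> x \<notin> P"
      and ch: "\<And>x. x \<in> V \<Longrightarrow> c (h x) = c x"
      and mono_h: "\<And>x y. x \<in> V \<inter> P \<Longrightarrow> y \<in> V \<inter> P \<Longrightarrow> c x = c y \<Longrightarrow> x < y \<Longrightarrow> h x < h y"
    for x h
  proof -
    have "{z \<in> V - P. c z = c x \<and> z < h x} = h ` {y \<in> V \<inter> P. c y = c x \<and> y < x}"
    proof (intro equalityI subsetI)
      fix z assume z: "z \<in> {z \<in> V - P. c z = c x \<and> z < h x}"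
      then have zV: "z \<in> V" by simp
      have "h z \<in> V \<inter> P" "c (h z) = c x" "h (h z) = z" using z pairing_D[OF h zV] Ph[OF zV] ch[OF zV] by auto
      moreover have "h z < x"
      proof (rule ccontr)
        assume "\<not> h z < x"
        then have "h x < h (h z) \<or> x = h z" using mono_h[OF x \<open>h z \<in> V \<inter> P\<close>] \<open>c (h z) = c x\<close> by fastforce
        then show False using z \<open>h (h z) = z\<close> by auto
      qed
      ultimately show "z \<in> h ` {y \<in> V \<inter> P. c y = c x \<and> y < x}" by (intro image_eqI[of _ _ "h z"]) auto
    next
      fix z assume "z \<in> h ` {y \<in> V \<inter> P. c y = c x \<and> y < x}"
      then obtain y where "y \<in> V \<inter> P" "c y = c x" "y < x" "z = h y" by blast
      then show "z \<in> {z \<in> V - P. c z = c x \<and> z < h x}"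
        using pairing_D(1)[OF h, of y] Ph[of y] ch[of y] mono_h[of y x] x by simp
    qed
    moreover have "inj_on h {y \<in> V \<inter> P. c y = c x \<and> y < x}"
      by (rule inj_on_subset[OF pairing_inj[OF h]]) auto
    ultimately show ?thesis by (simp add: card_image)
  qed
  have le: "g x \<le> h x"
    if x: "x \<in> V \<inter> P" and *: "card {z \<in> V - P. c z = c x \<and> z < h x} = card {z \<in> V - P. c z = c x \<and> z < g x}"
      and h: "h x \<in> V - P" "c (h x) = c x" for x and g h :: "nat \<Rightarrow> nat"
  proof (rule ccontr)
    assume "\<not> g x \<le> h x"
    then have lt: "h x < g x" by simp
    have "h x \<in> {z \<in> V - P. c z = c x \<and> z < g x}" using h lt by simp
    moreover have "h x \<notin> {z \<in> V - P. c z = c x \<and> z < h x}" by simp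
    moreover have "{z \<in> V - P. c z = c x \<and> z < h x} \<subseteq> {z \<in> V - P. c z = c x \<and> z < g x}"
      using lt less_trans by blast
    ultimately have "{z \<in> V - P. c z = c x \<and> z < h x} \<subset> {z \<in> V - P. c z = c x \<and> z < g x}"
      by blast
    moreover have "finite {z \<in> V - P. c z = c x \<and> z < g x}" using V by simp
    ultimately have "card {z \<in> V - P. c z = c x \<and> z < h x} < card {z \<in> V - P. c z = c x \<and> z < g x}"
      by (intro psubset_card_mono)
    then show False using * by simp
  qed
  have eqP: "f x = g x" if x: "x \<in> V \<inter> P" for x
  proof (rule antisym)
    have "card {z \<in> V - P. c z = c x \<and> z < f x} = card {z \<in> V - P. c z = c x \<and> z < g x}"
      by (rule trans[OF rank[OF x f P(1) c(1) mono_f] rank[OF x g P(2) c(2) mono_g, symmetric]])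
    moreover have xV: "x \<in> V" "x \<in> P" using x by simp_all
    have "f x \<in> V - P" "c (f x) = c x" "g x \<in> V - P" "c (g x) = c x"
      using pairing_D(1)[OF f xV(1)] pairing_D(1)[OF g xV(1)] P[OF xV(1)] c[OF xV(1)] xV(2) by simp_all
    ultimately show "f x \<le> g x" "g x \<le> f x" using le[OF x, of g f] le[OF x, of f g] by simp_all
  qed
  have eqV: "f x = g x" if x: "x \<in> V" for x
  proof (cases "x \<in> P")
    case False
    then have "f x \<in> V \<inter> P" using P(1)[OF x] pairing_D(1)[OF f x] by simp
    then have "g (f x) = x" using eqP[of "f x"] pairing_D(3)[OF f x] by simp
    then show ?thesis using pairing_D(3)[OF g, of "f x"] \<open>f x \<in> V \<inter> P\<close> by simp
  next
    case True
    then show ?thesis using eqP x by blast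
  qed
  then show ?thesis unfolding strands_def by (intro image_cong) simp_all
qed

text \<open>A maximum exists by finiteness, and every element other than \<open>d0\<close> can be
  improved, so \<open>d0\<close> is the only one. Thus a single local exchange suffices for both
  weight arguments below.\<close>

lemma unique_maximum:
  fixes F :: "'a \<Rightarrow> nat"
  assumes C: "finite C" "d0 \<in> C" and step: "\<And>d. d \<in> C \<Longrightarrow> d \<noteq> d0 \<Longrightarrow> \<exists>d'\<in>C. F d < F d'"
    and d: "d \<in> C" "d \<noteq> d0"
  shows "F d < F d0"
proof -
  have M: "F ` C \<noteq> {}" "finite (F ` C)" using C by auto
  then obtain d1 where d1: "d1 \<in> C" "F d1 = Max (F ` C)" using Max_in[OF M(2,1)] by fastforce
  have "d1 = d0"
  proof (rule ccontr)
    assume "d1 \<noteq> d0"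
    then obtain d' where "d' \<in> C" "F d1 < F d'" using step[OF d1(1)] by blast
    then show False using d1(2) M(2) by (metis Max_ge imageI not_less)
  qed
  obtain d' where d': "d' \<in> C" "F d < F d'" using step[OF d] by blast
  have "F d' \<le> F d0" using d1 \<open>d1 = d0\<close> M(2) d'(1) by simp
  then show ?thesis using d'(2) by simp
qed

section \<open>Straightening\<close>

text \<open>The product makes a crossing heavier than the nesting on the same four points, and the second summand
  makes it heavier than the two disjoint strands.\<close>

definition crossing_weight :: "nat \<Rightarrow> nat set \<Rightarrow> nat" where
  "crossing_weight r e = Min e * Max e + r * (Max e - Min e)"

lemma crossing_weight_pair: "a < b \<Longrightarrow> crossing_weight r {a, b} = a * b + r * (b - a)"
  by (simp add: crossing_weight_def min_def max_def)

text \<open>The right side minus the left side is \<open>(c - b) * (2 * r - d + a)\<close> in the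
  first inequality and \<open>(b - a) * (d - c)\<close> in the second; \<open>d \<le> r\<close>
  makes the former positive. The proof substitutes the gaps between the points, so that all terms
  are nonnegative.\<close>

lemma crossing_weight_less:
  assumes "a < b" "b < c" "c < d" "d \<le> r"
  shows "crossing_weight r {a, b} + crossing_weight r {c, d} < crossing_weight r {a, c} + crossing_weight r {b, d}"
    "crossing_weight r {a, d} + crossing_weight r {b, c} < crossing_weight r {a, c} + crossing_weight r {b, d}"
proof -
  obtain x y z t where e: "b = a + Suc x" "c = b + Suc y" "d = c + Suc z" "r = d + t"
    using assms by (metis less_imp_Suc_add le_Suc_ex add_Suc_right)
  have w: "crossing_weight r {a, b} = a * b + r * Suc x" "crossing_weight r {c, d} = c * d + r * Suc z"
    "crossing_weight r {a, c} = a * c + r * (Suc x + Suc y)" "crossing_weight r {b, d} = b * d + r * (Suc y + Suc z)"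
    "crossing_weight r {a, d} = a * d + r * (Suc x + Suc y + Suc z)" "crossing_weight r {b, c} = b * c + r * Suc y"
    using e(1-3) assms by (simp_all add: crossing_weight_pair algebra_simps)
  show "crossing_weight r {a, b} + crossing_weight r {c, d} < crossing_weight r {a, c} + crossing_weight r {b, d}"
    "crossing_weight r {a, d} + crossing_weight r {b, c} < crossing_weight r {a, c} + crossing_weight r {b, d}"
    unfolding w unfolding e by (simp_all add: algebra_simps)
qed

definition all_crossing :: "nat set \<Rightarrow> (nat \<Rightarrow> nat) \<Rightarrow> bool" where
  "all_crossing S f \<longleftrightarrow>
    (\<forall>x\<in>S. \<forall>y\<in>S. x < f x \<longrightarrow> y < f y \<longrightarrow> x < y \<longrightarrow> y < f x \<and> f x < f y)"

text \<open>Two strands that do not cross are disjoint or nested. Exchanging \<open>f x\<close> with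
  \<open>y\<close> in the first case, and with \<open>f y\<close> in the second, makes them cross
  and raises the weight.\<close>

lemma crossing_weight_increase:
  assumes f: "pairing S f" and S: "finite S" "S \<subseteq> {..r}" and nc: "\<not> all_crossing S f"
  shows "\<exists>d\<in>perfect_matchings S. sum (crossing_weight r) (strands S f) < sum (crossing_weight r) d"
proof -
  obtain x y where xy: "x \<in> S" "y \<in> S" "x < f x" "y < f y" "x < y" "\<not> (y < f x \<and> f x < f y)"
    using nc unfolding all_crossing_def by blast
  have fx: "f x \<in> S" "f (f x) = x" and fy: "f y \<in> S" "f (f y) = y"
    using pairing_D[OF f xy(1)] pairing_D[OF f xy(2)] by simp_all
  have le: "f x \<le> r" "f y \<le> r" using S(2) fx(1) fy(1) by auto
  have ne: "f x \<noteq> y" "f x \<noteq> f y" using fx(2) fy(2) xy(4,5) by auto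
  show ?thesis
  proof (cases "f x < y")
    case True
    have "sum (crossing_weight r) (swap_matching (f x) y (strands S f)) + crossing_weight r {f x, f (f x)} + crossing_weight r {y, f y} =
        sum (crossing_weight r) (strands S f) + crossing_weight r {y, f (f x)} + crossing_weight r {f x, f y}"
      by (rule sum_swap_matching[OF f S(1) fx(1) xy(2)]) (use ne(1) fx(2) xy(5) in auto)
    moreover have "crossing_weight r {x, f x} + crossing_weight r {y, f y} < crossing_weight r {x, y} + crossing_weight r {f x, f y}"
      by (rule crossing_weight_less) (use True xy le in auto)
    ultimately have "sum (crossing_weight r) (strands S f) < sum (crossing_weight r) (swap_matching (f x) y (strands S f))"
      using fx(2) by (simp add: insert_commute)
    then show ?thesis using swap_matching_perfect[OF strands_perfect_matching[OF f] fx(1) xy(2)] by blast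
  next
    case False
    then have lt: "y < f y" "f y < f x" using xy ne by auto
    have "sum (crossing_weight r) (swap_matching (f x) (f y) (strands S f)) + crossing_weight r {f x, f (f x)} + crossing_weight r {f y, f (f y)} =
        sum (crossing_weight r) (strands S f) + crossing_weight r {f y, f (f x)} + crossing_weight r {f x, f (f y)}"
      by (rule sum_swap_matching[OF f S(1) fx(1) fy(1)]) (use ne fx(2) xy(4,5) in auto)
    moreover have "crossing_weight r {x, f x} + crossing_weight r {y, f y} < crossing_weight r {x, f y} + crossing_weight r {y, f x}"
      by (rule crossing_weight_less) (use lt xy le in auto)
    ultimately have "sum (crossing_weight r) (strands S f) < sum (crossing_weight r) (swap_matching (f x) (f y) (strands S f))"
      using fx(2) fy(2) by (simp add: insert_commute)
    then show ?thesis using swap_matching_perfect[OF strands_perfect_matching[OF f] fx(1) fy(1)] by blast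
  qed
qed

lemma pairing_half:
  assumes f: "pairing S f" and S: "finite S" and P: "\<And>x. x \<in> S \<Longrightarrow> f x \<in> P \<longleftrightarrow> x \<notin> P"
  shows "card S = 2 * card (S \<inter> P)"
proof -
  have "f ` (S \<inter> P) = S - P"
  proof (intro equalityI subsetI)
    fix z assume "z \<in> S - P"
    then have "f z \<in> S \<inter> P" "f (f z) = z" using P[of z] pairing_D[OF f, of z] by simp_all
    then show "z \<in> f ` (S \<inter> P)" by (metis imageI)
  next
    fix z assume "z \<in> f ` (S \<inter> P)"
    then obtain x where "x \<in> S" "x \<in> P" "z = f x" by blast
    then show "z \<in> S - P" using P[of x] pairing_D(1)[OF f, of x] by simp
  qed
  moreover have "inj_on f (S \<inter> P)" by (rule inj_on_subset[OF pairing_inj[OF f]]) simp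
  ultimately have "card (S - P) = card (S \<inter> P)" by (metis card_image)
  moreover have "card S = card (S \<inter> P) + card (S - P)" using S by (metis card_Int_Diff)
  ultimately show ?thesis by simp
qed

lemma opener_iff:
  fixes f :: "nat \<Rightarrow> nat"
  assumes "pairing S f" "x \<in> S"
  shows "f x \<in> {z. z < f z} \<longleftrightarrow> x \<notin> {z. z < f z}"
  using pairing_D[OF assms] by auto

text \<open>When all strands cross, every left end precedes every right end, so the left ends form
  the lower half of \<open>S\<close>. This half does not depend on the pairing, and the increasing
  bijection onto the other half is unique.\<close>

lemma all_crossing_unique:
  assumes f: "pairing S f" "all_crossing S f" and g: "pairing S g" "all_crossing S g" and S: "finite S"
  shows "strands S f = strands S g"
proof -
  have low: "x < z" if "pairing S h" "all_crossing S h" "x \<in> S" "x < h x" "z \<in> S" "\<not> z < h z" for h x z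
  proof -
    have hz: "h z \<in> S" "h z < z" "h (h z) = z" using pairing_D[OF that(1,5)] that(6) by auto
    show ?thesis
    proof (cases "h z < x")
      case True
      then have "x < h (h z)" using that(2) hz that(3,4) unfolding all_crossing_def by metis
      then show ?thesis using hz by simp
    next
      case False
      then show ?thesis using hz by simp
    qed
  qed
  have sub: "S \<inter> {z. z < h z} \<subseteq> S \<inter> {z. z < k z}"
    if h: "pairing S h" "all_crossing S h" and k: "pairing S k" "all_crossing S k" for h k
  proof
    fix x assume x: "x \<in> S \<inter> {z. z < h z}"
    show "x \<in> S \<inter> {z. z < k z}"
    proof (rule ccontr)
      assume nx: "x \<notin> S \<inter> {z. z < k z}"
      have "S \<inter> {z. z < k z} \<subseteq> S \<inter> {z. z < h z}"
      proof
        fix z assume z: "z \<in> S \<inter> {z. z < k z}"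
        have "z < x" using low[OF k, of z x] z nx x by blast
        then show "z \<in> S \<inter> {z. z < h z}" using low[OF h, of x z] z x by force
      qed
      then have "S \<inter> {z. z < k z} \<subset> S \<inter> {z. z < h z}" using x nx by blast
      then have "card (S \<inter> {z. z < k z}) < card (S \<inter> {z. z < h z})" using S by (intro psubset_card_mono) simp
      moreover have "2 * card (S \<inter> {z. z < k z}) = 2 * card (S \<inter> {z. z < h z})"
        using pairing_half[OF h(1) S opener_iff[OF h(1)]] pairing_half[OF k(1) S opener_iff[OF k(1)]] by simp
      ultimately show False by simp
    qed
  qed
  have P: "S \<inter> {z. z < f z} = S \<inter> {z. z < g z}" using sub[OF f g] sub[OF g f] by blast
  show ?thesis
  proof (rule monotone_pairing_unique[OF S f(1) g(1), where P = "S \<inter> {z. z < f z}" and c = "\<lambda>_. 0"])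
    show "f x \<in> S \<inter> {z. z < f z} \<longleftrightarrow> x \<notin> S \<inter> {z. z < f z}" if "x \<in> S" for x
      using opener_iff[OF f(1) that] pairing_D(1)[OF f(1) that] that by simp
    show "g x \<in> S \<inter> {z. z < f z} \<longleftrightarrow> x \<notin> S \<inter> {z. z < f z}" if "x \<in> S" for x
      unfolding P using opener_iff[OF g(1) that] pairing_D(1)[OF g(1) that] that by simp
    show "f x < f y" if "x \<in> S \<inter> (S \<inter> {z. z < f z})" "y \<in> S \<inter> (S \<inter> {z. z < f z})" "x < y" for x y
      using f(2) that unfolding all_crossing_def by simp
    show "g x < g y" if "x \<in> S \<inter> (S \<inter> {z. z < f z})" "y \<in> S \<inter> (S \<inter> {z. z < f z})" "x < y" for x y
      using g(2) that unfolding P all_crossing_def by simp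
  qed simp_all
qed

lemma all_crossing_max:
  assumes f: "pairing S f" "all_crossing S f" and S: "finite S" "S \<subseteq> {..r}"
    and m: "m \<in> perfect_matchings S" "m \<noteq> strands S f"
  shows "sum (crossing_weight r) m < sum (crossing_weight r) (strands S f)"
proof (rule unique_maximum[OF finite_perfect_matchings[OF S(1)] strands_perfect_matching[OF f(1)] _ m])
  fix d assume d: "d \<in> perfect_matchings S" "d \<noteq> strands S f"
  obtain g where g: "pairing S g" "d = strands S g" using d(1) by (rule perfect_matching_strands)
  have "\<not> all_crossing S g" using all_crossing_unique[OF f g(1) _ S(1)] d(2) g(2) by blast
  then show "\<exists>d'\<in>perfect_matchings S. sum (crossing_weight r) d < sum (crossing_weight r) d'"
    unfolding g(2) by (rule crossing_weight_increase[OF g(1) S])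
qed

text \<open>\<open>S\<close> consists of the ends of the crossing, on which \<open>d\<close>
  restricts to the matching of largest weight. The remaining strands \<open>f\<close> add the same
  amount to the weight of every term.\<close>

lemma crossing_decomposition:
  assumes d: "d \<in> perfect_matchings V" and V: "finite V" "V \<subseteq> {..r}"
    and cr: "length as = m" "length bs = m" "sorted_wrt (<) (as @ bs)" "\<forall>i<m. {as ! i, bs ! i} \<in> d"
  shows "\<exists>S f m0. S \<subseteq> V \<and> card S = 2 * m \<and> f \<in> perfect_matchings (V - S) \<and> m0 \<in> perfect_matchings S \<and>
    d = m0 \<union> f \<and> (\<forall>m'\<in>perfect_matchings S. m' \<noteq> m0 \<longrightarrow>
      sum (crossing_weight r) (m' \<union> f) < sum (crossing_weight r) d)"
proof -
  obtain f where f: "pairing V f" "d = strands V f" using d by (rule perfect_matching_strands)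
  define S where "S = set (as @ bs)"
  have st: "as ! i \<in> V" "bs ! i = f (as ! i)" "bs ! i \<in> V" "as ! i = f (bs ! i)" if "i < m" for i
  proof -
    show "as ! i \<in> V" "bs ! i = f (as ! i)" using cr(4) that strand_iff[OF f(1)] f(2) by blast+
    then show "bs ! i \<in> V" "as ! i = f (bs ! i)" using pairing_D[OF f(1)] by simp_all
  qed
  have S: "S = {as ! i |i. i < m} \<union> {bs ! i |i. i < m}"
    unfolding S_def set_append by (simp only: set_conv_nth cr(1,2))
  have SV: "S \<subseteq> V" unfolding S using st by blast
  have fS: "f x \<in> S" if "x \<in> S" for x
  proof -
    from that consider i where "i < m" "x = as ! i" | i where "i < m" "x = bs ! i" unfolding S by blast
    then show ?thesis
    proof cases
      case 1
      then have "f x = bs ! i" using st(2)[OF 1(1)] by simp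
      then show ?thesis unfolding S using 1(1) by blast
    next
      case 2
      then have "f x = as ! i" using st(4)[OF 2(1)] by simp
      then show ?thesis unfolding S using 2(1) by blast
    qed
  qed
  have "distinct (as @ bs)" using cr(3) by (simp add: strict_sorted_iff)
  then have cS: "card S = 2 * m" unfolding S_def by (simp add: distinct_card[of "as @ bs", unfolded set_append] cr(1,2) del: distinct_append)
  have pS: "pairing S f" unfolding pairing_def using fS SV pairing_D[OF f(1)] by blast
  have pR: "pairing (V - S) f" unfolding pairing_def
  proof
    fix x assume x: "x \<in> V - S"
    then have "f x \<in> V" "f x \<noteq> x" "f (f x) = x" using pairing_D[OF f(1), of x] by simp_all
    moreover have "f x \<notin> S" using fS[of "f x"] x calculation by auto
    ultimately show "f x \<in> V - S \<and> f x \<noteq> x \<and> f (f x) = x" by simp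
  qed
  have less: "as ! i < bs ! j" "i < j \<Longrightarrow> as ! i < as ! j" "i < j \<Longrightarrow> bs ! i < bs ! j" if "i < m" "j < m" for i j
  proof -
    have srt: "sorted_wrt (<) as" "sorted_wrt (<) bs" "\<forall>x\<in>set as. \<forall>y\<in>set bs. x < y"
      using cr(3) unfolding sorted_wrt_append by blast+
    have l: "i < length as" "j < length as" "j < length bs" using that cr(1,2) by simp_all
    show "as ! i < bs ! j" using srt(3) nth_mem[OF l(1)] nth_mem[OF l(3)] by blast
    show "as ! i < as ! j" if "i < j" by (rule sorted_wrt_nth_less[OF srt(1) that l(2)])
    show "bs ! i < bs ! j" if "i < j" by (rule sorted_wrt_nth_less[OF srt(2) that l(3)])
  qed
  have opener: "\<exists>i<m. x = as ! i \<and> f x = bs ! i" if "x \<in> S" "x < f x" for x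
  proof -
    from that consider i where "i < m" "x = as ! i" | i where "i < m" "x = bs ! i" unfolding S by blast
    then show ?thesis
    proof cases
      case 1
      then have "f x = bs ! i" using st(2)[OF 1(1)] by simp
      then show ?thesis using 1 by blast
    next
      case 2
      then show ?thesis using st(4)[OF 2(1)] less(1)[OF 2(1) 2(1)] that(2) by simp
    qed
  qed
  have ac: "all_crossing S f" unfolding all_crossing_def
  proof (intro ballI impI)
    fix x y assume x: "x \<in> S" "x < f x" and y: "y \<in> S" "y < f y" and "x < y"
    obtain i j where ij: "i < m" "x = as ! i" "f x = bs ! i" "j < m" "y = as ! j" "f y = bs ! j"
      using opener[OF x] opener[OF y] by blast
    have "i < j"
    proof (rule ccontr)
      assume "\<not> i < j"
      then have "j < i \<or> j = i" by auto
      then have "y \<le> x" using less(2)[OF ij(4,1)] ij(2,5) by (elim disjE) simp_all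
      then show False using \<open>x < y\<close> by simp
    qed
    then show "y < f x \<and> f x < f y" using less(1)[OF ij(4,1)] less(3)[OF ij(1,4)] ij(2,3,5,6) by simp
  qed
  have fin: "finite S" "finite (V - S)" using V SV finite_subset by auto
  have R: "strands (V - S) f \<in> perfect_matchings (V - S)" by (rule strands_perfect_matching[OF pR])
  have "S \<union> (V - S) = V" "S \<subseteq> {..r}" using SV V(2) by blast+
  then have dd: "d = strands S f \<union> strands (V - S) f" and Sr: "S \<subseteq> {..r}"
    unfolding f(2) strands_def image_Un[symmetric] by simp_all
  have sum_Un: "sum (crossing_weight r) (m' \<union> strands (V - S) f) =
      sum (crossing_weight r) m' + sum (crossing_weight r) (strands (V - S) f)" if "m' \<in> perfect_matchings S" for m'
    by (rule sum.union_disjoint[OF finite_perfect_matching[OF fin(1) that] finite_perfect_matching[OF fin(2) R]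
      perfect_matchings_Un(2)[OF that R SV]])
  have "sum (crossing_weight r) (m' \<union> strands (V - S) f) < sum (crossing_weight r) d"
    if "m' \<in> perfect_matchings S" "m' \<noteq> strands S f" for m'
    unfolding dd sum_Un[OF that(1)] sum_Un[OF strands_perfect_matching[OF pS]]
    by (rule add_strict_right_mono[OF all_crossing_max[OF pS ac fin(1) Sr that]])
  then show ?thesis
    by (intro exI[of _ S] exI[of _ "strands (V - S) f"] exI[of _ "strands S f"] conjI ballI impI)
      (rule SV cS R strands_perfect_matching[OF pS] dd | assumption)+
qed

section \<open>Coloured signs\<close>

definition partner :: "'a set set \<Rightarrow> 'a \<Rightarrow> 'a" where
  "partner d x = (THE y. {x, y} \<in> d)"

lemma partner_strands: "pairing V f \<Longrightarrow> x \<in> V \<Longrightarrow> partner (strands V f) x = f x"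
  by (simp add: partner_def strand_iff)

definition respects_colouring :: "'a set \<Rightarrow> 'a set \<Rightarrow> ('a \<Rightarrow> 'c) \<Rightarrow> 'a set set \<Rightarrow> bool" where
  "respects_colouring V P c d \<longleftrightarrow> (\<forall>x\<in>V. (partner d x \<in> P \<longleftrightarrow> x \<notin> P) \<and> c (partner d x) = c x)"

text \<open>A matching that joins \<open>P\<close> to its complement is a bijection from \<open>P\<close> to the complement.
  The fixed bijection \<open>h\<close> in the other direction only serves to make sense of its sign.\<close>

definition coloured_sign :: "'a set \<Rightarrow> 'a set \<Rightarrow> ('a \<Rightarrow> 'c) \<Rightarrow> ('a \<Rightarrow> 'a) \<Rightarrow> 'a set set \<Rightarrow> int" where
  "coloured_sign V P c h d =
    (if respects_colouring V P c d then sign (\<lambda>x. if x \<in> V \<inter> P then h (partner d x) else x) else 0)"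

lemma respects_strands:
  "pairing V f \<Longrightarrow> respects_colouring V P c (strands V f) \<longleftrightarrow> (\<forall>x\<in>V. (f x \<in> P \<longleftrightarrow> x \<notin> P) \<and> c (f x) = c x)"
  by (simp add: respects_colouring_def partner_strands)

lemma respects_swap:
  assumes d: "d \<in> perfect_matchings V" and p: "p \<in> V \<inter> P" "p' \<in> V \<inter> P" "c p = c p'"
  shows "respects_colouring V P c (swap_matching p p' d) \<longleftrightarrow> respects_colouring V P c d"
proof -
  let ?t = "Transposition.transpose p p'"
  obtain f where f: "pairing V f" "d = strands V f" using d by (rule perfect_matching_strands)
  have V: "p \<in> V" "p' \<in> V" using p by simp_all
  have t: "?t x \<in> P \<longleftrightarrow> x \<in> P" "c (?t x) = c x" for x
    using p by (auto simp: Transposition.transpose_def)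
  have tV: "?t ` V = V" using V by simp
  have "respects_colouring V P c (swap_matching p p' d) \<longleftrightarrow> (\<forall>x\<in>V. (f (?t x) \<in> P \<longleftrightarrow> ?t x \<notin> P) \<and> c (f (?t x)) = c (?t x))"
    unfolding f(2) swap_strands(1)[OF f(1) V] respects_strands[OF swap_strands(2)[OF f(1) V]] comp_apply t ..
  also have "\<dots> \<longleftrightarrow> (\<forall>y\<in>?t ` V. (f y \<in> P \<longleftrightarrow> y \<notin> P) \<and> c (f y) = c y)" by (simp only: ball_simps)
  finally show ?thesis unfolding tV f(2) respects_strands[OF f(1)] .
qed

text \<open>Exchanging two points of \<open>P\<close> of equal colour preserves the colouring
  condition and composes the permutation with their transposition: partners of points in
  \<open>P\<close> lie outside \<open>P\<close>, so the exchange does not move them.\<close>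

lemma coloured_sign_swap:
  assumes V: "finite V" and d: "d \<in> perfect_matchings V"
    and p: "p \<in> V \<inter> P" "p' \<in> V \<inter> P" "c p = c p'" "p \<noteq> p'"
    and h: "pairing V h" "\<And>x. x \<in> V \<Longrightarrow> h x \<in> P \<longleftrightarrow> x \<notin> P"
  shows "coloured_sign V P c h (swap_matching p p' d) = - coloured_sign V P c h d"
proof (cases "respects_colouring V P c d")
  case True
  let ?t = "Transposition.transpose p p'"
  let ?s = "\<lambda>f x. if x \<in> V \<inter> P then h (f x) else x"
  obtain f where f: "pairing V f" "d = strands V f" using d by (rule perfect_matching_strands)
  have pV: "p \<in> V" "p' \<in> V" using p by simp_all
  have fP: "f x \<notin> P" if "x \<in> V \<inter> P" for x using True that unfolding f(2) respects_strands[OF f(1)] by blast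
  have s: "?s f ` (V \<inter> P) \<subseteq> V \<inter> P"
  proof
    fix y assume "y \<in> ?s f ` (V \<inter> P)"
    then obtain x where x: "x \<in> V \<inter> P" "y = h (f x)" by auto
    then have "f x \<in> V" "f x \<notin> P" using fP pairing_D(1)[OF f(1)] by blast+
    then show "y \<in> V \<inter> P" using x(2) h(2)[of "f x"] pairing_D(1)[OF h(1), of "f x"] by simp
  qed
  moreover have inj: "inj_on (?s f) (V \<inter> P)"
  proof (rule inj_onI)
    fix x y assume xy: "x \<in> V \<inter> P" "y \<in> V \<inter> P" "?s f x = ?s f y"
    then have "h (f x) = h (f y)" by simp
    then have "f x = f y" using xy pairing_inj[OF h(1)] pairing_D(1)[OF f(1)] by (simp add: inj_on_eq_iff)
    then show "x = y" using xy pairing_inj[OF f(1)] by (simp add: inj_on_eq_iff)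
  qed
  ultimately have "bij_betw (?s f) (V \<inter> P) (V \<inter> P)"
    using V by (simp only: bij_betw_def endo_inj_surj finite_Int simp_thms)
  then have perm: "permutation (?s f)"
    using V by (intro permutes_imp_permutation[of "V \<inter> P"] bij_imp_permutes) auto
  have eq: "(\<lambda>x. if x \<in> V \<inter> P then h (partner (swap_matching p p' d) x) else x) = ?s f \<circ> ?t"
  proof
    fix x
    show "(if x \<in> V \<inter> P then h (partner (swap_matching p p' d) x) else x) = (?s f \<circ> ?t) x"
    proof (cases "x \<in> V \<inter> P")
      case True
      then have tx: "?t x \<in> V \<inter> P" using p by (auto simp: Transposition.transpose_def)
      have "partner (swap_matching p p' d) x = ?t (f (?t x))"
        using True partner_strands[OF swap_strands(2)[OF f(1) pV]] by (simp add: f(2) swap_strands(1)[OF f(1) pV])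
      moreover have "f (?t x) \<noteq> p" "f (?t x) \<noteq> p'" using fP[OF tx] p by auto
      ultimately show ?thesis using True tx by simp
    next
      case False
      then have "?t x = x" using p by (auto simp: Transposition.transpose_def)
      then show ?thesis using False by auto
    qed
  qed
  have eq': "(\<lambda>x. if x \<in> V \<inter> P then h (partner d x) else x) = ?s f"
    using partner_strands[OF f(1)] by (auto simp: f(2))
  have "sign (?s f \<circ> ?t) = sign (?s f) * sign ?t" by (rule sign_compose[OF perm permutation_swap_id])
  then have "sign (?s f \<circ> ?t) = - sign (?s f)" using p(4) by (simp add: sign_swap_id)
  then show ?thesis using True respects_swap[of d V p P p' c] d p unfolding coloured_sign_def eq eq' by simp
next
  case False
  then show ?thesis using respects_swap[of d V p P p' c] d p unfolding coloured_sign_def by simp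
qed

text \<open>Among \<open>n + 1\<close> strands two have the same colour; exchanging their ends in \<open>P\<close> is a
  sign-reversing involution.\<close>

lemma coloured_sign_pfaffian:
  assumes V: "finite V" and S: "S \<subseteq> V" "card S = 2 * (n + 1)" and f: "f \<in> perfect_matchings (V - S)"
    and h: "pairing V h" "\<And>x. x \<in> V \<Longrightarrow> h x \<in> P \<longleftrightarrow> x \<notin> P" and c: "\<And>x. x \<in> V \<Longrightarrow> c x < n"
  shows "(\<Sum>m\<in>perfect_matchings S. coloured_sign V P c h (m \<union> f)) = 0"
\<comment> \<open>One matching that respects the colouring shows that exactly half of
  \<open>S\<close>, hence \<open>n + 1\<close> points, lies in \<open>P\<close>. If there is none,
  all terms vanish.\<close>
proof (cases "\<exists>m\<in>perfect_matchings S. respects_colouring V P c (m \<union> f)")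
  case True
  then obtain m where m: "m \<in> perfect_matchings S" "respects_colouring V P c (m \<union> f)" by blast
  obtain g where g: "pairing S g" "m = strands S g" using m(1) by (rule perfect_matching_strands)
  obtain u where u: "pairing V u" "m \<union> f = strands V u"
    using perfect_matchings_Un(1)[OF m(1) f S(1)] by (rule perfect_matching_strands)
  have gu: "g x = u x" if "x \<in> S" for x
  proof -
    have "{x, g x} \<in> strands V u" unfolding u(2)[symmetric] g(2) using that by (simp add: strands_def)
    then show ?thesis using strand_iff[OF u(1)] by simp
  qed
  have gP: "g x \<in> P \<longleftrightarrow> x \<notin> P" if "x \<in> S" for x
    using m(2) that S(1) gu[OF that] unfolding u(2) respects_strands[OF u(1)] by (metis subsetD)
  have fin: "finite S" using V S(1) finite_subset by blast
  have "card (S \<inter> P) = n + 1" using pairing_half[OF g(1) fin gP] S(2) by simp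
  moreover have "card (c ` (S \<inter> P)) \<le> n"
    using card_mono[of "{..<n}" "c ` (S \<inter> P)"] c S(1) by auto
  ultimately have "\<not> inj_on c (S \<inter> P)" by (metis card_image not_less_eq_eq Suc_eq_plus1 order_refl)
  then obtain p p' where p: "p \<in> S \<inter> P" "p' \<in> S \<inter> P" "c p = c p'" "p \<noteq> p'" unfolding inj_on_def by blast
  have pS: "p \<in> S" "p' \<in> S" using p by simp_all
  have pV: "p \<in> V \<inter> P" "p' \<in> V \<inter> P" using p S(1) by blast+
  have Uf: "\<Union>f = V - S" using f by (simp add: perfect_matchings_def partition_on_def)
  have tf: "swap_matching p p' f = f"
  proof -
    have "Transposition.transpose p p' ` e = e" if "e \<in> f" for e
    proof -
      have "p \<notin> e" "p' \<notin> e" using Uf that pS by blast+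
      then show ?thesis by simp
    qed
    then show ?thesis by simp
  qed
  have neg: "coloured_sign V P c h (swap_matching p p' m \<union> f) = - coloured_sign V P c h (m \<union> f)"
    if "m \<in> perfect_matchings S" for m
    using coloured_sign_swap[OF V perfect_matchings_Un(1)[OF that f S(1)] pV p(3,4) h]
    unfolding image_Un tf .
  have "(\<Sum>m\<in>perfect_matchings S. coloured_sign V P c h (m \<union> f)) =
      (\<Sum>m\<in>perfect_matchings S. coloured_sign V P c h (swap_matching p p' m \<union> f))"
    by (rule sum.reindex_bij_witness[of _ "swap_matching p p'" "swap_matching p p'"])
      (simp_all add: swap_matching_swap swap_matching_perfect[OF _ pS])
  also have "\<dots> = - (\<Sum>m\<in>perfect_matchings S. coloured_sign V P c h (m \<union> f))"
    unfolding sum_negf[symmetric] by (rule sum.cong[OF refl neg])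
  finally show ?thesis by simp
next
  case False
  then show ?thesis by (intro sum.neutral) (simp add: coloured_sign_def)
qed

text \<open>For the matching of \<open>h\<close> itself the permutation is
  \<open>h \<circ> h\<close> on \<open>V \<inter> P\<close>, the identity.\<close>

lemma coloured_sign_self:
  assumes "pairing V h" "\<And>x. x \<in> V \<Longrightarrow> h x \<in> P \<longleftrightarrow> x \<notin> P" "\<And>x. x \<in> V \<Longrightarrow> c (h x) = c x"
  shows "coloured_sign V P c h (strands V h) = 1"
proof -
  have "(\<lambda>x. if x \<in> V \<inter> P then h (partner (strands V h) x) else x) = (\<lambda>x. x)"
    using partner_strands[OF assms(1)] pairing_D(3)[OF assms(1)] by auto
  then show ?thesis using assms unfolding coloured_sign_def respects_strands[OF assms(1)] by simp
qed

text \<open>The rearrangement inequality in each colour: exchanging \<open>x < y\<close> whose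
  partners are in the wrong order raises the sum of products by
  \<open>(y - x) * (f x - f y)\<close>. The competing matchings join the left ends of
  \<open>h\<close> to its right ends, but a left end of \<open>h\<close> need not be a left end in
  them.\<close>

lemma fifo_triangular:
  fixes V :: "nat set"
  assumes V: "finite V" and h: "pairing V h" and c: "fifo_colouring V h n c"
    and d: "d \<in> perfect_matchings V" "d \<noteq> strands V h" "respects_colouring V {x. x < h x} c d"
  shows "sum \<Prod> d < sum \<Prod> (strands V h)"
proof (rule unique_maximum[of "{d \<in> perfect_matchings V. respects_colouring V {x. x < h x} c d}"])
  let ?P = "{x. x < h x}"
  have ch: "c (h x) = c x" if "x \<in> V" for x using c that unfolding fifo_colouring_def by blast
  show "finite {d \<in> perfect_matchings V. respects_colouring V ?P c d}" using finite_perfect_matchings[OF V] by simp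
  show "strands V h \<in> {d \<in> perfect_matchings V. respects_colouring V ?P c d}"
    using strands_perfect_matching[OF h] opener_iff[OF h] ch by (simp add: respects_strands[OF h])
  show "d \<in> {d \<in> perfect_matchings V. respects_colouring V ?P c d}" "d \<noteq> strands V h" using d by simp_all
  fix d assume "d \<in> {d \<in> perfect_matchings V. respects_colouring V ?P c d}" and ne: "d \<noteq> strands V h"
  then have d: "d \<in> perfect_matchings V" "respects_colouring V ?P c d" by simp_all
  obtain f where f: "pairing V f" "d = strands V f" using d(1) by (rule perfect_matching_strands)
  have fP: "f x \<in> ?P \<longleftrightarrow> x \<notin> ?P" "c (f x) = c x" if "x \<in> V" for x
    using d(2) that unfolding f(2) respects_strands[OF f(1)] by blast+
  have "\<exists>x y. x \<in> V \<inter> ?P \<and> y \<in> V \<inter> ?P \<and> c x = c y \<and> x < y \<and> \<not> f x < f y"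
  proof (rule ccontr)
    assume "\<not> ?thesis"
    then have "strands V f = strands V h"
    proof (intro monotone_pairing_unique[OF V f(1) h fP(1) opener_iff[OF h] fP(2) ch])
      fix x y assume "x \<in> V \<inter> ?P" "y \<in> V \<inter> ?P" "c x = c y" "x < y"
      then show "h x < h y" using c unfolding fifo_colouring_def by simp
    qed blast+
    then show False using ne f(2) by simp
  qed
  then obtain x y where xy: "x \<in> V \<inter> ?P" "y \<in> V \<inter> ?P" "c x = c y" "x < y" "\<not> f x < f y" by blast
  have xyV: "x \<in> V" "y \<in> V" using xy by simp_all
  have ne': "f x \<noteq> f y" using pairing_D(3)[OF f(1) xyV(1)] pairing_D(3)[OF f(1) xyV(2)] xy(4) by auto
  then have lt: "f y < f x" using xy(5) by simp
  have "f x \<noteq> y" using fP(1)[OF xyV(1)] xy(1,2) by auto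
  moreover have "x \<noteq> f y" using fP(1)[OF xyV(2)] xy(1,2) by auto
  ultimately have prods: "\<Prod>{x, f x} = x * f x" "\<Prod>{y, f y} = y * f y" "\<Prod>{y, f x} = y * f x" "\<Prod>{x, f y} = x * f y"
    using pairing_D(2)[OF f(1) xyV(1)] pairing_D(2)[OF f(1) xyV(2)] by auto
  have "sum \<Prod> (swap_matching x y (strands V f)) + x * f x + y * f y = sum \<Prod> (strands V f) + y * f x + x * f y"
    using sum_swap_matching[OF f(1) V xyV, of \<Prod>] xy(4) \<open>f x \<noteq> y\<close> prods by simp
  moreover have "x * f x + y * f y < y * f x + x * f y"
  proof -
    obtain a b where "y = x + Suc a" "f x = f y + Suc b" using xy(4) lt by (metis less_imp_Suc_add add_Suc_right)
    then show ?thesis by (simp add: algebra_simps)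
  qed
  ultimately have "sum \<Prod> d < sum \<Prod> (swap_matching x y d)" by (simp add: f(2))
  moreover have "swap_matching x y d \<in> {d \<in> perfect_matchings V. respects_colouring V ?P c d}"
    using swap_matching_perfect[OF d(1) xyV] respects_swap[OF d(1) xy(1,2,3)] d(2) by simp
  ultimately show "\<exists>d'\<in>{d \<in> perfect_matchings V. respects_colouring V ?P c d}. sum \<Prod> d < sum \<Prod> d'" by blast
qed

section \<open>Counting noncrossing diagrams\<close>

lemma open_tableau_cong:
  assumes "\<And>x. x \<in> {1..r} \<Longrightarrow> f x = g x"
  shows "open_tableau f r j = open_tableau g r j"
proof -
  have "map f (filter (\<lambda>b. f b \<le> j) xs) = map g (filter (\<lambda>b. g b \<le> j) xs)" if "set xs \<subseteq> {1..r}" for xs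
    using that assms by (induction xs) auto
  moreover have "set (rev [Suc j..<Suc r]) \<subseteq> {1..r}" by auto
  ultimately show ?thesis unfolding open_tableau_def open_word_def by metis
qed

definition crosses :: "nat \<Rightarrow> nat set set \<Rightarrow> bool" where
  "crosses m d \<longleftrightarrow> (\<exists>as bs. length as = m \<and> length bs = m \<and> sorted_wrt (<) (as @ bs) \<and>
    (\<forall>i<m. {as ! i, bs ! i} \<in> d))"

definition fifo_colourable :: "nat \<Rightarrow> nat \<Rightarrow> nat set set set" where
  "fifo_colourable n r = {strands {1..r} f | f. pairing {1..r} f \<and> (\<exists>c. fifo_colouring {1..r} f n c)}"

lemma fifo_colourable_subset: "fifo_colourable n r \<subseteq> perfect_matchings {1..r}"
  unfolding fifo_colourable_def using strands_perfect_matching by blast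

lemma finite_fifo_colourable: "finite (fifo_colourable n r)"
  by (rule finite_subset[OF fifo_colourable_subset finite_perfect_matchings]) simp

lemma noncrossing_strands:
  assumes f: "pairing {1..r} f" and nc: "\<not> crosses m (strands {1..r} f)"
  shows "noncrossing m {1..r} f"
  unfolding noncrossing_def
proof
  assume "\<exists>as bs. length as = m \<and> length bs = m \<and> sorted_wrt (<) (as @ bs) \<and> set bs \<subseteq> {1..r} \<and>
    (\<forall>i<m. as ! i = f (bs ! i))"
  then obtain as bs where *: "length as = m" "length bs = m" "sorted_wrt (<) (as @ bs)" "set bs \<subseteq> {1..r}"
    "\<forall>i<m. as ! i = f (bs ! i)" by blast
  have "{as ! i, bs ! i} \<in> strands {1..r} f" if "i < m" for i
  proof -
    have "bs ! i \<in> {1..r}" using *(2,4) that nth_mem by blast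
    then have "{bs ! i, as ! i} \<in> strands {1..r} f" using *(5) that strand_iff[OF f] by simp
    then show ?thesis by (simp add: insert_commute)
  qed
  then show False using nc * unfolding crosses_def by blast
qed

text \<open>Transposing the walk is injective: the new diagram determines its shapes, these
  determine the shapes of the old one, and \<open>open_tableau_inj\<close> recovers the old
  diagram.\<close>

lemma card_noncrossing_le:
  "card {d \<in> perfect_matchings {1..r}. \<not> crosses (n + 1) d} \<le> card (fifo_colourable n r)"
proof -
  let ?V = "{1..r}"
  define N where "N = {d \<in> perfect_matchings ?V. \<not> crosses (n + 1) d}"
  \<comment> \<open>A diagram fixes its pairing only on \<open>{1..r}\<close>, so the map between
    diagrams is chosen through a relation that carries representing pairings along.\<close>
  define R where "R d d' f g \<longleftrightarrow> pairing ?V f \<and> d = strands ?V f \<and> pairing ?V g \<and> d' = strands ?V g \<and>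
    (\<exists>c. fifo_colouring ?V g n c) \<and> (\<forall>j\<le>r. cells (open_tableau g r j) = prod.swap ` cells (open_tableau f r j))"
    for d d' f g
  have ex: "\<exists>d' f g. R d d' f g" if "d \<in> N" for d
  proof -
    have d: "d \<in> perfect_matchings ?V" "\<not> crosses (n + 1) d" using that unfolding N_def by simp_all
    obtain f where f: "pairing ?V f" "d = strands ?V f" using d(1) by (rule perfect_matching_strands)
    have nc: "noncrossing (n + 1) ?V f" by (rule noncrossing_strands[OF f(1) d(2)[unfolded f(2)]])
    obtain g c where "pairing ?V g" "fifo_colouring ?V g n c"
      "\<forall>j\<le>r. cells (open_tableau g r j) = prod.swap ` cells (open_tableau f r j)"
      using transposed_pairing[OF f(1) nc] by (elim exE conjE)
    then have "R d (strands ?V g) f g" unfolding R_def using f by (intro conjI exI[of _ c]) simp_all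
    then show ?thesis by (intro exI)
  qed
  define G where "G d = (SOME d'. \<exists>f g. R d d' f g)" for d
  have G: "\<exists>f g. R d (G d) f g" if "d \<in> N" for d
    unfolding G_def by (rule someI_ex) (rule ex[OF that])
  have "inj_on G N"
  proof (rule inj_onI)
    fix d d' assume d: "d \<in> N" "d' \<in> N" and eq: "G d = G d'"
    obtain f g where R: "R d (G d) f g" using G[OF d(1)] by (elim exE)
    obtain f' g' where R': "R d' (G d') f' g'" using G[OF d(2)] by (elim exE)
    have f: "pairing ?V f" "d = strands ?V f" and g: "pairing ?V g" "G d = strands ?V g"
      "\<forall>j\<le>r. cells (open_tableau g r j) = prod.swap ` cells (open_tableau f r j)"
      using R unfolding R_def by blast+
    have f': "pairing ?V f'" "d' = strands ?V f'" and g': "pairing ?V g'" "G d' = strands ?V g'"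
      "\<forall>j\<le>r. cells (open_tableau g' r j) = prod.swap ` cells (open_tableau f' r j)"
      using R' unfolding R_def by blast+
    have gg: "g x = g' x" if "x \<in> ?V" for x
      using partner_strands[OF g(1) that] partner_strands[OF g'(1) that] eq g(2) g'(2) by simp
    have "cells (open_tableau f r j) = cells (open_tableau f' r j)" if "j \<le> r" for j
    proof -
      have "open_tableau g r j = open_tableau g' r j" by (rule open_tableau_cong[OF gg])
      moreover have "cells (open_tableau g r j) = prod.swap ` cells (open_tableau f r j)"
        "cells (open_tableau g' r j) = prod.swap ` cells (open_tableau f' r j)"
        using g(3)[rule_format, OF that] g'(3)[rule_format, OF that] .
      ultimately have "prod.swap ` cells (open_tableau f r j) = prod.swap ` cells (open_tableau f' r j)"
        by (simp only:)
      then show ?thesis by (simp only: inj_image_eq_iff[OF inj_swap])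
    qed
    then have "\<forall>x\<in>?V. f x = f' x" by (rule open_tableau_inj[OF f(1) f'(1)])
    then show "d = d'" unfolding f(2) f'(2) strands_def by (intro image_cong) simp_all
  qed
  moreover have "G ` N \<subseteq> fifo_colourable n r"
  proof
    fix x assume "x \<in> G ` N"
    then obtain d where d: "d \<in> N" "x = G d" by blast
    obtain f g where "R d (G d) f g" using G[OF d(1)] by (elim exE)
    then have "pairing ?V g" "x = strands ?V g" "\<exists>c. fifo_colouring ?V g n c"
      unfolding R_def d(2) by blast+
    then show "x \<in> fifo_colourable n r" unfolding fifo_colourable_def by blast
  qed
  ultimately show ?thesis using finite_fifo_colourable unfolding N_def[symmetric] by (rule card_inj_on_le)
qed

section \<open>Transfer from numbers to tagged nodes\<close>

abbreviation tag :: "nat set set \<Rightarrow> (nat + nat) set set" where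
  "tag d \<equiv> (`) Inr ` d"

lemma inj_tag: "inj tag"
  by (rule inj_on_inverseI[of _ "(`) ((-`) Inr)"]) (simp add: image_image inj_vimage_image_eq)

lemma nodes_0: "nodes 0 r = Inr ` {1..r}"
  by (simp add: nodes_def)

lemma perfect_matchings_Inr: "perfect_matchings (Inr ` V) = tag ` perfect_matchings V"
  by (rule perfect_matchings_image) simp

lemma diagrams_0: "diagrams 0 r = tag ` perfect_matchings {1..r}"
  by (simp only: diagrams_def nodes_0 perfect_matchings_Inr)

lemma has_crossing_tag: "has_crossing m (tag d) \<longleftrightarrow> crosses m d"
proof -
  have "{Inr a, Inr b} \<in> tag d \<longleftrightarrow> {a, b} \<in> d" for a b
  proof -
    have inj: "inj ((`) (Inr :: nat \<Rightarrow> nat + nat))"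
      by (rule inj_on_inverseI[of _ "(-`) Inr"]) (simp add: inj_vimage_image_eq)
    show ?thesis using inj_image_mem_iff[OF inj, of "{a, b}" d] by simp
  qed
  then show ?thesis unfolding has_crossing_def crosses_def by simp
qed

lemma noncrossing_diagrams_tag:
  "noncrossing_diagrams m r = tag ` {d \<in> perfect_matchings {1..r}. \<not> crosses m d}"
  unfolding noncrossing_diagrams_def diagrams_0 using has_crossing_tag by auto

lemma tag_Un: "tag (m \<union> f) = tag m \<union> tag f"
  by (rule image_Un)

lemma pfaffian_tag:
  "(pfaffian (Inr ` S) (tag f) :: _ \<Rightarrow>\<^sub>0 'k::field) = (\<Sum>m\<in>perfect_matchings S. diagram_vec (tag (m \<union> f)))"
  unfolding pfaffian_def perfect_matchings_Inr tag_Un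
  by (subst sum.reindex) (auto intro: inj_on_subset[OF inj_tag])


section \<open>The quotient by the Pfaffian ideal\<close>

abbreviation pf_ideal :: "nat \<Rightarrow> nat \<Rightarrow> ((nat + nat) set set \<Rightarrow>\<^sub>0 'k::field) set" where
  "pf_ideal n r \<equiv> pfaffian_ideal n 0 r"

lemma brauer_hom_simps [simp]:
  "carrier (brauer_hom r s) = {v. Poly_Mapping.keys v \<subseteq> diagrams r s}"
  "\<zero>\<^bsub>brauer_hom r s\<^esub> = 0" "x \<oplus>\<^bsub>brauer_hom r s\<^esub> y = x + y"
  "c \<odot>\<^bsub>brauer_hom r s\<^esub> x = Poly_Mapping.map ((*) c) x"
  by (simp_all add: brauer_hom_def)

lemma submodule_pfaffian_ideal:
  "LinearCombinations.submodule class_ring (pfaffian_ideal n r s :: (_ \<Rightarrow>\<^sub>0 'k::field) set) (brauer_hom r s)"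
proof -
  interpret V: vectorspace class_ring "brauer_hom r s :: ('k, _) module"
    by (rule vectorspace_brauer_hom)
  show ?thesis unfolding pfaffian_ideal_def
    by (rule V.span_is_submodule) (use pfaffian_in_carrier in blast)
qed

lemma pfaffian_in_ideal:
  assumes "S \<subseteq> nodes r s" "card S = 2 * (n + 1)" "f \<in> perfect_matchings (nodes r s - S)"
  shows "(pfaffian S f :: _ \<Rightarrow>\<^sub>0 'k::field) \<in> pfaffian_ideal n r s"
proof -
  interpret V: vectorspace class_ring "brauer_hom r s :: ('k, _) module"
    by (rule vectorspace_brauer_hom)
  show ?thesis unfolding pfaffian_ideal_def
    by (rule subsetD[OF V.in_own_span]) (use assms pfaffian_in_carrier in blast)+
qed

lemma coset_brauer_hom: "N +>\<^bsub>brauer_hom r s\<^esub> v = (\<lambda>h. h + v) ` N"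
  by (auto simp: a_r_coset_def')

lemma coset_pfaffian_ideal:
  "pfaffian_ideal n r s +>\<^bsub>brauer_hom r s\<^esub> v = (pfaffian_ideal n r s :: (_ \<Rightarrow>\<^sub>0 'k::field) set) \<longleftrightarrow> v \<in> pfaffian_ideal n r s"
proof -
  let ?N = "pfaffian_ideal n r s :: (_ \<Rightarrow>\<^sub>0 'k) set"
  interpret N: LinearCombinations.submodule class_ring ?N "brauer_hom r s :: ('k, _) module"
    by (rule submodule_pfaffian_ideal)
  have zero: "0 \<in> ?N" using N.zero_closed by simp
  have add: "x + y \<in> ?N" if "x \<in> ?N" "y \<in> ?N" for x y using N.m_closed[OF that] by simp
  have "Poly_Mapping.map ((*) (- 1)) x = - x" for x :: "(nat + nat) set set \<Rightarrow>\<^sub>0 'k"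
    by (rule poly_mapping_eqI) (simp add: lookup_smult)
  then have neg: "- x \<in> ?N" if "x \<in> ?N" for x using N.smult_closed[of "- 1" x] that by simp
  show ?thesis unfolding coset_brauer_hom
  proof
    assume "(\<lambda>h. h + v) ` ?N = ?N"
    then show "v \<in> ?N" using zero by (metis add_0 imageI)
  next
    assume v: "v \<in> ?N"
    show "(\<lambda>h. h + v) ` ?N = ?N"
    proof (intro equalityI subsetI)
      fix x assume "x \<in> ?N"
      then have "x + - v \<in> ?N" using add neg v by blast
      then show "x \<in> (\<lambda>h. h + v) ` ?N" by (intro image_eqI[of _ _ "x + - v"]) simp_all
    qed (use add v in auto)
  qed
qed

text \<open>The kernel of \<open>\<phi>\<close> is a submodule that contains the generators of the
  ideal.\<close>

lemma linear_functional_pfaffian_ideal: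
  fixes \<phi> :: "((nat + nat) set set \<Rightarrow>\<^sub>0 'k::field) \<Rightarrow> 'k"
  assumes add: "\<And>v w. \<phi> (v + w) = \<phi> v + \<phi> w" and smult: "\<And>c v. \<phi> (Poly_Mapping.map ((*) c) v) = c * \<phi> v"
    and pf: "\<And>S f. S \<subseteq> nodes r s \<Longrightarrow> card S = 2 * (n + 1) \<Longrightarrow> f \<in> perfect_matchings (nodes r s - S) \<Longrightarrow> \<phi> (pfaffian S f) = 0"
    and v: "v \<in> pfaffian_ideal n r s"
  shows "\<phi> v = 0"
proof -
  interpret V: vectorspace class_ring "brauer_hom r s :: ('k, _) module"
    by (rule vectorspace_brauer_hom)
  have "\<phi> 0 = 0" using add[of 0 0] by (metis add.right_neutral add_left_cancel)
  have "LinearCombinations.submodule class_ring {v \<in> carrier (brauer_hom r s). \<phi> v = 0} (brauer_hom r s :: ('k, _) module)"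
  proof (rule LinearCombinations.submodule.intro)
    show "Module.module class_ring (brauer_hom r s :: ('k, _) module)" ..
    show "v \<oplus>\<^bsub>brauer_hom r s\<^esub> w \<in> {v \<in> carrier (brauer_hom r s). \<phi> v = 0}"
      if "v \<in> {v \<in> carrier (brauer_hom r s). \<phi> v = 0}" "w \<in> {v \<in> carrier (brauer_hom r s). \<phi> v = 0}" for v w
      using that V.M.add.m_closed[of v w] add by simp
    show "c \<odot>\<^bsub>brauer_hom r s\<^esub> v \<in> {v \<in> carrier (brauer_hom r s). \<phi> v = 0}"
      if "c \<in> carrier class_ring" "v \<in> {v \<in> carrier (brauer_hom r s). \<phi> v = 0}" for c v
      using that V.smult_closed[of c v] smult by simp
  qed (use \<open>\<phi> 0 = 0\<close> in auto)
  then have "pfaffian_ideal n r s \<subseteq> {v \<in> carrier (brauer_hom r s). \<phi> v = 0}"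
    unfolding pfaffian_ideal_def by (rule V.span_is_subset[rotated]) (use pf pfaffian_in_carrier in blast)
  then show ?thesis using v by blast
qed

section \<open>Functionals on diagrams and independence of the colourable ones\<close>

definition evaluate :: "((nat + nat) set set \<Rightarrow> 'k) \<Rightarrow> nat \<Rightarrow> ((nat + nat) set set \<Rightarrow>\<^sub>0 'k::field) \<Rightarrow> 'k" where
  "evaluate l r v = (\<Sum>d\<in>diagrams 0 r. Poly_Mapping.lookup v d * l d)"

lemma finite_diagrams_0: "finite (diagrams 0 r)"
  unfolding diagrams_0 by (intro finite_imageI finite_perfect_matchings) simp

lemma evaluate_add: "evaluate l r (v + w) = evaluate l r v + evaluate l r w"
  by (simp add: evaluate_def lookup_add distrib_right sum.distrib)

lemma evaluate_smult: "evaluate l r (Poly_Mapping.map ((*) c) v) = c * evaluate l r v"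
  by (simp add: evaluate_def lookup_smult sum_distrib_left mult.assoc)

lemma evaluate_sum: "evaluate l r (sum v A) = (\<Sum>x\<in>A. evaluate l r (v x))"
proof (induction A rule: infinite_finite_induct)
  case (insert x F)
  then show ?case by (simp add: evaluate_add)
qed (simp_all add: evaluate_def)

lemma evaluate_diagram_vec: "d \<in> diagrams 0 r \<Longrightarrow> evaluate l r (diagram_vec d) = l d"
proof -
  assume d: "d \<in> diagrams 0 r"
  have "evaluate l r (diagram_vec d) = (\<Sum>d'\<in>diagrams 0 r. if d = d' then l d' else 0)"
    unfolding evaluate_def diagram_vec_def by (intro sum.cong) (simp_all add: lookup_single)
  then show ?thesis using d finite_diagrams_0 by simp
qed

text \<open>Let \<open>d0\<close> be a diagram in the support of \<open>w\<close> with the least sum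
  of products. The functional made from the left ends and a colouring of \<open>d0\<close> itself
  vanishes on the ideal, hence on \<open>w\<close>, but its value at \<open>w\<close> is the
  coefficient of \<open>d0\<close>.\<close>

lemma fifo_colourable_independent:
  fixes w :: "(nat + nat) set set \<Rightarrow>\<^sub>0 'k::field_char_0"
  assumes w: "w \<in> pf_ideal n r" "Poly_Mapping.keys w \<subseteq> tag ` fifo_colourable n r"
  shows "w = 0"
proof (rule ccontr)
  assume "w \<noteq> 0"
  let ?V = "{1..r}"
  define K where "K = {d \<in> fifo_colourable n r. Poly_Mapping.lookup w (tag d) \<noteq> 0}"
  have "Poly_Mapping.keys w \<noteq> {}" using \<open>w \<noteq> 0\<close> by simp
  then obtain D where D: "D \<in> Poly_Mapping.keys w" by blast
  then obtain d where "d \<in> fifo_colourable n r" "D = tag d" using w(2) by blast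
  then have "d \<in> K" using D unfolding K_def by (simp add: in_keys_iff)
  moreover have "finite K" unfolding K_def using finite_fifo_colourable by simp
  ultimately obtain d0 where d0: "d0 \<in> K" "\<And>d. d \<in> K \<Longrightarrow> sum \<Prod> d0 \<le> (sum \<Prod> d :: nat)"
    using arg_min_if_finite[of K "sum \<Prod> :: nat set set \<Rightarrow> nat"] by (metis empty_iff not_less)
  obtain h c where h: "pairing ?V h" "d0 = strands ?V h" "fifo_colouring ?V h n c"
    using d0(1) unfolding K_def fifo_colourable_def by blast
  let ?P = "{x. x < h x}"
  define l :: "(nat + nat) set set \<Rightarrow> 'k" where
    "l D = of_int (coloured_sign ?V ?P c h (the_inv tag D))" for D
  have l: "l (tag d) = of_int (coloured_sign ?V ?P c h d)" for d
    unfolding l_def the_inv_f_f[OF inj_tag] ..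
  have c: "c x < n" "c (h x) = c x" if "x \<in> ?V" for x
    using h(3) that unfolding fifo_colouring_def by blast+
  have "evaluate l r (pfaffian S f) = 0"
    if S: "S \<subseteq> nodes 0 r" "card S = 2 * (n + 1)" and f: "f \<in> perfect_matchings (nodes 0 r - S)" for S f
  proof -
    obtain S' where S': "S' \<subseteq> ?V" "S = Inr ` S'" using S(1) unfolding nodes_0 by (metis subset_imageE)
    have "nodes 0 r - S = Inr ` (?V - S')" unfolding nodes_0 S'(2) by (simp add: image_set_diff)
    then have "f \<in> tag ` perfect_matchings (?V - S')" using f perfect_matchings_Inr by metis
    then obtain f' where f': "f' \<in> perfect_matchings (?V - S')" "f = tag f'" by blast
    have cS: "card S' = 2 * (n + 1)" using S(2) unfolding S'(2) by (simp add: card_image)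
    have "evaluate l r (pfaffian S f) = (\<Sum>m\<in>perfect_matchings S'. evaluate l r (diagram_vec (tag (m \<union> f'))))"
      unfolding S'(2) f'(2) pfaffian_tag evaluate_sum ..
    also have "\<dots> = (\<Sum>m\<in>perfect_matchings S'. of_int (coloured_sign ?V ?P c h (m \<union> f')))"
    proof (rule sum.cong[OF refl])
      fix m assume "m \<in> perfect_matchings S'"
      then have "tag (m \<union> f') \<in> diagrams 0 r" unfolding diagrams_0 
        using perfect_matchings_Un(1)[OF _ f'(1) S'(1)] by blast
      then show "evaluate l r (diagram_vec (tag (m \<union> f'))) = of_int (coloured_sign ?V ?P c h (m \<union> f'))"
        by (simp only: evaluate_diagram_vec l)
    qed
    also have "\<dots> = of_int (\<Sum>m\<in>perfect_matchings S'. coloured_sign ?V ?P c h (m \<union> f'))" by simp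
    also have "(\<Sum>m\<in>perfect_matchings S'. coloured_sign ?V ?P c h (m \<union> f')) = 0"
      by (rule coloured_sign_pfaffian[OF _ S'(1) cS f'(1) h(1) opener_iff[OF h(1)] c(1)]) simp_all
    finally show ?thesis by simp
  qed
  then have "evaluate l r w = 0"
    by (rule linear_functional_pfaffian_ideal[where \<phi> = "evaluate l r", OF evaluate_add evaluate_smult _ w(1)])
  moreover have "evaluate l r w = Poly_Mapping.lookup w (tag d0)"
  proof -
    have d0': "tag d0 \<in> diagrams 0 r" using d0(1) fifo_colourable_subset unfolding K_def diagrams_0 by blast
    \<comment> \<open>Another diagram in the support on which \<open>l\<close> is nonzero respects
      the colouring of \<open>d0\<close>, so its sum of products would be smaller, against the
      choice of \<open>d0\<close>.\<close>
    have "Poly_Mapping.lookup w D * l D = 0" if D: "D \<in> diagrams 0 r - {tag d0}" for D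
    proof (rule ccontr)
      assume nz: "Poly_Mapping.lookup w D * l D \<noteq> 0"
      then have "D \<in> Poly_Mapping.keys w" by (simp add: in_keys_iff)
      then obtain d where d: "D = tag d" "d \<in> fifo_colourable n r" using w(2) by blast
      then have "d \<in> K" using nz unfolding K_def by simp
      have "d \<noteq> d0" using D d(1) by auto
      have "respects_colouring ?V ?P c d"
        using nz unfolding d(1) l coloured_sign_def by (auto split: if_splits)
      then have "sum \<Prod> d < sum \<Prod> (strands ?V h)"
        by (intro fifo_triangular[OF _ h(1,3)]) (use d(2) fifo_colourable_subset \<open>d \<noteq> d0\<close> h(2) in auto)
      then show False using d0(2)[OF \<open>d \<in> K\<close>] h(2) by simp
    qed
    then have "(\<Sum>D\<in>diagrams 0 r - {tag d0}. Poly_Mapping.lookup w D * l D) = 0" by (intro sum.neutral ballI)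
    then have "evaluate l r w = Poly_Mapping.lookup w (tag d0) * l (tag d0)"
      unfolding evaluate_def 
      using sum.remove[OF finite_diagrams_0 d0', of "\<lambda>D. Poly_Mapping.lookup w D * l D"] by simp
    moreover have "coloured_sign ?V ?P c h (strands ?V h) = 1"
      by (rule coloured_sign_self[OF h(1)]) (rule opener_iff[OF h(1)] c(2); assumption)+
    then have "l (tag d0) = 1" unfolding l h(2) by simp
    ultimately show ?thesis by simp
  qed
  ultimately show False using d0(1) unfolding K_def by simp
qed


lemma pf_quotient_hom_ops:
  fixes x y :: "(nat + nat) set set \<Rightarrow>\<^sub>0 'k::field"
  assumes "x \<in> carrier (brauer_hom 0 r)"
  shows smult_pf_quotient: "a \<odot>\<^bsub>pf_quotient_hom n 0 r\<^esub> (pf_ideal n r +>\<^bsub>brauer_hom 0 r\<^esub> x) =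
      pf_ideal n r +>\<^bsub>brauer_hom 0 r\<^esub> Poly_Mapping.map ((*) a) x"
    and add_pf_quotient: "y \<in> carrier (brauer_hom 0 r) \<Longrightarrow>
      (pf_ideal n r +>\<^bsub>brauer_hom 0 r\<^esub> x) \<oplus>\<^bsub>pf_quotient_hom n 0 r\<^esub> (pf_ideal n r +>\<^bsub>brauer_hom 0 r\<^esub> y) =
      pf_ideal n r +>\<^bsub>brauer_hom 0 r\<^esub> (x + y)"
proof -
  interpret V: vectorspace class_ring "brauer_hom 0 r :: ('k, _) module"
    by (rule vectorspace_brauer_hom)
  note sub = submodule_pfaffian_ideal[of n 0 r, where ?'k = 'k]
  show "a \<odot>\<^bsub>pf_quotient_hom n 0 r\<^esub> (pf_ideal n r +>\<^bsub>brauer_hom 0 r\<^esub> x) =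
      pf_ideal n r +>\<^bsub>brauer_hom 0 r\<^esub> Poly_Mapping.map ((*) a) x"
    unfolding pf_quotient_hom_def using V.smult_quot_module[OF sub, of a x] assms by simp
  show "(pf_ideal n r +>\<^bsub>brauer_hom 0 r\<^esub> x) \<oplus>\<^bsub>pf_quotient_hom n 0 r\<^esub> (pf_ideal n r +>\<^bsub>brauer_hom 0 r\<^esub> y) =
      pf_ideal n r +>\<^bsub>brauer_hom 0 r\<^esub> (x + y)" if "y \<in> carrier (brauer_hom 0 r)"
    unfolding pf_quotient_hom_def using V.add_quot_module[OF sub, of x y] assms that by simp
qed

lemma carrier_pf_quotient:
  "carrier (pf_quotient_hom n 0 r) =
    (\<lambda>x. pf_ideal n r +>\<^bsub>brauer_hom 0 r\<^esub> x) ` carrier (brauer_hom 0 r :: ('k::field, _) module)"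
proof -
  interpret V: vectorspace class_ring "brauer_hom 0 r :: ('k, _) module"
    by (rule vectorspace_brauer_hom)
  show ?thesis
    unfolding pf_quotient_hom_def by (rule V.carrier_quot_module[OF submodule_pfaffian_ideal])
qed

lemma zero_pf_quotient: "\<zero>\<^bsub>pf_quotient_hom n 0 r\<^esub> = pf_ideal n r"
  by (simp add: pf_quotient_hom_def quot_module_def)

lemma diagram_vec_carrier: "d \<in> diagrams r s \<Longrightarrow> diagram_vec d \<in> carrier (brauer_hom r s)"
  by (simp add: diagram_vec_def)

lemma map_mult_single: "Poly_Mapping.map ((*) c) (Poly_Mapping.single d 1) = Poly_Mapping.single d (c :: 'k::field)"
  by (rule poly_mapping_eqI) (simp add: lookup_smult lookup_single when_def)

lemma sum_single_lookup:
  assumes "finite D" "Poly_Mapping.keys v \<subseteq> D"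
  shows "(\<Sum>d\<in>D. Poly_Mapping.single d (Poly_Mapping.lookup v d)) = v"
proof (rule poly_mapping_eqI)
  fix d
  have "Poly_Mapping.lookup (\<Sum>d\<in>D. Poly_Mapping.single d (Poly_Mapping.lookup v d)) d =
      (\<Sum>d'\<in>D. if d' = d then Poly_Mapping.lookup v d' else 0)"
    unfolding lookup_sum by (intro sum.cong) (simp_all add: lookup_single when_def)
  also have "\<dots> = Poly_Mapping.lookup v d"
    using assms by (auto simp: in_keys_iff)
  finally show "Poly_Mapping.lookup (\<Sum>d\<in>D. Poly_Mapping.single d (Poly_Mapping.lookup v d)) d = Poly_Mapping.lookup v d" .
qed

text \<open>Induction on the weight: a diagram with a crossing is a Pfaffian minus strictly lighter
  diagrams, all with coefficient one. An abstract \<open>U\<close> keeps the argument in the free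
  space; it will be the preimage of a span in the quotient.\<close>

lemma straightening:
  fixes U :: "((nat + nat) set set \<Rightarrow>\<^sub>0 'k::field) set"
  assumes ideal: "pf_ideal n r \<subseteq> U" and zero: "0 \<in> U"
    and add: "\<And>v w. v \<in> U \<Longrightarrow> w \<in> U \<Longrightarrow> v + w \<in> U"
    and smult: "\<And>c v. v \<in> U \<Longrightarrow> Poly_Mapping.map ((*) c) v \<in> U"
    and nc: "\<And>d. d \<in> noncrossing_diagrams (n + 1) r \<Longrightarrow> diagram_vec d \<in> U"
  shows "carrier (brauer_hom 0 r) \<subseteq> U"
proof -
  let ?V = "{1..r}"
  have sum: "sum v A \<in> U" if "\<And>x. x \<in> A \<Longrightarrow> v x \<in> U" for v :: "'i \<Rightarrow> _" and A
    using that by (induction A rule: infinite_finite_induct) (simp_all add: zero add)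
  have "Poly_Mapping.map ((*) (- 1)) x = - x" for x :: "(nat + nat) set set \<Rightarrow>\<^sub>0 'k"
    by (rule poly_mapping_eqI) (simp add: lookup_smult)
  then have minus: "v - w \<in> U" if "v \<in> U" "w \<in> U" for v w
    using add[OF that(1) smult[OF that(2), of "- 1"]] by simp
  have vec: "diagram_vec (tag d) \<in> U" if "d \<in> perfect_matchings ?V" for d
    using that
  proof (induction "sum (crossing_weight r) d" arbitrary: d rule: less_induct)
    case less
    show ?case
    proof (cases "crosses (n + 1) d")
      case False
      then show ?thesis using nc less.prems unfolding noncrossing_diagrams_tag by blast
    next
      case True
      then obtain as bs where "length as = n + 1" "length bs = n + 1" "sorted_wrt (<) (as @ bs)"
        "\<forall>i<n + 1. {as ! i, bs ! i} \<in> d" unfolding crosses_def by blast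
      then obtain S f m0 where S: "S \<subseteq> ?V" "card S = 2 * (n + 1)" "f \<in> perfect_matchings (?V - S)"
        "m0 \<in> perfect_matchings S" "d = m0 \<union> f" and smaller: "\<forall>m\<in>perfect_matchings S. m \<noteq> m0 \<longrightarrow>
          sum (crossing_weight r) (m \<union> f) < sum (crossing_weight r) d"
        using crossing_decomposition[OF less.prems, of r as "n + 1" bs] by auto
      have fin: "finite (perfect_matchings S)" using S(1) finite_subset by (intro finite_perfect_matchings) blast
      have "pfaffian (Inr ` S) (tag f) \<in> U"
      proof (rule subsetD[OF ideal pfaffian_in_ideal])
        show "Inr ` S \<subseteq> nodes 0 r" unfolding nodes_0 using S(1) by (rule image_mono)
        show "card (Inr ` S :: (nat + nat) set) = 2 * (n + 1)" using S(2) by (simp add: card_image)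
        have "nodes 0 r - Inr ` S = Inr ` (?V - S)" unfolding nodes_0 by (simp add: image_set_diff)
        then show "tag f \<in> perfect_matchings (nodes 0 r - Inr ` S)"
          using S(3) perfect_matchings_Inr by (metis imageI)
      qed
      moreover have "pfaffian (Inr ` S) (tag f) = diagram_vec (tag d) +
          (\<Sum>m\<in>perfect_matchings S - {m0}. diagram_vec (tag (m \<union> f)) :: _ \<Rightarrow>\<^sub>0 'k)"
        unfolding pfaffian_tag S(5) by (rule sum.remove[OF fin S(4)])
      moreover have "(\<Sum>m\<in>perfect_matchings S - {m0}. diagram_vec (tag (m \<union> f))) \<in> U"
      proof (rule sum)
        fix m assume m: "m \<in> perfect_matchings S - {m0}"
        show "diagram_vec (tag (m \<union> f)) \<in> U"
        proof (rule less.hyps)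
          show "sum (crossing_weight r) (m \<union> f) < sum (crossing_weight r) d" using smaller m by blast
          show "m \<union> f \<in> perfect_matchings ?V" using perfect_matchings_Un(1)[OF _ S(3,1)] m by blast
        qed
      qed
      ultimately show ?thesis using minus by (metis add_diff_cancel_right')
    qed
  qed
  show ?thesis
  proof
    fix v :: "(nat + nat) set set \<Rightarrow>\<^sub>0 'k"
    assume "v \<in> carrier (brauer_hom 0 r)"
    then have v: "Poly_Mapping.keys v \<subseteq> diagrams 0 r" by simp
    have "(\<Sum>d\<in>diagrams 0 r. Poly_Mapping.single d (Poly_Mapping.lookup v d)) \<in> U"
    proof (rule sum)
      fix D assume "D \<in> diagrams 0 r"
      then obtain d where d: "d \<in> perfect_matchings ?V" "D = tag d" unfolding diagrams_0 by blast
      have "Poly_Mapping.map ((*) (Poly_Mapping.lookup v D)) (diagram_vec (tag d)) \<in> U" by (rule smult[OF vec[OF d(1)]])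
      then show "Poly_Mapping.single D (Poly_Mapping.lookup v D) \<in> U" unfolding diagram_vec_def map_mult_single d(2) .
    qed
    then show "v \<in> U" unfolding sum_single_lookup[OF finite_diagrams_0 v] .
  qed
qed

text \<open>A basis is a set of vectors here, so the first conjunct adds that different diagrams
  have different classes.\<close>

theorem theorem7p4p24:
  fixes n r :: nat
  assumes "n \<ge> 1"
  shows "inj_on (diagram_class n 0 r :: _ \<Rightarrow> (_ \<Rightarrow>\<^sub>0 'k::field_char_0) set)
      (noncrossing_diagrams (n + 1) r) \<and>
    vectorspace.basis class_ring (pf_quotient_hom n 0 r :: ('k, _) module)
      (diagram_class n 0 r ` noncrossing_diagrams (n + 1) r)"
proof -
  let ?Q = "pf_quotient_hom n 0 r :: ('k, ((nat + nat) set set \<Rightarrow>\<^sub>0 'k) set) module"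
  let ?N = "pf_ideal n r :: ((nat + nat) set set \<Rightarrow>\<^sub>0 'k) set"
  let ?cls = "diagram_class n 0 r :: _ \<Rightarrow> (_ \<Rightarrow>\<^sub>0 'k) set"
  let ?coset = "\<lambda>v. ?N +>\<^bsub>brauer_hom 0 r\<^esub> v"
  let ?NC = "noncrossing_diagrams (n + 1) r"
  let ?FC = "tag ` fifo_colourable n r"
  interpret Q: vectorspace class_ring ?Q by (rule vectorspace_pf_quotient_hom)
  have NC: "?NC \<subseteq> diagrams 0 r" by (auto simp: noncrossing_diagrams_def)
  have FC: "?FC \<subseteq> diagrams 0 r" unfolding diagrams_0 using fifo_colourable_subset by (rule image_mono)
  have cls_carrier: "?cls d \<in> carrier ?Q" if "d \<in> diagrams 0 r" for d
    unfolding carrier_pf_quotient diagram_class_def using diagram_vec_carrier[OF that] by blast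
  have span: "Q.span (?cls ` ?NC) = carrier ?Q"
  proof
    have B: "?cls ` ?NC \<subseteq> carrier ?Q" using cls_carrier NC by blast
    show "Q.span (?cls ` ?NC) \<subseteq> carrier ?Q" by (rule Q.span_is_subset2[OF B])
    interpret W: LinearCombinations.submodule class_ring "Q.span (?cls ` ?NC)" ?Q
      by (rule Q.span_is_submodule[OF B])
    let ?U = "{v \<in> carrier (brauer_hom 0 r). ?coset v \<in> Q.span (?cls ` ?NC)}"
    have N_carrier: "?N \<subseteq> carrier (brauer_hom 0 r)"
      using LinearCombinations.submodule.subset[OF submodule_pfaffian_ideal] .
    interpret V: vectorspace class_ring "brauer_hom 0 r :: ('k, _) module"
      by (rule vectorspace_brauer_hom)
    have "carrier (brauer_hom 0 r) \<subseteq> ?U"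
    proof (rule straightening)
      show "?N \<subseteq> ?U"
      proof
        fix v assume v: "v \<in> ?N"
        then have "?coset v = \<zero>\<^bsub>?Q\<^esub>" unfolding zero_pf_quotient coset_pfaffian_ideal .
        then show "v \<in> ?U" using v N_carrier W.zero_closed by auto
      qed
      then show "0 \<in> ?U" using LinearCombinations.submodule.zero_closed[OF submodule_pfaffian_ideal[of n 0 r, where ?'k = 'k]] by auto
      show "v + w \<in> ?U" if "v \<in> ?U" "w \<in> ?U" for v w
        using W.m_closed[of "?coset v" "?coset w"] V.M.add.m_closed[of v w] add_pf_quotient[of v r w n] that by simp
      show "Poly_Mapping.map ((*) c) v \<in> ?U" if "v \<in> ?U" for c v
        using W.smult_closed[of c "?coset v"] V.smult_closed[of c v] smult_pf_quotient[of v r n c] that by simp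
      show "diagram_vec d \<in> ?U" if "d \<in> ?NC" for d
        using Q.in_own_span[OF B] diagram_vec_carrier[of d 0 r] NC that unfolding diagram_class_def by blast
    qed
    then show "carrier ?Q \<subseteq> Q.span (?cls ` ?NC)" unfolding carrier_pf_quotient by blast
  qed
  \<comment> \<open>Independence of a set of classes does not exclude that two diagrams share a
    class, so the number of classes has to be secured separately.\<close>
  have inj_FC: "inj_on ?cls ?FC"
  proof (rule inj_onI)
    fix d d' assume d: "d \<in> ?FC" "d' \<in> ?FC" and eq: "?cls d = ?cls d'"
    have "0 \<in> ?N" using LinearCombinations.submodule.zero_closed[OF submodule_pfaffian_ideal[of n 0 r, where ?'k = 'k]] by simp
    then have "diagram_vec d \<in> ?cls d" unfolding diagram_class_def coset_brauer_hom by (intro image_eqI[of _ _ 0]) simp_all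
    then obtain h where h: "h \<in> ?N" "diagram_vec d = h + diagram_vec d'"
      unfolding eq unfolding diagram_class_def coset_brauer_hom by blast
    then have "diagram_vec d - diagram_vec d' \<in> ?N" by simp
    moreover have "Poly_Mapping.keys (diagram_vec d - diagram_vec d' :: _ \<Rightarrow>\<^sub>0 'k) \<subseteq> ?FC"
      using Poly_Mapping.keys_diff[of "diagram_vec d" "diagram_vec d' :: _ \<Rightarrow>\<^sub>0 'k"] d by (auto simp: diagram_vec_def)
    ultimately have "diagram_vec d - diagram_vec d' = (0 :: _ \<Rightarrow>\<^sub>0 'k)" by (rule fifo_colourable_independent)
    then have "Poly_Mapping.lookup (diagram_vec d :: _ \<Rightarrow>\<^sub>0 'k) d = Poly_Mapping.lookup (diagram_vec d') d" by simp
    then show "d = d'" by (simp add: diagram_vec_def lookup_single when_def split: if_splits)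
  qed
  have indpt: "Q.lin_indpt (?cls ` ?FC)"
  proof
    assume "Q.lin_dep (?cls ` ?FC)"
    then obtain A a v where A: "finite A" "A \<subseteq> ?cls ` ?FC" "Q.lincomb a A = \<zero>\<^bsub>?Q\<^esub>" "v \<in> A" "a v \<noteq> 0"
      unfolding Q.lin_dep_def by auto
    obtain D where D: "D \<subseteq> ?FC" "A = ?cls ` D" using A(2) by (metis subset_imageE)
    have inj: "inj_on ?cls D" using inj_FC D(1) by (rule inj_on_subset)
    have "finite D" using A(1) inj unfolding D(2) by (rule finite_imageD)
    \<comment> \<open>A linear combination of classes is the class of the corresponding vector of
      the free space; injectivity on \<open>D\<close> gives each diagram its own
      coefficient.\<close>
    have lc: "Q.lincomb a (?cls ` E) = ?coset (\<Sum>d\<in>E. Poly_Mapping.single d (a (?cls d)))"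
      if "E \<subseteq> D" "finite E" for E
      using that(2,1)
    proof (induction E)
      case empty
      have "0 \<in> ?N" using LinearCombinations.submodule.zero_closed[OF submodule_pfaffian_ideal[of n 0 r, where ?'k = 'k]] by simp
      then have "?coset 0 = ?N" unfolding coset_pfaffian_ideal .
      then show ?case by (simp add: Q.lincomb_def zero_pf_quotient)
    next
      case (insert d E)
      have d: "d \<in> diagrams 0 r" "E \<subseteq> diagrams 0 r" using insert.prems D(1) FC by blast+
      have new: "?cls d \<notin> ?cls ` E" using insert.hyps insert.prems inj by (auto dest: inj_onD)
      have "Q.lincomb a (?cls ` insert d E) = a (?cls d) \<odot>\<^bsub>?Q\<^esub> ?cls d \<oplus>\<^bsub>?Q\<^esub> Q.lincomb a (?cls ` E)"
        unfolding Q.lincomb_def image_insert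
        by (rule Q.M.finsum_insert) (use new insert.hyps cls_carrier d Q.smult_closed in auto)
      also have "a (?cls d) \<odot>\<^bsub>?Q\<^esub> ?cls d = ?coset (Poly_Mapping.single d (a (?cls d)))"
        unfolding diagram_class_def smult_pf_quotient[OF diagram_vec_carrier[OF d(1)]]
        unfolding diagram_vec_def map_mult_single ..
      also have "Q.lincomb a (?cls ` E) = ?coset (\<Sum>d\<in>E. Poly_Mapping.single d (a (?cls d)))"
        using insert.IH insert.prems by simp
      also have "?coset (Poly_Mapping.single d (a (?cls d))) \<oplus>\<^bsub>?Q\<^esub> ?coset (\<Sum>d\<in>E. Poly_Mapping.single d (a (?cls d))) =
          ?coset (Poly_Mapping.single d (a (?cls d)) + (\<Sum>d\<in>E. Poly_Mapping.single d (a (?cls d))))"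
      proof (rule add_pf_quotient)
        show "Poly_Mapping.single d (a (?cls d)) \<in> carrier (brauer_hom 0 r)" using d(1) by simp
        have "Poly_Mapping.keys (\<Sum>d\<in>E. Poly_Mapping.single d (a (?cls d))) \<subseteq> diagrams 0 r"
          by (rule order.trans[OF Poly_Mapping.keys_sum]) (use d(2) in \<open>auto split: if_splits\<close>)
        then show "(\<Sum>d\<in>E. Poly_Mapping.single d (a (?cls d))) \<in> carrier (brauer_hom 0 r)" by simp
      qed
      finally show ?case using insert.hyps by simp
    qed
    define w where "w = (\<Sum>d\<in>D. Poly_Mapping.single d (a (?cls d)))"
    have "?coset w = ?N" using lc[OF order.refl \<open>finite D\<close>] A(3) unfolding D(2) w_def zero_pf_quotient by simp
    then have "w \<in> ?N" unfolding coset_pfaffian_ideal .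
    moreover have "Poly_Mapping.keys w \<subseteq> ?FC" unfolding w_def
      by (rule order.trans[OF Poly_Mapping.keys_sum]) (use D(1) in \<open>auto split: if_splits\<close>)
    ultimately have "w = 0" by (rule fifo_colourable_independent)
    obtain d where d: "d \<in> D" "v = ?cls d" using A(4) unfolding D(2) by blast
    have "Poly_Mapping.lookup w d = (\<Sum>d'\<in>D. if d' = d then a (?cls d') else 0)"
      unfolding w_def lookup_sum by (intro sum.cong) (simp_all add: lookup_single when_def)
    then have "Poly_Mapping.lookup w d = a v" using d \<open>finite D\<close> by simp
    then show False using A(5) \<open>w = 0\<close> by simp
  qed
  have fin: "finite ?NC" "finite ?FC" using NC FC finite_diagrams_0 finite_subset by blast+
  have "card ?NC \<le> card ?FC"
  proof -
    have "card ?NC = card {d \<in> perfect_matchings {1..r}. \<not> crosses (n + 1) d}"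
      unfolding noncrossing_diagrams_tag by (rule card_image[OF inj_on_subset[OF inj_tag]]) simp
    also have "\<dots> \<le> card (fifo_colourable n r)" by (rule card_noncrossing_le)
    also have "\<dots> = card ?FC" by (rule card_image[OF inj_on_subset[OF inj_tag], symmetric]) simp
    finally show ?thesis .
  qed
  also have "card ?FC = card (?cls ` ?FC)" using inj_FC by (simp add: card_image)
  finally have le: "card ?NC \<le> card (?cls ` ?FC)" .
  have sub: "?cls ` ?FC \<subseteq> carrier ?Q" "?cls ` ?NC \<subseteq> carrier ?Q" using cls_carrier NC FC by blast+
  have fd: "Q.fin_dim" unfolding Q.fin_dim_def using fin(1) sub(2) span by blast
  have dim: "card (?cls ` ?FC) \<le> Q.dim" by (rule Q.li_le_dim(2)[OF fd sub(1) indpt])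
  \<comment> \<open>This closes the chain \<open>card ?NC \<le> card (?cls\<close> ?FC) \<le> Q.dim
    \<le> card (?cls \<open>?NC) \<le> card ?NC\<close>. Equality throughout makes the noncrossing
    classes distinct and the spanning set they form as small as the dimension.\<close>
  have "Q.dim \<le> card (?cls ` ?NC)" by (rule Q.gen_ge_dim) (use fin(1) sub(2) span in auto)
  moreover have "card (?cls ` ?NC) \<le> card ?NC" by (rule card_image_le[OF fin(1)])
  ultimately have "card (?cls ` ?NC) = card ?NC" "card (?cls ` ?NC) = Q.dim" using le dim by linarith+
  then have "inj_on ?cls ?NC" "Q.basis (?cls ` ?NC)"
    using fin(1) sub(2) span by (auto intro: eq_card_imp_inj_on Q.dim_gen_is_basis)
  then show ?thesis ..
qed

end
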